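(* Let $T=\langle a,b,c\mid a^2=b^2=c^2=(ab)^3=(bc)^3=(ca)^3=1\rangle$ be the $(3,3,3)$ triangle group. Then $T$ is virtually a hierarchically hyperbolic group (it has a finite-index subgroup that admits an HHG structure), but $T$ does not admit any hierarchically hyperbolic group structure. In particular, $T$ (with a word metric) is a hierarchically hyperbolic space but $T$ is not a hierarchically hyperbolic group.
   Context: **Hierarchically hyperbolic spaces (HHSs).** Let $X$ be a quasigeodesic metric space. An HHS structure $(X,\mathfrak S)$ consists of a set $\mathfrak S$ of *domains*, a constant $E\ge 1$, and for each $U\in\mathfrak S$ a geodesic $E$-hyperbolic space $\mathcal C U$, with the following data and axioms. (Distance between sets means infimal distance. One writes $d_U$ for distance in $\mathcal C U$ and suppresses $\pi_U$: $d_U(x,y)=d_{\mathcal C U}(\pi_U(x),\pi_U(y))$ for $x,y\in X$, $d_U(x,A)=d_{\mathcal C U}(\pi_U(x),A)$ for $A\subseteq\mathcal C U$.) 1. *Projections.* Maps $\pi_U:X\to\mathcal C U$ with $d_U(x,y)\le E\,d_X(x,y)+E$, and every point of $\mathcal C U$ is within $E$ of $\pi_U(X)$. 2. *Nesting.* A partial order $\sqsubseteq$ on $\mathfrak S$ with a unique maximal element (if $\mathfrak S\neq\varnothing$). $V\sqsubset W$ means $V\sqsubseteq W$, $V\ne W$ ("properly nested"). $\mathfrak S_W=\{V:V\sqsubseteq W\}$. If $V\sqsubset W$ there are a specified nonempty $\rho^V_W\subseteq\mathcal C W$ of diameter $\le E$ and a map $\rho^W_V:\mathcal C W\to 2^{\mathcal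 C V}$. 3. *Orthogonality.* A symmetric antireflexive relation $\bot$. If $V\sqsubseteq W$ and $W\bot U$ then $V\bot U$. If $V\bot W$ then $V,W$ are not $\sqsubseteq$-comparable. For each $T\in\mathfrak S$ and $U\in\mathfrak S_T$ with $\{V\in\mathfrak S_T:V\bot U\}\ne\varnothing$ there is $W\in\mathfrak S_T\smallsetminus\{T\}$ such that $V\sqsubseteq W$ whenever $V\in\mathfrak S_T$, $V\bot U$. 4. *Transversality and consistency.* If $V,W$ are distinct, not orthogonal and not $\sqsubseteq$-comparable they are *transverse*, $V\pitchfork W$; then there are nonempty sets $\rho^V_W\subseteq\mathcal C W$, $\rho^W_V\subseteq\mathcal C V$ of diameter $\le E$ with $\min\{d_W(x,\rho^V_W),d_V(x,\rho^W_V)\}\le E$ for all $x\in X$. If $V\sqsubset W$ then $\min\{d_W(x,\rho^V_W),\operatorname{diam}(\{\pi_V(x)\}\cup\rho^W_V(\pi_W(x)))\}\le E$ for all $x\in X$. If $U\sqsubseteq V$ then $d_W(\rho^U_W,\rho^V_W)\le E$ whenever $V\sqsubset W$, or $V\pitchfork W$ and $W\not\perp U$. 5. *Finite complexity.* The cardinality of $\sqsubseteq$-chains is bounded; the maximum is the *complexity*. 6. *Large links.* For $W\in\mathfrak S$, $x,x'\in X$ let $N=E\,d_W(x,x')+E$. There are $T_1,\dots,T_{\lfloor N\rfloor}\in\mathfrak S_W\smallsetminus\{W\}$ such that each $T\in\mathfrak S_W\smallsetminus\{W\}$ is nested in some $T_i$ or has $d_T(x,x')<E$; and $d_W(x,\rho^{T_i}_W)\le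 N$ for all $i$. 7. *Bounded geodesic image.* If $V\sqsubset W$ and $\gamma$ is a geodesic of $\mathcal C W$, then $\operatorname{diam}\rho^W_V(\gamma)\le E$ or $\gamma$ meets the $E$-neighbourhood of $\rho^V_W$. Moreover if $y,z\in X$ have $d_V(y,z)>E$ then $\rho^V_W$ is $E$-close to every geodesic $[\pi_W(y),\pi_W(z)]$. 8. *Partial realisation.* If $\{W_i\}$ are pairwise orthogonal and $p_i\in\mathcal C W_i$, there is $x\in X$ with $d_{W_i}(x,p_i)\le E$ for all $i$ and $d_V(x,\rho^{W_i}_V)\le E$ whenever $W_i\sqsubset V$ or $W_i\pitchfork V$. 9. *Uniqueness.* For each $\kappa$ there is $\theta_u(\kappa)$ such that if $d_X(x,y)>\theta_u(\kappa)$ then $d_U(x,y)>\kappa$ for some $U\in\mathfrak S$. **Hierarchically hyperbolic groups (HHGs).** A finitely generated group $G$ with an HHS structure $(G,\mathfrak S)$ on $G$ (with a word metric) is an HHG if: $G$ acts on $\mathfrak S$ with finitely many orbits, preserving $\sqsubseteq,\bot,\pitchfork$; for $g\in G$, $U\in\mathfrak S$ there is an isometry $g:\mathcal C U\to\mathcal C gU$, with the isometry of a product $gh$ equal to the composition; and $g\pi_U(x)=\pi_{gU}(gx)$, $g\rho^V_U=\rho^{gV}_{gU}$ for all $g,x\in G$ and $U,V$ with $U\pitchfork V$ or $V\sqsubset U$. By cofiniteness, $E$ is also chosen so that $\operatorname{diam}\mathcal C U>E$ implies $\operatorname{diam}\mathcal C U=\infty$. *)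

theory Defs
  imports "HOL-Analysis.Analysis" "HOL-Algebra.Group_Action" "HOL-Algebra.Generated_Groups"
begin

section \<open>Metric notions\<close>

text \<open>Infimal distance and diameter take extended real values, so that an unbounded set has
  diameter \<open>\<infinity>\<close> and the distance to the empty set is \<open>\<infinity>\<close> (the empty set has diameter \<open>-\<infinity>\<close>).\<close>

definition msetdist :: "'a metric \<Rightarrow> 'a set \<Rightarrow> 'a set \<Rightarrow> ereal" where
  "msetdist m A B = (INF x\<in>A. INF y\<in>B. ereal (mdist m x y))"

definition mdiam :: "'a metric \<Rightarrow> 'a set \<Rightarrow> ereal" where
  "mdiam m A = (SUP x\<in>A. SUP y\<in>A. ereal (mdist m x y))"

definition geodesic_path :: "'a metric \<Rightarrow> 'a \<Rightarrow> 'a \<Rightarrow> (real \<Rightarrow> 'a) \<Rightarrow> bool" where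
  "geodesic_path m x y \<gamma> \<longleftrightarrow>
     \<gamma> ` {0..mdist m x y} \<subseteq> mspace m \<and> \<gamma> 0 = x \<and> \<gamma> (mdist m x y) = y \<and>
     (\<forall>s\<in>{0..mdist m x y}. \<forall>t\<in>{0..mdist m x y}. mdist m (\<gamma> s) (\<gamma> t) = \<bar>s - t\<bar>)"

definition geodesic_segment :: "'a metric \<Rightarrow> 'a \<Rightarrow> 'a \<Rightarrow> 'a set \<Rightarrow> bool" where
  "geodesic_segment m x y P \<longleftrightarrow>
     x \<in> mspace m \<and> y \<in> mspace m \<and> (\<exists>\<gamma>. geodesic_path m x y \<gamma> \<and> P = \<gamma> ` {0..mdist m x y})"

definition geodesic_metric :: "'a metric \<Rightarrow> bool" where
  "geodesic_metric m \<longleftrightarrow> (\<forall>x\<in>mspace m. \<forall>y\<in>mspace m. \<exists>P. geodesic_segment m x y P)"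

text \<open>Hyperbolicity of a geodesic space is Rips' condition: geodesic triangles are thin.\<close>

definition hyperbolic_metric :: "real \<Rightarrow> 'a metric \<Rightarrow> bool" where
  "hyperbolic_metric \<delta> m \<longleftrightarrow>
     (\<forall>x y z P Q R. geodesic_segment m x y P \<and> geodesic_segment m y z Q \<and> geodesic_segment m z x R
        \<longrightarrow> (\<forall>p\<in>P. \<exists>q\<in>Q \<union> R. mdist m p q \<le> \<delta>))"

definition quasigeodesic_metric :: "'a metric \<Rightarrow> bool" where
  "quasigeodesic_metric m \<longleftrightarrow>
     (\<exists>K\<ge>1. \<forall>x\<in>mspace m. \<forall>y\<in>mspace m. \<exists>l\<ge>0. \<exists>\<gamma>.
        \<gamma> ` {0..l} \<subseteq> mspace m \<and> \<gamma> 0 = x \<and> \<gamma> l = y \<and>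
        (\<forall>s\<in>{0..l}. \<forall>t\<in>{0..l}.
           \<bar>s - t\<bar> / K - K \<le> mdist m (\<gamma> s) (\<gamma> t) \<and> mdist m (\<gamma> s) (\<gamma> t) \<le> K * \<bar>s - t\<bar> + K))"


section \<open>Hierarchically hyperbolic spaces\<close>

text \<open>
  \<open>rho S V W\<close> is the set $\rho^V_W \subseteq \mathcal C W$, relevant if $V \sqsubset W$ or
  $V \pitchfork W$; \<open>rho_map S W V\<close> is the map
  $\rho^W_V : \mathcal C W \to 2^{\mathcal C V}$, relevant if $V \sqsubset W$.  All the spaces
  $\mathcal C U$ have their points in one type, but need not be disjoint or related.\<close>

record ('x, 'd, 'c) hhs =
  domains :: "'d set"
  hconst :: real
  cspace :: "'d \<Rightarrow> 'c metric"
  cproj :: "'d \<Rightarrow> 'x \<Rightarrow> 'c"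
  nested :: "'d \<Rightarrow> 'd \<Rightarrow> bool"
  orth :: "'d \<Rightarrow> 'd \<Rightarrow> bool"
  rho :: "'d \<Rightarrow> 'd \<Rightarrow> 'c set"
  rho_map :: "'d \<Rightarrow> 'd \<Rightarrow> 'c \<Rightarrow> 'c set"

definition properly_nested :: "('x, 'd, 'c) hhs \<Rightarrow> 'd \<Rightarrow> 'd \<Rightarrow> bool" where
  "properly_nested S V W \<longleftrightarrow> nested S V W \<and> V \<noteq> W"

definition transverse :: "('x, 'd, 'c) hhs \<Rightarrow> 'd \<Rightarrow> 'd \<Rightarrow> bool" where
  "transverse S V W \<longleftrightarrow> V \<noteq> W \<and> \<not> orth S V W \<and> \<not> nested S V W \<and> \<not> nested S W V"

definition domains_in :: "('x, 'd, 'c) hhs \<Rightarrow> 'd \<Rightarrow> 'd set" where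
  "domains_in S W = {V \<in> domains S. nested S V W}"

definition cdist :: "('x, 'd, 'c) hhs \<Rightarrow> 'd \<Rightarrow> 'x \<Rightarrow> 'x \<Rightarrow> real" where
  "cdist S U x y = mdist (cspace S U) (cproj S U x) (cproj S U y)"

definition csetdist :: "('x, 'd, 'c) hhs \<Rightarrow> 'd \<Rightarrow> 'x \<Rightarrow> 'c set \<Rightarrow> ereal" where
  "csetdist S U x A = msetdist (cspace S U) {cproj S U x} A"

locale hhs_structure =
  fixes X :: "'x metric" and S :: "('x, 'd, 'c) hhs"
  assumes quasigeodesic: "quasigeodesic_metric X"
    and const_ge_1: "hconst S \<ge> 1"
    and geodesic: "U \<in> domains S \<Longrightarrow> geodesic_metric (cspace S U)"
    and hyperbolic: "U \<in> domains S \<Longrightarrow> hyperbolic_metric (hconst S) (cspace S U)"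
    and proj_in: "\<lbrakk>U \<in> domains S; x \<in> mspace X\<rbrakk> \<Longrightarrow> cproj S U x \<in> mspace (cspace S U)"
    and proj_lipschitz: "\<lbrakk>U \<in> domains S; x \<in> mspace X; y \<in> mspace X\<rbrakk>
      \<Longrightarrow> cdist S U x y \<le> hconst S * mdist X x y + hconst S"
    and proj_coarsely_onto: "\<lbrakk>U \<in> domains S; p \<in> mspace (cspace S U)\<rbrakk>
      \<Longrightarrow> msetdist (cspace S U) {p} (cproj S U ` mspace X) \<le> hconst S"
    and nested_refl: "U \<in> domains S \<Longrightarrow> nested S U U"
    and nested_antisym: "\<lbrakk>U \<in> domains S; V \<in> domains S; nested S U V; nested S V U\<rbrakk> \<Longrightarrow> U = V"
    and nested_trans: "\<lbrakk>U \<in> domains S; V \<in> domains S; W \<in> domains S; nested S U V; nested S V W\<rbrakk>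
      \<Longrightarrow> nested S U W"
    and nested_max: "domains S \<noteq> {}
      \<Longrightarrow> \<exists>!M. M \<in> domains S \<and> (\<forall>V\<in>domains S. \<not> properly_nested S M V)"
    and rho_nested: "\<lbrakk>V \<in> domains S; W \<in> domains S; properly_nested S V W\<rbrakk>
      \<Longrightarrow> rho S V W \<noteq> {} \<and> rho S V W \<subseteq> mspace (cspace S W) \<and>
          mdiam (cspace S W) (rho S V W) \<le> hconst S"
    and rho_map_in: "\<lbrakk>V \<in> domains S; W \<in> domains S; properly_nested S V W; p \<in> mspace (cspace S W)\<rbrakk>
      \<Longrightarrow> rho_map S W V p \<subseteq> mspace (cspace S V)"
    and orth_sym: "\<lbrakk>V \<in> domains S; W \<in> domains S; orth S V W\<rbrakk> \<Longrightarrow> orth S W V"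
    and orth_irrefl: "V \<in> domains S \<Longrightarrow> \<not> orth S V V"
    and orth_nested: "\<lbrakk>U \<in> domains S; V \<in> domains S; W \<in> domains S; nested S V W; orth S W U\<rbrakk>
      \<Longrightarrow> orth S V U"
    and orth_incomparable: "\<lbrakk>V \<in> domains S; W \<in> domains S; orth S V W\<rbrakk>
      \<Longrightarrow> \<not> nested S V W \<and> \<not> nested S W V"
    and container: "\<lbrakk>T \<in> domains S; U \<in> domains_in S T; {V \<in> domains_in S T. orth S V U} \<noteq> {}\<rbrakk>
      \<Longrightarrow> \<exists>W \<in> domains_in S T - {T}. \<forall>V \<in> domains_in S T. orth S V U \<longrightarrow> nested S V W"
    and rho_transverse: "\<lbrakk>V \<in> domains S; W \<in> domains S; transverse S V W\<rbrakk>
      \<Longrightarrow> rho S V W \<noteq> {} \<and> rho S V W \<subseteq> mspace (cspace S W) \<and>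
          mdiam (cspace S W) (rho S V W) \<le> hconst S"
    and consistency_transverse:
      "\<lbrakk>V \<in> domains S; W \<in> domains S; transverse S V W; x \<in> mspace X\<rbrakk>
      \<Longrightarrow> min (csetdist S W x (rho S V W)) (csetdist S V x (rho S W V)) \<le> hconst S"
    and consistency_nested:
      "\<lbrakk>V \<in> domains S; W \<in> domains S; properly_nested S V W; x \<in> mspace X\<rbrakk>
      \<Longrightarrow> min (csetdist S W x (rho S V W))
            (mdiam (cspace S V) ({cproj S V x} \<union> rho_map S W V (cproj S W x))) \<le> hconst S"
    and consistency_rho:
      "\<lbrakk>U \<in> domains S; V \<in> domains S; W \<in> domains S; nested S U V;
        properly_nested S V W \<or> (transverse S V W \<and> \<not> orth S W U)\<rbrakk>
      \<Longrightarrow> msetdist (cspace S W) (rho S U W) (rho S V W) \<le> hconst S"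
    and finite_complexity: "\<exists>n. \<forall>C \<subseteq> domains S.
      (\<forall>U\<in>C. \<forall>V\<in>C. nested S U V \<or> nested S V U) \<longrightarrow> finite C \<and> card C \<le> n"
    \<comment> \<open>large links: a family of domains with at most \<open>\<lfloor>N\<rfloor>\<close> members; possibly none, as
      is forced if \<open>W\<close> is minimal\<close>
    and large_links: "\<lbrakk>W \<in> domains S; x \<in> mspace X; x' \<in> mspace X;
        N = hconst S * cdist S W x x' + hconst S\<rbrakk>
      \<Longrightarrow> \<exists>\<T> \<subseteq> domains_in S W - {W}. finite \<T> \<and> int (card \<T>) \<le> \<lfloor>N\<rfloor> \<and>
            (\<forall>V \<in> domains_in S W - {W}. (\<exists>T\<in>\<T>. nested S V T) \<or> cdist S V x x' < hconst S) \<and>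
            (\<forall>T\<in>\<T>. csetdist S W x (rho S T W) \<le> N)"
    and bounded_geodesic_image:
      "\<lbrakk>V \<in> domains S; W \<in> domains S; properly_nested S V W; geodesic_segment (cspace S W) p q \<gamma>\<rbrakk>
      \<Longrightarrow> mdiam (cspace S V) (\<Union>r\<in>\<gamma>. rho_map S W V r) \<le> hconst S \<or>
          (\<exists>r\<in>\<gamma>. msetdist (cspace S W) {r} (rho S V W) \<le> hconst S)"
    and bounded_geodesic_image':
      "\<lbrakk>V \<in> domains S; W \<in> domains S; properly_nested S V W; y \<in> mspace X; z \<in> mspace X;
        cdist S V y z > hconst S; geodesic_segment (cspace S W) (cproj S W y) (cproj S W z) \<gamma>\<rbrakk>
      \<Longrightarrow> msetdist (cspace S W) (rho S V W) \<gamma> \<le> hconst S"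
    and partial_realisation:
      "\<lbrakk>\<W> \<subseteq> domains S; pairwise (orth S) \<W>; \<And>W. W \<in> \<W> \<Longrightarrow> f W \<in> mspace (cspace S W)\<rbrakk>
      \<Longrightarrow> \<exists>x \<in> mspace X. \<forall>W\<in>\<W>. csetdist S W x {f W} \<le> hconst S \<and>
            (\<forall>V\<in>domains S. properly_nested S W V \<or> transverse S W V
               \<longrightarrow> csetdist S V x (rho S W V) \<le> hconst S)"
    and uniqueness: "\<exists>\<theta>. \<forall>x\<in>mspace X. \<forall>y\<in>mspace X. mdist X x y > \<theta>
      \<longrightarrow> (\<exists>U\<in>domains S. cdist S U x y > \<kappa>)"

text \<open>The types holding the domains and the points of the hyperbolic spaces are parameters, since
  one cannot quantify over types inside a formula.\<close>

definition hierarchically_hyperbolic_space ::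
  "'d itself \<Rightarrow> 'c itself \<Rightarrow> 'x metric \<Rightarrow> bool" where
  "hierarchically_hyperbolic_space _ _ X \<longleftrightarrow> (\<exists>S :: ('x, 'd, 'c) hhs. hhs_structure X S)"

lemma (in hhs_structure) hhs_structure_mono:
  assumes le: "hconst S \<le> e"
  shows "hhs_structure X (S\<lparr>hconst := e\<rparr>)"
proof -
  let ?S = "S\<lparr>hconst := e\<rparr>"
  have sel: "domains ?S = domains S" "hconst ?S = e" "cspace ?S = cspace S" "cproj ?S = cproj S"
    "nested ?S = nested S" "orth ?S = orth S" "rho ?S = rho S" "rho_map ?S = rho_map S"
    "properly_nested ?S = properly_nested S" "transverse ?S = transverse S"
    "domains_in ?S = domains_in S" "cdist ?S = cdist S" "csetdist ?S = csetdist S"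
    by (simp_all add: fun_eq_iff properly_nested_def transverse_def domains_in_def cdist_def
        csetdist_def)
  have tr: "a \<le> ereal e" if "a \<le> ereal (hconst S)" for a
    using that le by (meson ereal_less_eq(3) order_trans)
  have mul: "hconst S * r + hconst S \<le> e * r + e" if "r \<ge> 0" for r
    using le that by (simp add: add_mono mult_right_mono)
  show ?thesis
  proof (unfold_locales, unfold sel)
    show "hyperbolic_metric e (cspace S U)" if "U \<in> domains S" for U
      using hyperbolic[OF that] le unfolding hyperbolic_metric_def by (meson order_trans)
    show "cdist S U x y \<le> e * mdist X x y + e"
      if "U \<in> domains S" "x \<in> mspace X" "y \<in> mspace X" for U x y
      using proj_lipschitz[OF that] mul[of "mdist X x y"] by simp
    show "\<exists>\<T>\<subseteq>domains_in S W - {W}. finite \<T> \<and> int (card \<T>) \<le> \<lfloor>N\<rfloor> \<and>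
            (\<forall>V\<in>domains_in S W - {W}. (\<exists>T\<in>\<T>. nested S V T) \<or> cdist S V x x' < e) \<and>
            (\<forall>T\<in>\<T>. csetdist S W x (rho S T W) \<le> ereal N)"
      if W: "W \<in> domains S" "x \<in> mspace X" "x' \<in> mspace X" and N: "N = e * cdist S W x x' + e"
      for W x x' N
    proof -
      let ?M = "hconst S * cdist S W x x' + hconst S"
      have M: "?M \<le> N" using N mul[of "cdist S W x x'"] by (simp add: cdist_def)
      obtain \<T> where T: "\<T> \<subseteq> domains_in S W - {W}" "finite \<T>" "int (card \<T>) \<le> \<lfloor>?M\<rfloor>"
        "\<forall>V\<in>domains_in S W - {W}. (\<exists>T\<in>\<T>. nested S V T) \<or> cdist S V x x' < hconst S"
        "\<forall>T\<in>\<T>. csetdist S W x (rho S T W) \<le> ereal ?M"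
        using large_links[OF W HOL.refl] by blast
      have "int (card \<T>) \<le> \<lfloor>N\<rfloor>" using T(3) floor_mono[OF M] by linarith
      moreover have "csetdist S W x (rho S T W) \<le> ereal N" if "T \<in> \<T>" for T
        using T(5) that M by (meson ereal_less_eq(3) order_trans)
      moreover have "(\<exists>T\<in>\<T>. nested S V T) \<or> cdist S V x x' < e" if "V \<in> domains_in S W - {W}" for V
        using T(4) that le by fastforce
      ultimately show ?thesis using T(1,2) by blast
    qed
    show "\<exists>x\<in>mspace X. \<forall>W\<in>\<W>. csetdist S W x {f W} \<le> ereal e \<and>
        (\<forall>V\<in>domains S. properly_nested S W V \<or> transverse S W V \<longrightarrow>
          csetdist S V x (rho S W V) \<le> ereal e)"
      if "\<W> \<subseteq> domains S" "pairwise (orth S) \<W>" "\<And>W. W \<in> \<W> \<Longrightarrow> f W \<in> mspace (cspace S W)"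
      for \<W> f
      using partial_realisation[OF that] tr by meson
    show "mdiam (cspace S V) (\<Union> (rho_map S W V ` \<gamma>)) \<le> ereal e \<or>
        (\<exists>r\<in>\<gamma>. msetdist (cspace S W) {r} (rho S V W) \<le> ereal e)"
      if "V \<in> domains S" "W \<in> domains S" "properly_nested S V W"
        "geodesic_segment (cspace S W) p q \<gamma>" for V W p q \<gamma>
      using bounded_geodesic_image[OF that] tr by blast
    show "msetdist (cspace S W) (rho S V W) \<gamma> \<le> ereal e"
      if "V \<in> domains S" "W \<in> domains S" "properly_nested S V W" "y \<in> mspace X" "z \<in> mspace X"
        "e < cdist S V y z" "geodesic_segment (cspace S W) (cproj S W y) (cproj S W z) \<gamma>"
      for V W y z \<gamma>
      using bounded_geodesic_image'[OF that(1-5) _ that(7)] that(6) le tr by force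
    show "1 \<le> e" using const_ge_1 le by simp
    show "rho S V W \<noteq> {} \<and> rho S V W \<subseteq> mspace (cspace S W) \<and>
        mdiam (cspace S W) (rho S V W) \<le> ereal e"
      if "V \<in> domains S" "W \<in> domains S" "properly_nested S V W" for V W
      using rho_nested[OF that] tr by blast
    show "rho S V W \<noteq> {} \<and> rho S V W \<subseteq> mspace (cspace S W) \<and>
        mdiam (cspace S W) (rho S V W) \<le> ereal e"
      if "V \<in> domains S" "W \<in> domains S" "transverse S V W" for V W
      using rho_transverse[OF that] tr by blast
  qed ((rule quasigeodesic finite_complexity uniqueness)
      | (rule nested_max geodesic proj_in nested_refl rho_map_in orth_sym orth_irrefl
          orth_incomparable container; assumption)
      | (rule tr, rule proj_coarsely_onto consistency_transverse consistency_nested consistency_rho;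
          assumption)
      | (erule (4) nested_trans) | (erule (3) nested_antisym) | (erule (4) orth_nested))+
qed


section \<open>Word metrics\<close>

definition finite_generating_set :: "('g, 'm) monoid_scheme \<Rightarrow> 'g set \<Rightarrow> bool" where
  "finite_generating_set G A \<longleftrightarrow> finite A \<and> A \<subseteq> carrier G \<and> generate G A = carrier G"

definition word_length :: "('g, 'm) monoid_scheme \<Rightarrow> 'g set \<Rightarrow> 'g \<Rightarrow> nat" where
  "word_length G A g =
     (LEAST n. \<exists>w. length w = n \<and> set w \<subseteq> A \<union> m_inv G ` A \<and> foldr (mult G) w (one G) = g)"

text \<open>Off the carrier the value is set to 0, as \<^typ>\<open>'g metric\<close> needs a distance function that is
  symmetric and nonnegative on the whole type.\<close>

definition word_dist :: "('g, 'm) monoid_scheme \<Rightarrow> 'g set \<Rightarrow> 'g \<Rightarrow> 'g \<Rightarrow> real" where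
  "word_dist G A x y =
     (if x \<in> carrier G \<and> y \<in> carrier G then real (word_length G A (m_inv G x \<otimes>\<^bsub>G\<^esub> y)) else 0)"

definition word_metric :: "('g, 'm) monoid_scheme \<Rightarrow> 'g set \<Rightarrow> 'g metric" where
  "word_metric G A = metric (carrier G, word_dist G A)"

lemma (in group) word_closed:
  assumes "A \<subseteq> carrier G" "set w \<subseteq> A \<union> m_inv G ` A"
  shows "foldr (mult G) w \<one> \<in> carrier G"
  using assms(2,1) by (induction w) auto

lemma (in group) word_append:
  assumes "A \<subseteq> carrier G" "set u \<subseteq> A \<union> m_inv G ` A" "set v \<subseteq> A \<union> m_inv G ` A"
  shows "foldr (mult G) (u @ v) \<one> = foldr (mult G) u \<one> \<otimes> foldr (mult G) v \<one>"
  using assms(2)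
proof (induction u)
  case Nil
  show ?case using word_closed[OF assms(1,3)] by simp
next
  case (Cons a u)
  have "a \<in> carrier G" using Cons.prems assms(1) by auto
  then show ?case
    using Cons word_closed[OF assms(1), of u] word_closed[OF assms(1,3)] by (simp add: m_assoc)
qed

lemma (in group) word_exists:
  assumes "finite_generating_set G A" "g \<in> carrier G"
  shows "\<exists>w. set w \<subseteq> A \<union> m_inv G ` A \<and> foldr (mult G) w \<one> = g"
proof -
  have A: "A \<subseteq> carrier G" and g: "g \<in> generate G A"
    using assms by (auto simp: finite_generating_set_def)
  from g show ?thesis
  proof (induction rule: generate.induct)
    case one
    show ?case by (intro exI[of _ "[]"]) simp
  next
    case (incl h)
    then show ?case using A by (intro exI[of _ "[h]"]) auto
  next
    case (inv h)
    then show ?case using A by (intro exI[of _ "[inv h]"]) auto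
  next
    case (eng h1 h2)
    then obtain u v where "set u \<subseteq> A \<union> m_inv G ` A" "foldr (mult G) u \<one> = h1"
      "set v \<subseteq> A \<union> m_inv G ` A" "foldr (mult G) v \<one> = h2" by blast
    then show ?case using word_append[OF A] by (intro exI[of _ "u @ v"]) auto
  qed
qed

lemma (in group) word_length_witness:
  assumes "finite_generating_set G A" "g \<in> carrier G"
  obtains w where "length w = word_length G A g" "set w \<subseteq> A \<union> m_inv G ` A" "foldr (mult G) w \<one> = g"
proof -
  have "\<exists>n w. length w = n \<and> set w \<subseteq> A \<union> m_inv G ` A \<and> foldr (mult G) w \<one> = g"
    using word_exists[OF assms] by blast
  from LeastI_ex[OF this] show ?thesis
    using that unfolding word_length_def by blast
qed

lemma word_length_le:
  assumes "set w \<subseteq> A \<union> m_inv G ` A" "foldr (mult G) w (one G) = g"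
  shows "word_length G A g \<le> length w"
  unfolding word_length_def using assms by (intro Least_le) blast

lemma (in group) word_inverse:
  assumes "A \<subseteq> carrier G" "set w \<subseteq> A \<union> m_inv G ` A"
  shows "\<exists>v. length v = length w \<and> set v \<subseteq> A \<union> m_inv G ` A \<and>
    foldr (mult G) v \<one> = inv (foldr (mult G) w \<one>)"
  using assms(2)
proof (induction w)
  case Nil
  show ?case by simp
next
  case (Cons a w)
  have a: "a \<in> carrier G" "inv a \<in> A \<union> m_inv G ` A" and w: "set w \<subseteq> A \<union> m_inv G ` A"
    using Cons.prems assms(1) by auto
  obtain v where v: "length v = length w" "set v \<subseteq> A \<union> m_inv G ` A"
    "foldr (mult G) v \<one> = inv (foldr (mult G) w \<one>)"
    using Cons.IH[OF w] by blast
  have "foldr (mult G) (v @ [inv a]) \<one> = foldr (mult G) v \<one> \<otimes> foldr (mult G) [inv a] \<one>"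
    by (rule word_append[OF assms(1) v(2)]) (use a in simp)
  then have "foldr (mult G) (v @ [inv a]) \<one> = inv (foldr (mult G) (a # w) \<one>)"
    using a v word_closed[OF assms(1) w] by (simp add: inv_mult_group)
  then show ?case using a v by (intro exI[of _ "v @ [inv a]"]) auto
qed

lemma (in group) Metric_space_word_dist:
  assumes gen: "finite_generating_set G A"
  shows "Metric_space (carrier G) (word_dist G A)"
proof
  have A: "A \<subseteq> carrier G" using gen by (simp add: finite_generating_set_def)
  have inv_le: "word_length G A (inv g) \<le> word_length G A g" if g: "g \<in> carrier G" for g
  proof -
    obtain w where w: "length w = word_length G A g" "set w \<subseteq> A \<union> m_inv G ` A"
      "foldr (mult G) w \<one> = g" by (rule word_length_witness[OF gen g])
    obtain v where "length v = length w" "set v \<subseteq> A \<union> m_inv G ` A" "foldr (mult G) v \<one> = inv g"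
      using word_inverse[OF A w(2)] w(3) by auto
    then show ?thesis using word_length_le[of v A G "inv g"] w(1) by simp
  qed
  show "0 \<le> word_dist G A x y" for x y by (simp add: word_dist_def)
  show "word_dist G A x y = word_dist G A y x" for x y
  proof (cases "x \<in> carrier G \<and> y \<in> carrier G")
    case True
    then have "inv (inv x \<otimes> y) = inv y \<otimes> x" "inv (inv y \<otimes> x) = inv x \<otimes> y"
      by (simp_all add: inv_mult_group)
    then show ?thesis
      using True inv_le[of "inv x \<otimes> y"] inv_le[of "inv y \<otimes> x"] by (simp add: word_dist_def)
  next
    case False
    then show ?thesis by (auto simp: word_dist_def)
  qed
  show "word_dist G A x y = 0 \<longleftrightarrow> x = y" if xy: "x \<in> carrier G" "y \<in> carrier G" for x y
  proof
    assume "word_dist G A x y = 0"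
    then have "word_length G A (inv x \<otimes> y) = 0" using xy by (simp add: word_dist_def)
    moreover obtain w where "length w = word_length G A (inv x \<otimes> y)"
      "foldr (mult G) w \<one> = inv x \<otimes> y"
      using word_length_witness[OF gen, of "inv x \<otimes> y"] xy by auto
    ultimately have "inv x \<otimes> y = \<one>" by simp
    then show "x = y" using xy by (metis inv_closed inv_inv inv_equality inv_unique' l_inv)
  next
    assume "x = y"
    then show "word_dist G A x y = 0"
      using xy word_length_le[of "[]" A G "\<one>"] by (simp add: word_dist_def)
  qed
  show "word_dist G A x z \<le> word_dist G A x y + word_dist G A y z"
    if xyz: "x \<in> carrier G" "y \<in> carrier G" "z \<in> carrier G" for x y z
  proof -
    obtain u where u: "length u = word_length G A (inv x \<otimes> y)" "set u \<subseteq> A \<union> m_inv G ` A"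
      "foldr (mult G) u \<one> = inv x \<otimes> y"
      using word_length_witness[OF gen, of "inv x \<otimes> y"] xyz by auto
    obtain v where v: "length v = word_length G A (inv y \<otimes> z)" "set v \<subseteq> A \<union> m_inv G ` A"
      "foldr (mult G) v \<one> = inv y \<otimes> z"
      using word_length_witness[OF gen, of "inv y \<otimes> z"] xyz by auto
    have "foldr (mult G) (u @ v) \<one> = (inv x \<otimes> y) \<otimes> (inv y \<otimes> z)"
      using word_append[OF A u(2) v(2)] u(3) v(3) by simp
    also have "\<dots> = inv x \<otimes> z"
      using xyz by (metis inv_closed inv_solve_left m_assoc m_closed)
    finally have "word_length G A (inv x \<otimes> z) \<le> length (u @ v)"
      using u(2) v(2) by (intro word_length_le) auto
    then show ?thesis using xyz u(1) v(1) by (simp add: word_dist_def)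
  qed
qed

lemma (in group) word_metric_simps [simp]:
  assumes "finite_generating_set G A"
  shows "mspace (word_metric G A) = carrier G" "mdist (word_metric G A) = word_dist G A"
  using Metric_space_word_dist[OF assms]
  by (simp_all add: word_metric_def Metric_space.mspace_metric Metric_space.mdist_metric)


section \<open>Hierarchically hyperbolic groups\<close>

text \<open>\<open>\<phi>\<close> is the action on the domains, \<open>\<psi> g U\<close> the isometry $\mathcal C U \to \mathcal C gU$.\<close>

locale hhg_structure =
  group G + hhs_structure "word_metric G A" S + group_action G "domains S" \<phi>
  for G :: "('g, 'm) monoid_scheme" (structure) and A :: "'g set" and S :: "('g, 'd, 'c) hhs"
    and \<phi> :: "'g \<Rightarrow> 'd \<Rightarrow> 'd" and \<psi> :: "'g \<Rightarrow> 'd \<Rightarrow> 'c \<Rightarrow> 'c" +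
  assumes generating: "finite_generating_set G A"
    and finite_orbits: "finite (orbits G (domains S) \<phi>)"
    and nested_equivariant: "\<lbrakk>g \<in> carrier G; U \<in> domains S; V \<in> domains S\<rbrakk>
      \<Longrightarrow> nested S (\<phi> g U) (\<phi> g V) \<longleftrightarrow> nested S U V"
    and orth_equivariant: "\<lbrakk>g \<in> carrier G; U \<in> domains S; V \<in> domains S\<rbrakk>
      \<Longrightarrow> orth S (\<phi> g U) (\<phi> g V) \<longleftrightarrow> orth S U V"
    and transverse_equivariant: "\<lbrakk>g \<in> carrier G; U \<in> domains S; V \<in> domains S\<rbrakk>
      \<Longrightarrow> transverse S (\<phi> g U) (\<phi> g V) \<longleftrightarrow> transverse S U V"
    and isom_bij: "\<lbrakk>g \<in> carrier G; U \<in> domains S\<rbrakk>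
      \<Longrightarrow> bij_betw (\<psi> g U) (mspace (cspace S U)) (mspace (cspace S (\<phi> g U)))"
    and isom_dist: "\<lbrakk>g \<in> carrier G; U \<in> domains S; p \<in> mspace (cspace S U); q \<in> mspace (cspace S U)\<rbrakk>
      \<Longrightarrow> mdist (cspace S (\<phi> g U)) (\<psi> g U p) (\<psi> g U q) = mdist (cspace S U) p q"
    and isom_mult: "\<lbrakk>g \<in> carrier G; h \<in> carrier G; U \<in> domains S; p \<in> mspace (cspace S U)\<rbrakk>
      \<Longrightarrow> \<psi> (g \<otimes> h) U p = \<psi> g (\<phi> h U) (\<psi> h U p)"
    and proj_equivariant: "\<lbrakk>g \<in> carrier G; x \<in> carrier G; U \<in> domains S\<rbrakk>
      \<Longrightarrow> \<psi> g U (cproj S U x) = cproj S (\<phi> g U) (g \<otimes> x)"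
    and rho_equivariant: "\<lbrakk>g \<in> carrier G; U \<in> domains S; V \<in> domains S;
        transverse S U V \<or> properly_nested S V U\<rbrakk>
      \<Longrightarrow> \<psi> g U ` rho S V U = rho S (\<phi> g V) (\<phi> g U)"

definition hierarchically_hyperbolic_group ::
  "'d itself \<Rightarrow> 'c itself \<Rightarrow> ('g, 'm) monoid_scheme \<Rightarrow> bool" where
  "hierarchically_hyperbolic_group _ _ G \<longleftrightarrow>
     (\<exists>A (S :: ('g, 'd, 'c) hhs) \<phi> \<psi>. hhg_structure G A S \<phi> \<psi>)"

definition virtually_hierarchically_hyperbolic_group ::
  "'d itself \<Rightarrow> 'c itself \<Rightarrow> ('g, 'm) monoid_scheme \<Rightarrow> bool" where
  "virtually_hierarchically_hyperbolic_group D C G \<longleftrightarrow>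
     (\<exists>H. subgroup H G \<and> finite (rcosets\<^bsub>G\<^esub> H) \<and>
          hierarchically_hyperbolic_group D C (G\<lparr>carrier := H\<rparr>))"

text \<open>The constant can always be enlarged so that a hyperbolic space of diameter greater than it
  is unbounded.  This normalisation is therefore not part of the definition.\<close>

lemma (in hhg_structure) hhg_structure_normalise:
  "\<exists>e\<ge>hconst S. hhg_structure G A (S\<lparr>hconst := e\<rparr>) \<phi> \<psi> \<and>
     (\<forall>U\<in>domains S. mdiam (cspace S U) (mspace (cspace S U)) > e \<longrightarrow>
        mdiam (cspace S U) (mspace (cspace S U)) = \<infinity>)"
proof -
  let ?diam = "\<lambda>U. mdiam (cspace S U) (mspace (cspace S U))"
  have diam_invariant: "?diam (\<phi> g U) = ?diam U" if "g \<in> carrier G" "U \<in> domains S" for g U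
  proof -
    have *: "mspace (cspace S (\<phi> g U)) = \<psi> g U ` mspace (cspace S U)"
      using isom_bij[OF that] by (simp add: bij_betw_def)
    then show ?thesis
      unfolding mdiam_def * image_image by (intro SUP_cong HOL.refl) (simp only: isom_dist[OF that])
  qed
  define rep where "rep Z = (SOME V. V \<in> Z \<and> V \<in> domains S)" for Z
  have "?diam U = ?diam (rep (orbit G \<phi> U))" if U: "U \<in> domains S" for U
  proof -
    have "U \<in> orbit G \<phi> U \<and> U \<in> domains S"
      using U orbit_refl by blast
    then have "rep (orbit G \<phi> U) \<in> orbit G \<phi> U"
      unfolding rep_def by (rule someI2) blast
    then obtain g where "g \<in> carrier G" "rep (orbit G \<phi> U) = \<phi> g U"
      unfolding orbit_def by blast
    then show ?thesis using diam_invariant[OF _ U] by simp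
  qed
  then have "?diam ` domains S \<subseteq> (\<lambda>Z. ?diam (rep Z)) ` orbits G (domains S) \<phi>"
    unfolding orbits_def by blast
  then have fin: "finite (?diam ` domains S)"
    using finite_orbits by (meson finite_surj)
  define D where "D = insert (hconst S) (real_of_ereal ` ?diam ` domains S)"
  define e where "e = Max D"
  have finD: "finite D" using fin by (simp add: D_def)
  have le: "hconst S \<le> e" using finD by (simp add: e_def D_def)
  have "?diam U = \<infinity>" if U: "U \<in> domains S" and gt: "?diam U > ereal e" for U
  proof (rule ccontr)
    assume "?diam U \<noteq> \<infinity>"
    then have "?diam U = ereal (real_of_ereal (?diam U))"
      using gt by (cases "?diam U") auto
    moreover have "real_of_ereal (?diam U) \<le> e"
      using finD U by (auto simp: e_def D_def intro!: Max_ge)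
    ultimately show False using gt by (metis ereal_less_eq(3) not_le)
  qed
  moreover have "hhg_structure G A (S\<lparr>hconst := e\<rparr>) \<phi> \<psi>"
  proof -
    let ?S = "S\<lparr>hconst := e\<rparr>"
    have sel: "domains ?S = domains S" "cspace ?S = cspace S" "cproj ?S = cproj S"
      "nested ?S = nested S" "orth ?S = orth S" "rho ?S = rho S"
      "properly_nested ?S = properly_nested S" "transverse ?S = transverse S"
      by (simp_all add: fun_eq_iff properly_nested_def transverse_def)
    have "group_action G (domains ?S) \<phi>" using group_action_axioms by simp
    moreover have "hhg_structure_axioms G A ?S \<phi> \<psi> = hhg_structure_axioms G A S \<phi> \<psi>"
      unfolding hhg_structure_axioms_def sel ..
    moreover have "hhg_structure_axioms G A S \<phi> \<psi>"
      using hhg_structure_axioms unfolding hhg_structure_def by blast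
    ultimately show ?thesis
      using hhs_structure_mono[OF le] group_axioms unfolding hhg_structure_def by blast
  qed
  ultimately show ?thesis using le by blast
qed


section \<open>Group presentations\<close>

text \<open>A word is a list of letters; \<open>(x, True)\<close> stands for the generator \<open>x\<close> and \<open>(x, False)\<close>
  for its inverse.  The generators of the presented group are all elements of the type \<open>'s\<close>.\<close>

type_synonym 's word = "('s \<times> bool) list"

inductive pres_eq :: "'s word set \<Rightarrow> 's word \<Rightarrow> 's word \<Rightarrow> bool" for R where
  refl: "pres_eq R u u"
| sym: "pres_eq R u v \<Longrightarrow> pres_eq R v u"
| trans: "pres_eq R u v \<Longrightarrow> pres_eq R v w \<Longrightarrow> pres_eq R u w"
| congr: "pres_eq R u v \<Longrightarrow> pres_eq R (p @ u @ q) (p @ v @ q)"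
| cancel: "pres_eq R [(x, b), (x, \<not> b)] []"
| relator: "r \<in> R \<Longrightarrow> pres_eq R r []"

definition word_class :: "'s word set \<Rightarrow> 's word \<Rightarrow> 's word set" where
  "word_class R u = {v. pres_eq R u v}"

definition presented_group :: "'s word set \<Rightarrow> 's word set monoid" where
  "presented_group R =
     \<lparr>carrier = range (word_class R),
      mult = (\<lambda>P Q. \<Union>u\<in>P. \<Union>v\<in>Q. word_class R (u @ v)),
      one = word_class R []\<rparr>"

lemma word_class_eq_iff: "word_class R u = word_class R v \<longleftrightarrow> pres_eq R u v"
  unfolding word_class_def set_eq_iff by (metis mem_Collect_eq pres_eq.refl pres_eq.sym pres_eq.trans)

lemma pres_eq_append:
  assumes "pres_eq R u u'" "pres_eq R v v'"
  shows "pres_eq R (u @ v) (u' @ v')"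
  using pres_eq.congr[OF assms(1), of "[]" v] pres_eq.congr[OF assms(2), of u' "[]"]
  by (auto intro: pres_eq.trans)

lemma presented_group_mult:
  "word_class R u \<otimes>\<^bsub>presented_group R\<^esub> word_class R v = word_class R (u @ v)"
proof -
  have *: "word_class R (u' @ v') = word_class R (u @ v)"
    if "u' \<in> word_class R u" "v' \<in> word_class R v" for u' v'
    unfolding word_class_eq_iff
    using that by (auto simp: word_class_def intro: pres_eq.sym pres_eq_append)
  have "u \<in> word_class R u" "v \<in> word_class R v"
    by (simp_all add: word_class_def pres_eq.refl)
  then have "(\<Union>u'\<in>word_class R u. \<Union>v'\<in>word_class R v. word_class R (u' @ v')) = word_class R (u @ v)"
    using * by blast
  then show ?thesis by (simp add: presented_group_def)
qed

lemma pres_eq_inverse_word: "pres_eq R (rev (map (\<lambda>(x, b). (x, \<not> b)) u) @ u) []"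
proof (induction u)
  case Nil
  show ?case by (simp add: pres_eq.refl)
next
  case (Cons l u)
  obtain x b where l: "l = (x, b)" by (cases l)
  let ?i = "rev (map (\<lambda>(x, b). (x, \<not> b)) u)"
  have "pres_eq R (?i @ [(x, \<not> b), (x, \<not> \<not> b)] @ u) (?i @ [] @ u)"
    by (rule pres_eq.congr) (rule pres_eq.cancel)
  then show ?case using Cons.IH l by (auto intro: pres_eq.trans)
qed

lemma group_presented_group: "group (presented_group R)"
proof (rule groupI)
  note [simp] = presented_group_mult
  have car: "carrier (presented_group R) = range (word_class R)"
    and one: "\<one>\<^bsub>presented_group R\<^esub> = word_class R []"
    by (simp_all add: presented_group_def)
  show "x \<otimes>\<^bsub>presented_group R\<^esub> y \<in> carrier (presented_group R)"
    if "x \<in> carrier (presented_group R)" "y \<in> carrier (presented_group R)" for x y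
    using that by (auto simp: car)
  show "\<one>\<^bsub>presented_group R\<^esub> \<in> carrier (presented_group R)" by (simp add: car one)
  show "x \<otimes>\<^bsub>presented_group R\<^esub> y \<otimes>\<^bsub>presented_group R\<^esub> z
      = x \<otimes>\<^bsub>presented_group R\<^esub> (y \<otimes>\<^bsub>presented_group R\<^esub> z)"
    if "x \<in> carrier (presented_group R)" "y \<in> carrier (presented_group R)"
      "z \<in> carrier (presented_group R)" for x y z
    using that by (auto simp: car)
  show "\<one>\<^bsub>presented_group R\<^esub> \<otimes>\<^bsub>presented_group R\<^esub> x = x"
    if "x \<in> carrier (presented_group R)" for x
    using that by (auto simp: car one)
  show "\<exists>y\<in>carrier (presented_group R). y \<otimes>\<^bsub>presented_group R\<^esub> x = \<one>\<^bsub>presented_group R\<^esub>"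
    if "x \<in> carrier (presented_group R)" for x
  proof -
    from that obtain u where x: "x = word_class R u" by (auto simp: car)
    show ?thesis
      unfolding x one car
      by (rule bexI[OF _ rangeI[of _ "rev (map (\<lambda>(x, b). (x, \<not> b)) u)"]])
        (simp add: word_class_eq_iff pres_eq_inverse_word)
  qed
qed

datatype tri_gen = Ta | Tb | Tc

definition tri_relators :: "tri_gen word set" where
  "tri_relators =
     (let a = (Ta, True); b = (Tb, True); c = (Tc, True) in
      {[a, a], [b, b], [c, c], [a, b, a, b, a, b], [b, c, b, c, b, c], [c, a, c, a, c, a]})"

definition triangle_group_333 :: "tri_gen word set monoid" where
  "triangle_group_333 = presented_group tri_relators"

end

theory Submission
  imports Defs
begin

text \<open>
  The triangle group is generated by the reflections in the sides of an equilateral triangle in the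
  plane.  It is a lattice of translations extended by the symmetric group of degree 3.

  \<^emph>\<open>The positive statements.\<close>  A space that is coarsely a plane is hierarchically hyperbolic: take
  two coordinate lines as orthogonal domains and a point as the maximal domain
  (\<open>hhs_structure_plane\<close>).  The translations preserve the two coordinate directions, so the lattice
  acts on this structure and is a hierarchically hyperbolic group.  For all this the presentation
  must be understood: the reflections act on \<open>\<int>\<^sup>2\<close>, and every element has the form
  \<open>u\<^sup>iw\<^sup>js\<close> with commuting translations \<open>u\<close>, \<open>w\<close> and with \<open>s\<close> among six elements
  (\<open>tri_normal_form\<close>).

  \<^emph>\<open>The negative statement.\<close>  A rotation \<open>r\<close> of order 3 preserves no pair of directions, and this
  is an obstruction for every structure.  The argument rests on one identity: the product of the
  conjugates of a translation \<open>l\<close> by the three powers of \<open>r\<close> is trivial.  Call a domain unbounded if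
  the group has unbounded image in its hyperbolic space.

  \<^item> Let \<open>V\<close> be a maximal unbounded domain.  By the large links axiom a pair of group elements has
    distance at least \<open>E\<close> in boundedly many maximal unbounded domains only
    (\<open>maximal_unbounded_count\<close>).  As an element of the lattice that moves far in \<open>V\<close> moves far in many
    translates of \<open>V\<close>, the lattice orbit of \<open>V\<close> is finite (\<open>finite_abelian_orbit\<close>).  A subgroup \<open>L\<close>
    of finite index in the lattice then fixes \<open>V\<close>, \<open>rV\<close> and \<open>r\<^sup>2V\<close>.

  \<^item> If \<open>rV \<noteq> V\<close>, then \<open>V\<close>, \<open>rV\<close> and \<open>r\<^sup>2V\<close> are distinct and pairwise orthogonal, since transverse
    domains would mark bounded sets that \<open>L\<close> preserves.  Partial realisation provides \<open>l \<in> L\<close> that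
    moves far in \<open>V\<close> and little in the other two domains.  But \<open>l\<close> is inverse to the product of two
    conjugates, and their displacements in \<open>V\<close> are about those of \<open>l\<close> in the other two domains
    (\<open>conjugation_orbit_not_orthogonal\<close>).

  \<^item> If \<open>rV = V\<close>, then conjugation by \<open>r\<close> hardly changes displacements in \<open>V\<close>.  As \<open>L\<close> acts on the
    hyperbolic space of \<open>V\<close> with coarsely dense orbits, that space looks like a line, on which
    displacements are absolute values of a homomorphism.  Three conjugates with trivial product
    and with the same absolute value cannot exist on a line unless that value is zero
    (\<open>conjugation_moves_unbounded_domain\<close>).  The proof reads this off from the four-point inequality
    of hyperbolic spaces for two pairs of commuting elements.
\<close>

section \<open>Hyperbolic geometry: the four-point inequality\<close>

lemma geodesic_segment_between:
  assumes "geodesic_segment m x y P" "p \<in> P"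
  shows "p \<in> mspace m" "mdist m x p + mdist m p y = mdist m x y"
proof -
  obtain \<gamma> where \<gamma>: "geodesic_path m x y \<gamma>" "P = \<gamma> ` {0..mdist m x y}"
    using assms(1) by (auto simp: geodesic_segment_def)
  obtain t where t: "t \<in> {0..mdist m x y}" "p = \<gamma> t" using assms(2) \<gamma>(2) by auto
  show "p \<in> mspace m" using \<gamma> t by (auto simp: geodesic_path_def)
  have iso: "\<forall>s\<in>{0..mdist m x y}. \<forall>t\<in>{0..mdist m x y}. mdist m (\<gamma> s) (\<gamma> t) = \<bar>s - t\<bar>"
    and ends: "\<gamma> 0 = x" "\<gamma> (mdist m x y) = y"
    using \<gamma>(1) by (auto simp: geodesic_path_def)
  have "mdist m x p = t" "mdist m p y = mdist m x y - t"
    using iso[rule_format, of 0 t] iso[rule_format, of t "mdist m x y"] t ends by auto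
  then show "mdist m x p + mdist m p y = mdist m x y" by simp
qed

lemma geodesic_segment_ends:
  assumes "geodesic_segment m x y P"
  shows "x \<in> P" "y \<in> P"
proof -
  obtain \<gamma> where \<gamma>: "geodesic_path m x y \<gamma>" "P = \<gamma> ` {0..mdist m x y}"
    using assms by (auto simp: geodesic_segment_def)
  have "\<gamma> 0 \<in> P" "\<gamma> (mdist m x y) \<in> P" unfolding \<gamma>(2) by (intro imageI; simp)+
  then show "x \<in> P" "y \<in> P" using \<gamma>(1) by (simp_all add: geodesic_path_def)
qed

text \<open>Along \<open>[x, z]\<close> one passes from the neighbourhood of \<open>[w, x]\<close> to that of \<open>[z, w]\<close>.  A point \<open>p\<close> at the
  passage is close to both of these sides, so either side is about as long as the way
  through \<open>p\<close>, and the Gromov product of \<open>x\<close> and \<open>z\<close> at \<open>w\<close> is about the distance from \<open>w\<close> to \<open>p\<close>.\<close>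

lemma Gromov_product_point:
  assumes hyp: "hyperbolic_metric \<delta> m"
    and P: "geodesic_segment m x z P" and Q: "geodesic_segment m z w Q"
    and R: "geodesic_segment m w x R"
  shows "\<exists>p\<in>P. 2 * mdist m w p \<le> mdist m x w + mdist m z w - mdist m x z + 4 * \<delta> + 2"
proof -
  obtain \<gamma> where \<gamma>: "geodesic_path m x z \<gamma>" and im: "P = \<gamma> ` {0..mdist m x z}"
    using P by (auto simp: geodesic_segment_def)
  define l where "l = mdist m x z"
  have l0: "0 \<le> l" by (simp add: l_def)
  have iso: "mdist m (\<gamma> s) (\<gamma> t) = \<bar>s - t\<bar>" if "s \<in> {0..l}" "t \<in> {0..l}" for s t
    using \<gamma> that unfolding geodesic_path_def l_def by blast
  have \<gamma>P: "\<gamma> t \<in> P" if "t \<in> {0..l}" for t using that im by (auto simp: l_def)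
  have near: "\<exists>q\<in>Q \<union> R. mdist m p q \<le> \<delta>" if "p \<in> P" for p
    using hyp P Q R that unfolding hyperbolic_metric_def by blast
  have mem: "w \<in> mspace m" "x \<in> mspace m" "z \<in> mspace m"
    using P Q by (auto simp: geodesic_segment_def)
  define near_R where "near_R = {t \<in> {0..l}. \<exists>q\<in>R. mdist m (\<gamma> t) q \<le> \<delta>}"
  have \<delta>: "0 \<le> \<delta>"
    using near[OF \<gamma>P[of 0]] l0 mdist_nonneg[of m] by (meson atLeastAtMost_iff order_refl order_trans)
  have x_R: "x \<in> R" and z_Q: "z \<in> Q"
    using geodesic_segment_ends[OF R] geodesic_segment_ends[OF Q] by auto
  have x0: "\<gamma> 0 = x" and zl: "\<gamma> l = z" using \<gamma> by (auto simp: geodesic_path_def l_def)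
  have self: "mdist m x x = 0" "mdist m z z = 0" using mem by simp_all
  have 0: "0 \<in> near_R" using x_R x0 \<delta> l0 self by (auto simp: near_R_def intro!: bexI[of _ x])
  have bdd: "bdd_above near_R" by (auto simp: near_R_def intro!: bdd_aboveI[of _ l])
  \<comment> \<open>\<open>t\<close> is one of the last parameters near \<open>R\<close>, and \<open>t'\<close> lies slightly beyond all of them\<close>
  obtain t where t: "t \<in> near_R" "Sup near_R - 1/2 < t"
    using less_cSup_iff[OF _ bdd, of "Sup near_R - 1/2"] 0 by auto
  have t_le: "t \<le> Sup near_R" using t bdd by (auto intro: cSup_upper)
  have tl: "t \<in> {0..l}" using t by (auto simp: near_R_def)
  have Sup_l: "Sup near_R \<le> l" using 0 by (auto simp: near_R_def intro!: cSup_least)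
  define t' where "t' = min l (Sup near_R + 1/2)"
  have t'l: "t' \<in> {0..l}" using tl t_le by (auto simp: t'_def)
  have tt': "\<bar>t - t'\<bar> \<le> 1" using t(2) t_le Sup_l by (auto simp: t'_def)
  have "\<exists>q'\<in>Q. mdist m (\<gamma> t') q' \<le> \<delta>"
  proof (cases "t' = l")
    case True
    then show ?thesis using z_Q zl \<delta> self by (auto intro!: bexI[of _ z])
  next
    case False
    then have "Sup near_R < t'" by (auto simp: t'_def)
    then have "t' \<notin> near_R" using bdd by (meson cSup_upper not_le)
    then show ?thesis using near[OF \<gamma>P[OF t'l]] t'l by (auto simp: near_R_def)
  qed
  then obtain q' where q': "q' \<in> Q" "mdist m (\<gamma> t') q' \<le> \<delta>" by blast
  obtain q where q: "q \<in> R" "mdist m (\<gamma> t) q \<le> \<delta>" using t(1) by (auto simp: near_R_def)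
  let ?p = "\<gamma> t"
  have p: "?p \<in> P" using \<gamma>P tl by blast
  note Pp = geodesic_segment_between[OF P p]
  note Pt' = geodesic_segment_between(1)[OF P \<gamma>P[OF t'l]]
  note Rq = geodesic_segment_between[OF R q(1)]
  note Qq = geodesic_segment_between[OF Q q'(1)]
  have pq': "mdist m ?p q' \<le> \<delta> + 1"
    using mdist_triangle[OF Pp(1) Pt' Qq(1)] iso[OF tl t'l] tt' q'(2) by linarith
  have "mdist m w x \<ge> mdist m w ?p + mdist m x ?p - 2 * \<delta>"
    using Rq mdist_triangle[OF mem(1) Rq(1) Pp(1)] mdist_triangle[OF mem(2) Rq(1) Pp(1)] q(2)
    by (simp add: mdist_commute)
  moreover have "mdist m z w \<ge> mdist m z ?p + mdist m w ?p - 2 * \<delta> - 2"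
    using Qq mdist_triangle[OF mem(1) Qq(1) Pp(1)] mdist_triangle[OF mem(3) Qq(1) Pp(1)] pq'
    by (simp add: mdist_commute)
  ultimately have "2 * mdist m w ?p \<le> mdist m x w + mdist m z w - mdist m x z + 4 * \<delta> + 2"
    using Pp(2) by (simp add: mdist_commute)
  then show ?thesis using p by blast
qed

text \<open>Let \<open>p\<close> be the point of \<open>[x, z]\<close> found in the previous lemma.  In the triangle \<open>x\<close>, \<open>y\<close>, \<open>z\<close> it is
  close to \<open>[x, y]\<close> or to \<open>[y, z]\<close>, and the distance from \<open>w\<close> to a point of a geodesic is at least the
  Gromov product of its ends.\<close>

proposition four_point_inequality:
  assumes geo: "geodesic_metric m" and hyp: "hyperbolic_metric \<delta> m"
    and mem: "x \<in> mspace m" "y \<in> mspace m" "z \<in> mspace m" "w \<in> mspace m"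
  shows "mdist m x z + mdist m y w
      \<le> max (mdist m x y + mdist m z w) (mdist m x w + mdist m y z) + 6 * \<delta> + 2"
proof -
  obtain P Q R where P: "geodesic_segment m x z P" and Q: "geodesic_segment m z w Q"
    and R: "geodesic_segment m w x R"
    using geo mem unfolding geodesic_metric_def by meson
  obtain U V where U: "geodesic_segment m z y U" and V: "geodesic_segment m y x V"
    using geo mem unfolding geodesic_metric_def by meson
  obtain p where p: "p \<in> P" "2 * mdist m w p \<le> mdist m x w + mdist m z w - mdist m x z + 4 * \<delta> + 2"
    using Gromov_product_point[OF hyp P Q R] by blast
  obtain q where q: "q \<in> U \<union> V" "mdist m p q \<le> \<delta>"
    using hyp P U V p(1) unfolding hyperbolic_metric_def by blast
  note Pp = geodesic_segment_between[OF P p(1)]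
  show ?thesis
  proof (cases "q \<in> U")
    case True
    note Uq = geodesic_segment_between[OF U True]
    have "mdist m z w + mdist m y w \<le> mdist m z y + 2 * mdist m w q"
      using Uq mdist_triangle[OF mem(3) Uq(1) mem(4)] mdist_triangle[OF mem(2) Uq(1) mem(4)]
      by (simp add: mdist_commute)
    moreover have "mdist m w q \<le> mdist m w p + \<delta>"
      using mdist_triangle[OF mem(4) Pp(1) Uq(1)] q(2) by simp
    ultimately show ?thesis using p(2) by (simp add: mdist_commute)
  next
    case False
    then have qV: "q \<in> V" using q by blast
    note Vq = geodesic_segment_between[OF V qV]
    have "mdist m y w + mdist m x w \<le> mdist m y x + 2 * mdist m w q"
      using Vq mdist_triangle[OF mem(2) Vq(1) mem(4)] mdist_triangle[OF mem(1) Vq(1) mem(4)]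
      by (simp add: mdist_commute)
    moreover have "mdist m w q \<le> mdist m w p + \<delta>"
      using mdist_triangle[OF mem(4) Pp(1) Vq(1)] q(2) by simp
    ultimately show ?thesis using p(2) by (simp add: mdist_commute)
  qed
qed

section \<open>Unbounded domains\<close>

lemma msetdist_singletons [simp]: "msetdist m {p} {q} = ereal (mdist m p q)"
  by (simp add: msetdist_def)

lemma mdiam_singleton [simp]: "mdiam m {p} = ereal (mdist m p p)"
  by (simp add: mdiam_def)

lemma mdist_le_mdiam:
  assumes "p \<in> A" "q \<in> A" "mdiam m A \<le> ereal d"
  shows "mdist m p q \<le> d"
proof -
  have "ereal (mdist m p q) \<le> mdiam m A"
    unfolding mdiam_def using assms by (intro SUP_upper2[OF assms(1)] SUP_upper2[OF assms(2)]) simp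
  then show ?thesis using assms(3) by (metis ereal_less_eq(3) order_trans)
qed

lemma near_point_of_set:
  assumes "msetdist m {p} A \<le> ereal d" "d < e"
  shows "\<exists>q\<in>A. mdist m p q < e"
proof -
  have "(INF q\<in>A. ereal (mdist m p q)) < ereal e"
    using assms by (simp add: msetdist_def le_less_trans)
  then show ?thesis by (auto simp: INF_less_iff)
qed


definition coarsely_dense :: "('g, 'm) monoid_scheme \<Rightarrow> 'g set \<Rightarrow> 'g set \<Rightarrow> bool" where
  "coarsely_dense G A L \<longleftrightarrow>
     L \<subseteq> carrier G \<and> (\<exists>R. \<forall>x\<in>carrier G. \<exists>l\<in>L. word_dist G A l x \<le> R)"

lemma (in group) coarsely_dense_translates:
  assumes L: "L \<subseteq> carrier G" and F: "finite F" "F \<subseteq> carrier G"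
    and cover: "\<And>x. x \<in> carrier G \<Longrightarrow> \<exists>l\<in>L. \<exists>f\<in>F. x = l \<otimes> f"
  shows "coarsely_dense G A L"
proof -
  have "\<exists>l\<in>L. word_dist G A l x \<le> (\<Sum>f\<in>F. real (word_length G A f))" if x: "x \<in> carrier G" for x
  proof -
    obtain l f where lf: "l \<in> L" "f \<in> F" "x = l \<otimes> f" using cover[OF x] by blast
    then have "l \<in> carrier G" "f \<in> carrier G" using L F by auto
    then have "inv l \<otimes> x = f" using lf by (simp add: m_assoc[symmetric])
    then have "word_dist G A l x = word_length G A f"
      using x \<open>l \<in> carrier G\<close> by (simp add: word_dist_def)
    also have "\<dots> \<le> (\<Sum>f\<in>F. real (word_length G A f))"
      using F lf(2) by (intro member_le_sum) auto
    finally show ?thesis using lf(1) by blast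
  qed
  then show ?thesis using L unfolding coarsely_dense_def by blast
qed

lemma (in group) coarsely_dense_finite_index:
  assumes L: "subgroup L G" and fin: "finite (rcosets L)"
  shows "coarsely_dense G A L"
proof -
  define rep where "rep C = (SOME f. f \<in> C)" for C :: "'a set"
  have Lc: "L \<subseteq> carrier G" using L by (rule subgroup.subset)
  have rep: "rep (L #> x) \<in> L #> x" if "x \<in> carrier G" for x
    unfolding rep_def using rcos_self[OF that L] by (rule someI)
  show ?thesis
  proof (rule coarsely_dense_translates[OF Lc, of "rep ` (rcosets L)"])
    show "finite (rep ` (rcosets L))" using fin by simp
    show "rep ` (rcosets L) \<subseteq> carrier G"
      using rep r_coset_subset_G[OF Lc] by (auto simp: RCOSETS_def)
    show "\<exists>l\<in>L. \<exists>f\<in>rep ` (rcosets L). x = l \<otimes> f" if x: "x \<in> carrier G" for x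
    proof -
      obtain l where l: "l \<in> L" "rep (L #> x) = l \<otimes> x" using rep[OF x] by (auto simp: r_coset_def)
      then have "x = inv l \<otimes> rep (L #> x)" using x Lc by (auto simp: m_assoc[symmetric])
      moreover have "L #> x \<in> rcosets L" using x Lc by (auto simp: RCOSETS_def)
      ultimately show ?thesis using subgroup.m_inv_closed[OF L l(1)] by blast
    qed
  qed
qed

context hhg_structure
begin

lemma cproj_in: "\<lbrakk>U \<in> domains S; x \<in> carrier G\<rbrakk> \<Longrightarrow> cproj S U x \<in> mspace (cspace S U)"
  using proj_in generating by simp

lemma cdist_commute: "cdist S U x y = cdist S U y x"
  by (simp add: cdist_def mdist_commute)

lemma cdist_nonneg [simp]: "0 \<le> cdist S U x y"
  by (simp add: cdist_def)

lemma cdist_triangle: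
  "\<lbrakk>U \<in> domains S; x \<in> carrier G; y \<in> carrier G; z \<in> carrier G\<rbrakk>
    \<Longrightarrow> cdist S U x z \<le> cdist S U x y + cdist S U y z"
  unfolding cdist_def by (intro mdist_triangle cproj_in)

lemma cdist_le_word_dist:
  "\<lbrakk>U \<in> domains S; x \<in> carrier G; y \<in> carrier G\<rbrakk>
    \<Longrightarrow> cdist S U x y \<le> hconst S * word_dist G A x y + hconst S"
  using proj_lipschitz[of U x y] generating by simp

lemma cdist_right_translate:
  assumes "U \<in> domains S" "x \<in> carrier G" "g \<in> carrier G"
  shows "cdist S U x (x \<otimes> g) \<le> hconst S * word_length G A g + hconst S"
proof -
  have "inv x \<otimes> (x \<otimes> g) = g" using assms by (simp add: m_assoc[symmetric])
  then show ?thesis using cdist_le_word_dist[of U x "x \<otimes> g"] assms by (simp add: word_dist_def)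
qed

lemma action_closed: "\<lbrakk>g \<in> carrier G; U \<in> domains S\<rbrakk> \<Longrightarrow> \<phi> g U \<in> domains S"
  using element_image by blast

lemma action_inv [simp]:
  "\<lbrakk>g \<in> carrier G; U \<in> domains S\<rbrakk> \<Longrightarrow> \<phi> (inv g) (\<phi> g U) = U"
  "\<lbrakk>g \<in> carrier G; U \<in> domains S\<rbrakk> \<Longrightarrow> \<phi> g (\<phi> (inv g) U) = U"
  using orbit_sym_aux[of g U] orbit_sym_aux[of "inv g" U] by simp_all

lemma cdist_equivariant:
  assumes "g \<in> carrier G" "U \<in> domains S" "x \<in> carrier G" "y \<in> carrier G"
  shows "cdist S (\<phi> g U) (g \<otimes> x) (g \<otimes> y) = cdist S U x y"
  using assms isom_dist[OF assms(1,2), of "cproj S U x" "cproj S U y"]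
  by (simp add: cdist_def proj_equivariant cproj_in)

lemma cdist_action:
  assumes "g \<in> carrier G" "U \<in> domains S" "x \<in> carrier G" "y \<in> carrier G"
  shows "cdist S (\<phi> g U) x y = cdist S U (inv g \<otimes> x) (inv g \<otimes> y)"
  using cdist_equivariant[of "inv g" "\<phi> g U" x y] assms by (simp add: action_closed)

definition unbounded_domain where
  "unbounded_domain U \<longleftrightarrow>
     U \<in> domains S \<and> (\<forall>B. \<exists>x\<in>carrier G. \<exists>y\<in>carrier G. cdist S U x y > B)"

definition maximal_unbounded where
  "maximal_unbounded V \<longleftrightarrow>
     unbounded_domain V \<and> (\<forall>U. unbounded_domain U \<and> nested S V U \<longrightarrow> U = V)"

lemma unbounded_domainD: "unbounded_domain U \<Longrightarrow> U \<in> domains S"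
  by (simp add: unbounded_domain_def)

lemma maximal_unboundedD: "maximal_unbounded U \<Longrightarrow> U \<in> domains S" "maximal_unbounded U \<Longrightarrow> unbounded_domain U"
  by (simp_all add: maximal_unbounded_def unbounded_domain_def)

lemma unbounded_domain_action:
  assumes g: "g \<in> carrier G" and U: "unbounded_domain U"
  shows "unbounded_domain (\<phi> g U)"
  unfolding unbounded_domain_def
proof (intro conjI allI)
  note Ud = unbounded_domainD[OF U]
  show "\<phi> g U \<in> domains S" by (rule action_closed[OF g Ud])
  fix B
  obtain x y where xy: "x \<in> carrier G" "y \<in> carrier G" "cdist S U x y > B"
    using U unfolding unbounded_domain_def by blast
  then have "cdist S (\<phi> g U) (g \<otimes> x) (g \<otimes> y) > B" using cdist_equivariant g Ud by simp
  then show "\<exists>x\<in>carrier G. \<exists>y\<in>carrier G. cdist S (\<phi> g U) x y > B" using g xy by blast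
qed

lemma maximal_unbounded_action:
  assumes g: "g \<in> carrier G" and V: "maximal_unbounded V"
  shows "maximal_unbounded (\<phi> g V)"
  unfolding maximal_unbounded_def
proof (intro conjI allI impI)
  note Vd = maximal_unboundedD[OF V]
  show "unbounded_domain (\<phi> g V)" using unbounded_domain_action[OF g Vd(2)] .
  fix U assume U: "unbounded_domain U \<and> nested S (\<phi> g V) U"
  then have Ud: "U \<in> domains S" by (simp add: unbounded_domainD)
  have "nested S (\<phi> (inv g) (\<phi> g V)) (\<phi> (inv g) U)"
    using U nested_equivariant[of "inv g" "\<phi> g V" U] g Vd(1) Ud by (simp add: action_closed)
  then have "nested S V (\<phi> (inv g) U)" using g Vd(1) by simp
  moreover have "unbounded_domain (\<phi> (inv g) U)" using U g by (intro unbounded_domain_action) auto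
  ultimately have "\<phi> (inv g) U = V" using V by (auto simp: maximal_unbounded_def)
  then show "U = \<phi> g V" using g Ud by auto
qed

text \<open>There are finitely many orbits of domains, so the bounded ones are uniformly bounded.\<close>

lemma uniform_bound_bounded_domains:
  "\<exists>B. \<forall>U\<in>domains S. \<not> unbounded_domain U \<longrightarrow>
     (\<forall>x\<in>carrier G. \<forall>y\<in>carrier G. cdist S U x y \<le> B)"
proof -
  define bound where "bound Z B \<longleftrightarrow> (\<forall>U\<in>Z. \<not> unbounded_domain U \<longrightarrow>
    (\<forall>x\<in>carrier G. \<forall>y\<in>carrier G. cdist S U x y \<le> B))" for Z B
  have "\<exists>B. bound Z B" if Z0: "Z \<in> orbits G (domains S) \<phi>" for Z
  proof -
    obtain U where U: "U \<in> domains S" and Z: "Z = orbit G \<phi> U" using Z0 unfolding orbits_def by blast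
    show ?thesis
    proof (cases "unbounded_domain U")
      case True
      then have "\<forall>V\<in>Z. unbounded_domain V" using unbounded_domain_action by (auto simp: Z orbit_def)
      then show ?thesis by (simp add: bound_def)
    next
      case False
      then obtain B where B: "\<And>x y. x \<in> carrier G \<Longrightarrow> y \<in> carrier G \<Longrightarrow> cdist S U x y \<le> B"
        using U unfolding unbounded_domain_def by (meson not_less)
      have "cdist S V x y \<le> B" if V: "V \<in> Z" and xy: "x \<in> carrier G" "y \<in> carrier G" for V x y
      proof -
        obtain g where "g \<in> carrier G" "V = \<phi> g U" using V by (auto simp: Z orbit_def)
        then show ?thesis using U B xy by (simp add: cdist_action)
      qed
      then show ?thesis unfolding bound_def by blast
    qed
  qed
  then have "\<forall>Z\<in>orbits G (domains S) \<phi>. \<exists>B. bound Z B" by blast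
  then obtain B where B: "\<forall>Z\<in>orbits G (domains S) \<phi>. bound Z (B Z)" by (rule bchoice[THEN exE])
  have "cdist S U x y \<le> Max (B ` orbits G (domains S) \<phi>)"
    if "U \<in> domains S" "\<not> unbounded_domain U" "x \<in> carrier G" "y \<in> carrier G" for U x y
  proof -
    have Z: "orbit G \<phi> U \<in> orbits G (domains S) \<phi>" using that(1) by (auto simp: orbits_def)
    have "cdist S U x y \<le> B (orbit G \<phi> U)"
      using bspec[OF B Z] orbit_refl[OF that(1)] that(2-4) unfolding bound_def by blast
    also have "\<dots> \<le> Max (B ` orbits G (domains S) \<phi>)" using finite_orbits Z by simp
    finally show ?thesis .
  qed
  then show ?thesis by blast
qed

text \<open>Chains above \<open>U\<close> have bounded cardinality, and the bound drops when \<open>U\<close> is replaced by a larger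
  domain.\<close>

lemma exists_maximal_above:
  assumes D: "D \<subseteq> domains S" and U: "U \<in> D"
  shows "\<exists>M\<in>D. nested S U M \<and> (\<forall>V\<in>D. nested S M V \<longrightarrow> V = M)"
proof -
  have bounded: "\<exists>M\<in>D. nested S U M \<and> (\<forall>V\<in>D. nested S M V \<longrightarrow> V = M)"
    if "U \<in> D" "\<And>C. \<lbrakk>C \<subseteq> domains S; \<forall>V\<in>C. nested S U V; \<forall>V\<in>C. \<forall>W\<in>C. nested S V W \<or> nested S W V\<rbrakk>
      \<Longrightarrow> card C \<le> n" for n U
    using that
  proof (induction n arbitrary: U)
    case 0
    have "card {U} \<le> 0" by (rule "0.prems"(2)) (use 0 D nested_refl in auto)
    then show ?case by simp
  next
    case (Suc n)
    show ?case
    proof (cases "\<forall>V\<in>D. nested S U V \<longrightarrow> V = U")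
      case True
      then show ?thesis using Suc.prems(1) D nested_refl by blast
    next
      case False
      then obtain V where V: "V \<in> D" "nested S U V" "V \<noteq> U" by blast
      have dom: "U \<in> domains S" "V \<in> domains S" using V Suc.prems(1) D by auto
      have "\<exists>M\<in>D. nested S V M \<and> (\<forall>W\<in>D. nested S M W \<longrightarrow> W = M)"
      proof (rule Suc.IH[OF V(1)])
        fix C assume C: "C \<subseteq> domains S" "\<forall>W\<in>C. nested S V W" "\<forall>W\<in>C. \<forall>W'\<in>C. nested S W W' \<or> nested S W' W"
        have above: "nested S U W" if "W \<in> C" for W using C that V dom nested_trans by blast
        have "card (insert U C) \<le> Suc n"
          by (rule Suc.prems(2)) (use C above dom nested_refl in auto)
        moreover have "U \<notin> C" using C V dom nested_antisym by blast
        moreover have "finite C" using finite_complexity C by blast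
        ultimately show "card C \<le> n" by simp
      qed
      then show ?thesis using V dom D nested_trans by blast
    qed
  qed
  obtain n where "\<And>C. \<lbrakk>C \<subseteq> domains S; \<forall>V\<in>C. \<forall>W\<in>C. nested S V W \<or> nested S W V\<rbrakk> \<Longrightarrow> card C \<le> n"
    using finite_complexity by blast
  then show ?thesis using bounded[OF U, of n] by blast
qed

text \<open>Large links covers the domains properly nested in \<open>W\<close> that see \<open>x\<close> and \<open>x'\<close> far apart by some \<open>T\<close>'s,
  whose number is bounded independently of \<open>x\<close> and \<open>x'\<close> if \<open>W\<close> is bounded.  A maximal unbounded
  domain differs from such a \<open>W\<close>, so it is nested in one of the \<open>T\<close>'s, and the chains below \<open>T\<close> are
  shorter than those below \<open>W\<close>.  If \<open>W\<close> is unbounded, no maximal unbounded domain but \<open>W\<close> itself can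
  be nested in it.\<close>

lemma maximal_unbounded_count_below:
  assumes B: "\<forall>U\<in>domains S. \<not> unbounded_domain U \<longrightarrow>
     (\<forall>x\<in>carrier G. \<forall>y\<in>carrier G. cdist S U x y \<le> B)"
  shows "\<exists>K. \<forall>W\<in>domains S.
     (\<forall>C\<subseteq>domains_in S W. (\<forall>U\<in>C. \<forall>V\<in>C. nested S U V \<or> nested S V U) \<longrightarrow> card C \<le> n) \<longrightarrow>
     (\<forall>x\<in>carrier G. \<forall>x'\<in>carrier G.
        let Z = {V. maximal_unbounded V \<and> nested S V W \<and> hconst S \<le> cdist S V x x'}
        in finite Z \<and> card Z \<le> K)"
proof (induction n)
  case 0
  have "\<not> (\<forall>C\<subseteq>domains_in S W. (\<forall>U\<in>C. \<forall>V\<in>C. nested S U V \<or> nested S V U) \<longrightarrow> card C \<le> 0)"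
    if "W \<in> domains S" for W
    using that nested_refl by (intro notI) (auto simp: domains_in_def dest!: spec[of _ "{W}"])
  then show ?case by blast
next
  case (Suc n)
  define seen where "seen W x x' = {V. maximal_unbounded V \<and> nested S V W \<and> hconst S \<le> cdist S V x x'}"
    for W x x'
  define short where "short n W \<longleftrightarrow>
    (\<forall>C\<subseteq>domains_in S W. (\<forall>U\<in>C. \<forall>V\<in>C. nested S U V \<or> nested S V U) \<longrightarrow> card C \<le> n)" for n W
  from Suc.IH obtain K where "\<forall>W\<in>domains S. short n W \<longrightarrow> (\<forall>x\<in>carrier G. \<forall>x'\<in>carrier G.
      finite (seen W x x') \<and> card (seen W x x') \<le> K)"
    unfolding seen_def short_def Let_def by blast
  then have K: "finite (seen W x x') \<and> card (seen W x x') \<le> K"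
    if "W \<in> domains S" "short n W" "x \<in> carrier G" "x' \<in> carrier G" for W x x'
    using that by blast
  define K' where "K' = max 1 (nat \<lfloor>hconst S * B + hconst S\<rfloor> * K)"
  have "finite (seen W x x') \<and> card (seen W x x') \<le> K'"
    if W: "W \<in> domains S" "short (Suc n) W" and x: "x \<in> carrier G" "x' \<in> carrier G" for W x x'
  proof (cases "unbounded_domain W")
    case True
    then have sub: "seen W x x' \<subseteq> {W}" unfolding seen_def maximal_unbounded_def by auto
    have "finite (seen W x x')" "card (seen W x x') \<le> card {W}"
      using finite_subset[OF sub] card_mono[OF _ sub] by simp_all
    then show ?thesis by (auto simp: K'_def)
  next
    case False
    define N where "N = hconst S * cdist S W x x' + hconst S"
    have "cdist S W x x' \<le> B" using B W False x by blast
    then have N: "N \<le> hconst S * B + hconst S" using const_ge_1 by (simp add: N_def)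
    have "\<exists>\<T>\<subseteq>domains_in S W - {W}. finite \<T> \<and> int (card \<T>) \<le> \<lfloor>N\<rfloor> \<and>
        (\<forall>V \<in> domains_in S W - {W}. (\<exists>T\<in>\<T>. nested S V T) \<or> cdist S V x x' < hconst S)"
      using large_links[OF W(1) _ _ N_def] x generating by (simp only: word_metric_simps) blast
    then obtain \<T> where T: "\<T> \<subseteq> domains_in S W - {W}" "finite \<T>" "int (card \<T>) \<le> \<lfloor>N\<rfloor>"
      and cover: "\<And>V. V \<in> domains_in S W - {W} \<Longrightarrow> (\<exists>T\<in>\<T>. nested S V T) \<or> cdist S V x x' < hconst S"
      by blast
    have seen_T: "finite (seen T x x') \<and> card (seen T x x') \<le> K" if T': "T \<in> \<T>" for T
    proof (rule K[OF _ _ x])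
      have TW: "T \<in> domains S" "nested S T W" "T \<noteq> W" using T T' by (auto simp: domains_in_def)
      then show "T \<in> domains S" by simp
      show "short n T"
        unfolding short_def
      proof (intro allI impI)
        fix C assume C: "C \<subseteq> domains_in S T" "\<forall>U\<in>C. \<forall>V\<in>C. nested S U V \<or> nested S V U"
        have below: "nested S U W \<and> U \<in> domains S" if "U \<in> C" for U
          using that C TW W(1) nested_trans[of U T W] by (auto simp: domains_in_def)
        have "insert W C \<subseteq> domains_in S W"
          using below W(1) nested_refl by (auto simp: domains_in_def)
        moreover have "\<forall>U\<in>insert W C. \<forall>V\<in>insert W C. nested S U V \<or> nested S V U"
          using C(2) below W(1) nested_refl by auto
        ultimately have "card (insert W C) \<le> Suc n" using W(2) unfolding short_def by blast
        moreover have "W \<notin> C" using C(1) TW W(1) nested_antisym by (auto simp: domains_in_def)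
        moreover have "finite C" using finite_complexity C below by (meson subsetI)
        ultimately show "card C \<le> n" by simp
      qed
    qed
    have "seen W x x' \<subseteq> (\<Union>T\<in>\<T>. seen T x x')"
    proof
      fix V assume V: "V \<in> seen W x x'"
      then have "V \<in> domains_in S W - {W}"
        using False maximal_unboundedD by (auto simp: seen_def domains_in_def)
      then obtain T where "T \<in> \<T>" "nested S V T" using cover[of V] V by (auto simp: seen_def)
      then show "V \<in> (\<Union>T\<in>\<T>. seen T x x')" using V by (auto simp: seen_def)
    qed
    moreover have fin: "finite (\<Union>T\<in>\<T>. seen T x x')" using T(2) seen_T by blast
    ultimately have "finite (seen W x x')" "card (seen W x x') \<le> card (\<Union>T\<in>\<T>. seen T x x')"
      by (auto intro: finite_subset card_mono)
    moreover have "card (\<Union>T\<in>\<T>. seen T x x') \<le> (\<Sum>T\<in>\<T>. card (seen T x x'))"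
      by (rule card_UN_le[OF T(2)])
    moreover have "(\<Sum>T\<in>\<T>. card (seen T x x')) \<le> card \<T> * K"
      using seen_T sum_bounded_above[of \<T> "\<lambda>T. card (seen T x x')" K] by simp
    moreover have "card \<T> \<le> nat \<lfloor>hconst S * B + hconst S\<rfloor>"
      using T(3) floor_mono[OF N] by linarith
    ultimately show ?thesis
      unfolding K'_def by (meson le_max_iff_disj mult_le_mono1 order_trans)
  qed
  then have "\<forall>W\<in>domains S. short (Suc n) W \<longrightarrow> (\<forall>x\<in>carrier G. \<forall>x'\<in>carrier G.
      finite (seen W x x') \<and> card (seen W x x') \<le> K')"
    by blast
  then show ?case unfolding seen_def short_def Let_def by (rule exI)
qed

lemma maximal_unbounded_count:
  "\<exists>K. \<forall>x\<in>carrier G. \<forall>y\<in>carrier G.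
     let Z = {V. maximal_unbounded V \<and> hconst S \<le> cdist S V x y} in finite Z \<and> card Z \<le> K"
proof (cases "domains S = {}")
  case True
  then have empty: "{V. maximal_unbounded V \<and> hconst S \<le> cdist S V x y} = {}" for x y
    using maximal_unboundedD by auto
  show ?thesis unfolding Let_def empty by (intro exI[of _ 0]) simp
next
  case False
  then obtain M where M: "M \<in> domains S"
    and unique: "\<And>M'. M' \<in> domains S \<Longrightarrow> \<forall>V\<in>domains S. \<not> properly_nested S M' V \<Longrightarrow> M' = M"
    using nested_max by auto
  have top: "nested S V M" if "V \<in> domains S" for V
    using exists_maximal_above[OF order_refl that] unique by (auto simp: properly_nested_def)
  obtain B where B: "\<forall>U\<in>domains S. \<not> unbounded_domain U \<longrightarrow>
     (\<forall>x\<in>carrier G. \<forall>y\<in>carrier G. cdist S U x y \<le> B)"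
    using uniform_bound_bounded_domains by blast
  obtain n where n: "\<And>C. \<lbrakk>C \<subseteq> domains S; \<forall>U\<in>C. \<forall>V\<in>C. nested S U V \<or> nested S V U\<rbrakk> \<Longrightarrow> card C \<le> n"
    using finite_complexity by blast
  have *: "\<forall>C\<subseteq>domains_in S M. (\<forall>U\<in>C. \<forall>V\<in>C. nested S U V \<or> nested S V U) \<longrightarrow> card C \<le> n"
    using n by (auto simp: domains_in_def)
  have all: "{V. maximal_unbounded V \<and> nested S V M \<and> hconst S \<le> cdist S V x y}
      = {V. maximal_unbounded V \<and> hconst S \<le> cdist S V x y}" for x y
    using top maximal_unboundedD by auto
  obtain K where K: "\<forall>W\<in>domains S.
     (\<forall>C\<subseteq>domains_in S W. (\<forall>U\<in>C. \<forall>V\<in>C. nested S U V \<or> nested S V U) \<longrightarrow> card C \<le> n) \<longrightarrow>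
     (\<forall>x\<in>carrier G. \<forall>x'\<in>carrier G.
        let Z = {V. maximal_unbounded V \<and> nested S V W \<and> hconst S \<le> cdist S V x x'}
        in finite Z \<and> card Z \<le> K)"
    using maximal_unbounded_count_below[OF B, of n] by (rule exE)
  show ?thesis using bspec[OF K M, THEN mp, OF *] unfolding all by (rule exI)
qed

end


lemma (in group) finite_word_ball:
  assumes gen: "finite_generating_set G A"
  shows "finite {g \<in> carrier G. word_length G A g \<le> n}"
proof (rule finite_subset)
  show "{g \<in> carrier G. word_length G A g \<le> n}
      \<subseteq> (\<lambda>w. foldr (mult G) w \<one>) ` {w. set w \<subseteq> A \<union> m_inv G ` A \<and> length w \<le> n}"
    by (auto elim!: word_length_witness[OF gen])
  show "finite ((\<lambda>w. foldr (mult G) w \<one>) ` {w. set w \<subseteq> A \<union> m_inv G ` A \<and> length w \<le> n})"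
    using gen by (intro finite_imageI finite_lists_length_le) (auto simp: finite_generating_set_def)
qed

context hhg_structure
begin

text \<open>Uniqueness, applied to a common bound of the bounded domains, would otherwise confine the group to
  a ball, and balls are finite.\<close>

lemma exists_unbounded_domain:
  assumes inf: "infinite (carrier G)"
  shows "\<exists>U. unbounded_domain U"
proof (rule ccontr)
  assume none: "\<nexists>U. unbounded_domain U"
  obtain B where B: "\<forall>U\<in>domains S. \<not> unbounded_domain U \<longrightarrow>
     (\<forall>x\<in>carrier G. \<forall>y\<in>carrier G. cdist S U x y \<le> B)"
    using uniform_bound_bounded_domains by (rule exE)
  obtain \<theta> where \<theta>: "\<And>x y. \<lbrakk>x \<in> carrier G; y \<in> carrier G; word_dist G A x y > \<theta>\<rbrakk>
      \<Longrightarrow> \<exists>U\<in>domains S. cdist S U x y > B"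
    using uniqueness[of B] generating by auto
  have "carrier G \<subseteq> {g \<in> carrier G. word_length G A g \<le> nat \<lceil>\<theta>\<rceil>}"
  proof
    fix g assume g: "g \<in> carrier G"
    have "\<not> word_dist G A \<one> g > \<theta>"
    proof
      assume "word_dist G A \<one> g > \<theta>"
      then obtain U where "U \<in> domains S" "cdist S U \<one> g > B" using \<theta> g by blast
      then show False using B none g by (meson not_le one_closed)
    qed
    then have "word_length G A g \<le> nat \<lceil>\<theta>\<rceil>" using g by (simp add: word_dist_def) linarith
    then show "g \<in> {g \<in> carrier G. word_length G A g \<le> nat \<lceil>\<theta>\<rceil>}" using g by simp
  qed
  then show False using inf finite_word_ball[OF generating] finite_subset by blast
qed

lemma exists_maximal_unbounded:
  assumes "infinite (carrier G)"
  shows "\<exists>V. maximal_unbounded V"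
proof -
  obtain U where "unbounded_domain U" using exists_unbounded_domain[OF assms] ..
  then show ?thesis
    using exists_maximal_above[of "Collect unbounded_domain" U] unbounded_domainD
    unfolding maximal_unbounded_def by blast
qed

text \<open>One \<open>l\<close> serves all domains.  This matters when a point has been realised in several domains
  simultaneously.\<close>

lemma coarsely_dense_cdist:
  assumes "coarsely_dense G A L"
  shows "\<exists>C\<ge>0. \<forall>x\<in>carrier G. \<exists>l\<in>L. \<forall>U\<in>domains S. cdist S U l x \<le> C"
proof -
  obtain R where L: "L \<subseteq> carrier G" and R: "\<And>x. x \<in> carrier G \<Longrightarrow> \<exists>l\<in>L. word_dist G A l x \<le> R"
    using assms unfolding coarsely_dense_def by blast
  have E: "hconst S \<ge> 0" using const_ge_1 by simp
  have "\<exists>l\<in>L. \<forall>U\<in>domains S. cdist S U l x \<le> hconst S * max 0 R + hconst S"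
    if x: "x \<in> carrier G" for x
  proof -
    obtain l where l: "l \<in> L" "word_dist G A l x \<le> R" using R[OF x] by blast
    have "cdist S U l x \<le> hconst S * max 0 R + hconst S" if "U \<in> domains S" for U
    proof -
      have "cdist S U l x \<le> hconst S * word_dist G A l x + hconst S"
        using cdist_le_word_dist[OF that] L l(1) x by blast
      also have "\<dots> \<le> hconst S * max 0 R + hconst S"
        using l(2) E by (intro add_right_mono mult_left_mono) auto
      finally show ?thesis .
    qed
    then show ?thesis using l(1) by blast
  qed
  then show ?thesis using E by (intro exI[of _ "hconst S * max 0 R + hconst S"]) auto
qed

text \<open>A bound for the displacements of the elements of \<open>L\<close> would bound the whole image of the group.\<close>

lemma unbounded_on_coarsely_dense:
  assumes U: "unbounded_domain U" and L: "coarsely_dense G A L"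
  shows "\<exists>l\<in>L. cdist S U \<one> l > B"
proof (rule ccontr)
  assume not: "\<not> (\<exists>l\<in>L. cdist S U \<one> l > B)"
  obtain C where C: "\<And>x. x \<in> carrier G \<Longrightarrow> \<exists>l\<in>L. \<forall>U\<in>domains S. cdist S U l x \<le> C"
    using coarsely_dense_cdist[OF L] by blast
  note Ud = unbounded_domainD[OF U]
  have near: "cdist S U \<one> x \<le> B + C" if x: "x \<in> carrier G" for x
  proof -
    obtain l where "l \<in> L" "cdist S U l x \<le> C" using C[OF x] Ud by blast
    moreover have "l \<in> carrier G" using L \<open>l \<in> L\<close> by (auto simp: coarsely_dense_def)
    ultimately show ?thesis using cdist_triangle[OF Ud one_closed _ x, of l] not by force
  qed
  obtain x y where xy: "x \<in> carrier G" "y \<in> carrier G" "cdist S U x y > 2 * (B + C)"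
    using U unfolding unbounded_domain_def by blast
  show False
    using cdist_triangle[OF Ud xy(1) one_closed xy(2)] near[OF xy(1)] near[OF xy(2)] xy(3)
    by (simp add: cdist_commute[of U x \<one>])
qed

section \<open>Abelian subgroups and their rotations\<close>

text \<open>For commuting \<open>g\<close> and \<open>h\<close> the displacement of \<open>g\<close> seen by the translate \<open>hV\<close> is its
  displacement at \<open>h\<inverse>\<close> seen by \<open>V\<close>, hence nearly its displacement at the identity.  An element
  \<open>g\<close> moving far in \<open>V\<close> therefore moves far in any given number of translates of \<open>V\<close>.\<close>

lemma finite_abelian_orbit:
  assumes L: "subgroup L G" and comm: "\<And>x y. \<lbrakk>x \<in> L; y \<in> L\<rbrakk> \<Longrightarrow> x \<otimes> y = y \<otimes> x"
    and dense: "coarsely_dense G A L" and V: "maximal_unbounded V"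
  shows "finite ((\<lambda>h. \<phi> h V) ` L)"
proof -
  have Lc: "L \<subseteq> carrier G" using L by (rule subgroup.subset)
  note Vd = maximal_unboundedD(1)[OF V]
  obtain K where K: "\<And>x y. \<lbrakk>x \<in> carrier G; y \<in> carrier G\<rbrakk>
    \<Longrightarrow> finite {V. maximal_unbounded V \<and> hconst S \<le> cdist S V x y}
      \<and> card {V. maximal_unbounded V \<and> hconst S \<le> cdist S V x y} \<le> K"
    using maximal_unbounded_count unfolding Let_def by blast
  have "card Z \<le> K" if Z: "Z \<subseteq> (\<lambda>h. \<phi> h V) ` L" "finite Z" for Z
  proof -
    obtain H where H: "H \<subseteq> L" "finite H" "Z = (\<lambda>h. \<phi> h V) ` H"
      using Z finite_subset_image by metis
    define c where "c h = hconst S * word_length G A (inv h) + hconst S" for h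
    obtain g where g: "g \<in> L" "cdist S V \<one> g > hconst S + 2 * (\<Sum>h\<in>H. c h)"
      using unbounded_on_coarsely_dense[OF maximal_unboundedD(2)[OF V] dense] by blast
    have "\<phi> h V \<in> {V. maximal_unbounded V \<and> hconst S \<le> cdist S V \<one> g}" if h: "h \<in> H" for h
    proof -
      have hL: "h \<in> L" "inv h \<in> L" using h H subgroup.m_inv_closed[OF L] by auto
      then have car: "h \<in> carrier G" "g \<in> carrier G" "inv h \<in> carrier G" using Lc g(1) by auto
      have "cdist S (\<phi> h V) \<one> g = cdist S V (inv h) (g \<otimes> inv h)"
        using car Vd comm[OF hL(2) g(1)] by (simp add: cdist_action)
      moreover have "cdist S V \<one> (inv h) \<le> c h" "cdist S V g (g \<otimes> inv h) \<le> c h"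
        using cdist_right_translate[OF Vd one_closed car(3)] cdist_right_translate[OF Vd car(2,3)] car
        by (simp_all add: c_def)
      moreover have "c h \<le> (\<Sum>h\<in>H. c h)"
        using H(2) h const_ge_1 by (intro member_le_sum) (auto simp: c_def)
      ultimately have "hconst S \<le> cdist S (\<phi> h V) \<one> g"
        using cdist_triangle[OF Vd one_closed car(3), of g]
          cdist_triangle[OF Vd car(3) m_closed[OF car(2,3)] car(2)] g(2) car
        by (simp add: cdist_commute[of V "g \<otimes> inv h" g])
      then show ?thesis using maximal_unbounded_action[OF car(1) V] by simp
    qed
    then have "Z \<subseteq> {V. maximal_unbounded V \<and> hconst S \<le> cdist S V \<one> g}" using H(3) by blast
    then show ?thesis
      using K[OF one_closed, of g] g(1) Lc card_mono by (meson order_trans subsetD)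
  qed
  then show ?thesis using finite_if_finite_subsets_card_bdd by blast
qed

text \<open>The elements of \<open>L\<close> move the domains of \<open>\<V>\<close> in finitely many ways.  With one representative \<open>f\<close> for
  each way, every element of \<open>L\<close> is an element of the stabilizer times some \<open>f\<close>.\<close>

lemma coarsely_dense_stabilizer:
  assumes L: "subgroup L G" and comm: "\<And>x y. \<lbrakk>x \<in> L; y \<in> L\<rbrakk> \<Longrightarrow> x \<otimes> y = y \<otimes> x"
    and dense: "coarsely_dense G A L"
    and \<V>: "finite \<V>" "\<And>V. V \<in> \<V> \<Longrightarrow> V \<in> domains S" "\<And>V. V \<in> \<V> \<Longrightarrow> finite ((\<lambda>h. \<phi> h V) ` L)"
  shows "coarsely_dense G A {l \<in> L. \<forall>V\<in>\<V>. \<phi> l V = V}"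
proof -
  let ?L' = "{l \<in> L. \<forall>V\<in>\<V>. \<phi> l V = V}"
  have Lc: "L \<subseteq> carrier G" using L by (rule subgroup.subset)
  define move where "move l = restrict (\<phi> l) \<V>" for l
  have "move ` L \<subseteq> (\<Pi>\<^sub>E V\<in>\<V>. (\<lambda>h. \<phi> h V) ` L)" by (auto simp: move_def)
  then have fin: "finite (move ` L)" using \<V> by (meson finite_PiE finite_subset)
  define rep where "rep f = (SOME l. l \<in> L \<and> move l = f)" for f
  have rep: "rep (move l) \<in> L \<and> move (rep (move l)) = move l" if "l \<in> L" for l
    unfolding rep_def using that by (intro someI[of "\<lambda>k. k \<in> L \<and> move k = move l" l]) simp
  define F where "F = rep ` move ` L"
  have F: "finite F" "F \<subseteq> L" using fin rep by (auto simp: F_def)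
  obtain R where R: "\<And>x. x \<in> carrier G \<Longrightarrow> \<exists>l\<in>L. word_dist G A l x \<le> R"
    using dense unfolding coarsely_dense_def by blast
  have "\<exists>l\<in>?L'. word_dist G A l x \<le> (\<Sum>f\<in>F. real (word_length G A f)) + R" if x: "x \<in> carrier G" for x
  proof -
    obtain l where l: "l \<in> L" "word_dist G A l x \<le> R" using R[OF x] by blast
    define f where "f = rep (move l)"
    have f: "f \<in> F" "f \<in> L" "move f = move l" using l(1) rep by (auto simp: f_def F_def)
    have car: "f \<in> carrier G" "l \<in> carrier G" using f(2) l(1) Lc by auto
    have L': "l \<otimes> inv f \<in> ?L'"
    proof -
      have fL: "inv f \<in> L" using f(2) by (rule subgroup.m_inv_closed[OF L])
      have "\<phi> (l \<otimes> inv f) V = V" if V: "V \<in> \<V>" for V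
      proof -
        have "\<phi> f V = \<phi> l V" using f(3) V by (auto simp: move_def dest: fun_cong[of _ _ V])
        moreover have "\<phi> (inv f \<otimes> l) V = \<phi> (inv f) (\<phi> l V)"
          using V \<V>(2) car by (intro composition_rule) auto
        ultimately have "\<phi> (inv f \<otimes> l) V = V" using car V \<V>(2) by (metis action_inv(1))
        then show ?thesis using comm[OF l(1) fL] by simp
      qed
      then show ?thesis using subgroup.m_closed[OF L l(1) fL] by blast
    qed
    have "word_dist G A (l \<otimes> inv f) l = word_length G A f"
      using car by (simp add: word_dist_def inv_mult_group m_assoc)
    moreover have "word_dist G A (l \<otimes> inv f) x \<le> word_dist G A (l \<otimes> inv f) l + word_dist G A l x"
      using Metric_space.triangle[OF Metric_space_word_dist[OF generating]] car x by simp
    moreover have "word_length G A f \<le> (\<Sum>f\<in>F. real (word_length G A f))"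
      using F f(1) by (intro member_le_sum) auto
    ultimately show ?thesis using L' l(2) by (intro bexI[OF _ L']) linarith
  qed
  moreover have "?L' \<subseteq> carrier G" using Lc by blast
  ultimately show ?thesis unfolding coarsely_dense_def by blast
qed

lemma cdist_stabilizer:
  assumes "g \<in> carrier G" "U \<in> domains S" "\<phi> g U = U" "x \<in> carrier G" "y \<in> carrier G"
  shows "cdist S U (g \<otimes> x) (g \<otimes> y) = cdist S U x y"
  using cdist_equivariant[of g U x y] assms by simp

lemma action_mult_fixed:
  assumes "g \<in> carrier G" "h \<in> carrier G" "U \<in> domains S" "\<phi> g U = U" "\<phi> h U = U"
  shows "\<phi> (g \<otimes> h) U = U"
  using composition_rule[of U g h] assms by simp

lemma action_inv_fixed:
  assumes "g \<in> carrier G" "U \<in> domains S" "\<phi> g U = U"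
  shows "\<phi> (inv g) U = U"
  using action_inv(1)[OF assms(1,2)] assms(3) by simp

text \<open>Maximality excludes nesting.  If \<open>V\<close> and \<open>W\<close> were transverse, \<open>L\<close> would preserve the bounded set
  \<open>rho S W V\<close>, and then its orbits in the hyperbolic space of \<open>V\<close> would be bounded.\<close>

lemma maximal_unbounded_orthogonal:
  assumes V: "maximal_unbounded V" and W: "maximal_unbounded W" and neq: "V \<noteq> W"
    and dense: "coarsely_dense G A L" and fixed: "\<And>l. l \<in> L \<Longrightarrow> \<phi> l V = V \<and> \<phi> l W = W"
  shows "orth S V W"
proof (rule ccontr)
  assume "\<not> orth S V W"
  note dom = maximal_unboundedD(1)[OF V] maximal_unboundedD(1)[OF W]
  have "\<not> nested S V W" "\<not> nested S W V" using V W neq by (auto simp: maximal_unbounded_def)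
  then have tr: "transverse S V W" "transverse S W V"
    using \<open>\<not> orth S V W\<close> neq orth_sym[OF dom(2,1)] by (auto simp: transverse_def)
  note rho = rho_transverse[OF dom(2,1) tr(2)]
  obtain p where p: "p \<in> rho S W V" using rho by blast
  have pV: "p \<in> mspace (cspace S V)" using p rho by blast
  have "cdist S V \<one> l \<le> 2 * mdist (cspace S V) (cproj S V \<one>) p + hconst S" if l: "l \<in> L" for l
  proof -
    have lG: "l \<in> carrier G" using dense l by (auto simp: coarsely_dense_def)
    let ?m = "cspace S V" and ?q = "\<psi> l V p"
    have "?q \<in> rho S W V"
      using rho_equivariant[OF lG dom disjI1[OF tr(1)]] fixed[OF l] p by (metis imageI)
    then have q: "mdist ?m p ?q \<le> hconst S" "?q \<in> mspace ?m"
      using mdist_le_mdiam[OF p] rho by blast+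
    have "\<psi> l V (cproj S V \<one>) = cproj S V l"
      using proj_equivariant[OF lG one_closed dom(1)] fixed[OF l] lG by simp
    then have "mdist ?m (cproj S V l) ?q = mdist ?m (cproj S V \<one>) p"
      using isom_dist[OF lG dom(1) cproj_in[OF dom(1) one_closed] pV] fixed[OF l] by simp
    moreover have "mdist ?m (cproj S V \<one>) (cproj S V l)
        \<le> mdist ?m (cproj S V \<one>) p + mdist ?m p (cproj S V l)"
      "mdist ?m p (cproj S V l) \<le> mdist ?m p ?q + mdist ?m ?q (cproj S V l)"
      using pV q lG dom cproj_in by (auto intro!: mdist_triangle)
    ultimately show ?thesis using q(1) by (simp add: cdist_def mdist_commute)
  qed
  moreover obtain l where "l \<in> L"
    "cdist S V \<one> l > 2 * mdist (cspace S V) (cproj S V \<one>) p + hconst S"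
    using unbounded_on_coarsely_dense[OF maximal_unboundedD(2)[OF V] dense] by blast
  ultimately show False by fastforce
qed

text \<open>By equivariance the displacement of \<open>l\<close> in \<open>rU\<close> is the distance in \<open>U\<close> from \<open>r\<inverse>\<close> to \<open>r\<inverse>l\<close>, and right
  multiplication of both by \<open>r\<close> moves each of them a bounded distance only.\<close>

lemma cdist_conjugate:
  assumes r: "r \<in> carrier G" and U: "U \<in> domains S" and l: "l \<in> carrier G"
  shows "\<bar>cdist S (\<phi> r U) \<one> l - cdist S U \<one> (inv r \<otimes> l \<otimes> r)\<bar>
      \<le> 2 * (hconst S * word_length G A r + hconst S)"
proof -
  let ?c = "hconst S * word_length G A r + hconst S"
  have "cdist S U (inv r) \<one> \<le> ?c" using cdist_right_translate[OF U _ r, of "inv r"] r by simp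
  moreover have "cdist S U (inv r \<otimes> l) (inv r \<otimes> l \<otimes> r) \<le> ?c"
    using cdist_right_translate[OF U _ r, of "inv r \<otimes> l"] r l by simp
  moreover have "cdist S (\<phi> r U) \<one> l = cdist S U (inv r) (inv r \<otimes> l)"
    using r U l by (simp add: cdist_action)
  moreover have "cdist S U (inv r) (inv r \<otimes> l) \<le> cdist S U (inv r) \<one> + cdist S U \<one> (inv r \<otimes> l \<otimes> r)
      + cdist S U (inv r \<otimes> l \<otimes> r) (inv r \<otimes> l)"
    using cdist_triangle[OF U, of "inv r" \<one> "inv r \<otimes> l"]
      cdist_triangle[OF U, of \<one> "inv r \<otimes> l \<otimes> r" "inv r \<otimes> l"] r l by simp
  moreover have "cdist S U \<one> (inv r \<otimes> l \<otimes> r) \<le> cdist S U \<one> (inv r) + cdist S U (inv r) (inv r \<otimes> l)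
      + cdist S U (inv r \<otimes> l) (inv r \<otimes> l \<otimes> r)"
    using cdist_triangle[OF U, of \<one> "inv r" "inv r \<otimes> l \<otimes> r"]
      cdist_triangle[OF U, of "inv r" "inv r \<otimes> l" "inv r \<otimes> l \<otimes> r"] r l by simp
  ultimately show ?thesis
    by (simp add: cdist_commute[of U _ \<one>] cdist_commute[of U "inv r \<otimes> l \<otimes> r" "inv r \<otimes> l"] abs_le_iff)
qed

text \<open>This is the four-point inequality for \<open>\<one>\<close>, \<open>g\<close>, \<open>h\<close> and \<open>gh\<close>: as \<open>g\<close> and \<open>h\<close> commute, opposite sides of
  this quadrilateral have the same length in \<open>U\<close>.\<close>

lemma cdist_commuting:
  assumes car: "g \<in> carrier G" "h \<in> carrier G" and U: "U \<in> domains S"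
    and fixed: "\<phi> g U = U" "\<phi> h U = U" and comm: "g \<otimes> h = h \<otimes> g"
  shows "cdist S U \<one> (g \<otimes> h) + cdist S U \<one> (inv g \<otimes> h)
    \<le> 2 * max (cdist S U \<one> g) (cdist S U \<one> h) + 6 * hconst S + 2"
proof -
  have "cdist S U \<one> (g \<otimes> h) + cdist S U g h
      \<le> max (cdist S U \<one> g + cdist S U (g \<otimes> h) h) (cdist S U \<one> h + cdist S U g (g \<otimes> h))
        + 6 * hconst S + 2"
    unfolding cdist_def using car U
    by (intro four_point_inequality geodesic hyperbolic cproj_in) auto
  moreover have "cdist S U g h = cdist S U \<one> (inv g \<otimes> h)"
    using cdist_stabilizer[OF car(1) U fixed(1), of \<one> "inv g \<otimes> h"] car by (simp add: m_assoc[symmetric])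
  moreover have "cdist S U (g \<otimes> h) h = cdist S U \<one> g"
    using cdist_stabilizer[OF car(2) U fixed(2), of g \<one>] car comm by (simp add: cdist_commute)
  moreover have "cdist S U g (g \<otimes> h) = cdist S U \<one> h"
    using cdist_stabilizer[OF car(1) U fixed(1), of \<one> h] car by simp
  ultimately show ?thesis by (simp add: max_def split: if_splits)
qed

text \<open>Take for \<open>h\<close> an element of \<open>L\<close> near the middle of a geodesic from \<open>\<one>\<close> to \<open>g\<close>.  It is almost a square
  root of \<open>g\<close> as far as \<open>U\<close> can see: by the previous lemma, applied to \<open>h\<close> and \<open>h\<inverse>g\<close>, these two are
  close, because the displacement of their product \<open>g\<close> is as large as possible.\<close>

lemma almost_square_root:
  assumes U: "U \<in> domains S" and dense: "coarsely_dense G A L"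
    and comm: "\<And>x y. \<lbrakk>x \<in> L; y \<in> L\<rbrakk> \<Longrightarrow> x \<otimes> y = y \<otimes> x"
    and fixed: "\<And>l. l \<in> L \<Longrightarrow> \<phi> l U = U"
  shows "\<exists>C. \<forall>g\<in>L. \<exists>h\<in>L. cdist S U \<one> h \<ge> cdist S U \<one> g / 2 - C
    \<and> cdist S U \<one> (h \<otimes> h) \<ge> 2 * cdist S U \<one> h - C"
proof -
  obtain C0 where C0: "\<And>x. x \<in> carrier G \<Longrightarrow> \<exists>l\<in>L. \<forall>U\<in>domains S. cdist S U l x \<le> C0" and C0_0: "C0 \<ge> 0"
    using coarsely_dense_cdist[OF dense] by blast
  define C where "C = hconst S + 1 + C0"
  define D where "D = 6 * hconst S + 2"
  let ?m = "cspace S U" and ?d = "cdist S U"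
  have "\<exists>h\<in>L. ?d \<one> h \<ge> ?d \<one> g / 2 - (4 * C + D) \<and> ?d \<one> (h \<otimes> h) \<ge> 2 * ?d \<one> h - (4 * C + D)"
    if g: "g \<in> L" for g
  proof -
    have gG: "g \<in> carrier G" using dense g by (auto simp: coarsely_dense_def)
    obtain \<gamma> where \<gamma>: "geodesic_path ?m (cproj S U \<one>) (cproj S U g) \<gamma>"
      using geodesic[OF U] cproj_in[OF U] gG unfolding geodesic_metric_def geodesic_segment_def
      by (metis one_closed)
    define p where "p = \<gamma> (?d \<one> g / 2)"
    have half: "?d \<one> g / 2 \<in> {0..?d \<one> g}" "0 \<in> {0..?d \<one> g}" "?d \<one> g \<in> {0..?d \<one> g}" by auto
    have p: "p \<in> mspace ?m" and dp: "mdist ?m (cproj S U \<one>) p = ?d \<one> g / 2"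
      "mdist ?m p (cproj S U g) = ?d \<one> g / 2"
    proof -
      show "p \<in> mspace ?m" using \<gamma> half unfolding geodesic_path_def p_def cdist_def by blast
      have ends: "\<gamma> 0 = cproj S U \<one>" "\<gamma> (?d \<one> g) = cproj S U g"
        and iso: "\<And>s t. \<lbrakk>s \<in> {0..?d \<one> g}; t \<in> {0..?d \<one> g}\<rbrakk> \<Longrightarrow> mdist ?m (\<gamma> s) (\<gamma> t) = \<bar>s - t\<bar>"
        using \<gamma> unfolding geodesic_path_def cdist_def by auto
      show "mdist ?m (cproj S U \<one>) p = ?d \<one> g / 2" "mdist ?m p (cproj S U g) = ?d \<one> g / 2"
        using iso[OF half(2,1)] iso[OF half(1,3)] ends by (auto simp: p_def)
    qed
    obtain x where x: "x \<in> carrier G" "mdist ?m p (cproj S U x) < hconst S + 1"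
      using near_point_of_set[OF proj_coarsely_onto[OF U p], of "hconst S + 1"] generating by auto
    obtain h where h: "h \<in> L" "?d h x \<le> C0" using C0[OF x(1)] U by blast
    have hG: "h \<in> carrier G" using dense h by (auto simp: coarsely_dense_def)
    note [simp] = cproj_in[OF U]
    have "mdist ?m p (cproj S U h) \<le> mdist ?m p (cproj S U x) + mdist ?m (cproj S U x) (cproj S U h)"
      using p x hG by (intro mdist_triangle) auto
    then have ph: "mdist ?m p (cproj S U h) \<le> C"
      using x(2) h(2) by (simp add: C_def cdist_def mdist_commute)
    have h_le: "?d \<one> h \<le> ?d \<one> g / 2 + C"
      using mdist_triangle[of "cproj S U \<one>" ?m p "cproj S U h"] p hG dp ph by (simp add: cdist_def)
    have h_ge: "?d \<one> h \<ge> ?d \<one> g / 2 - C"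
      using mdist_triangle[of "cproj S U \<one>" ?m "cproj S U h" p] p hG dp ph
      by (simp add: cdist_def mdist_commute)
    define k where "k = inv h \<otimes> g"
    have kG: "k \<in> carrier G" using hG gG by (simp add: k_def)
    have hk: "h \<otimes> k = g" using hG gG by (simp add: k_def m_assoc[symmetric])
    have "k \<otimes> h = inv h \<otimes> (h \<otimes> g)" using comm[OF g h(1)] hG gG by (simp add: k_def m_assoc)
    then have kh: "k \<otimes> h = g" using hG gG by (simp add: m_assoc[symmetric])
    have fixed_k: "\<phi> k U = U"
      unfolding k_def using hG gG U fixed[OF g] fixed[OF h(1)]
      by (intro action_mult_fixed action_inv_fixed) auto
    have "?d \<one> k = ?d h g"
      using cdist_stabilizer[OF hG U fixed[OF h(1)] one_closed kG] hG hk by simp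
    also have "\<dots> \<le> ?d \<one> g / 2 + C"
      using mdist_triangle[of "cproj S U h" ?m p "cproj S U g"] p hG gG dp ph
      by (simp add: cdist_def mdist_commute)
    finally have k_le: "?d \<one> k \<le> ?d \<one> g / 2 + C" .
    have close: "?d \<one> (inv h \<otimes> k) \<le> 2 * C + D"
      using cdist_commuting[OF hG kG U fixed[OF h(1)] fixed_k] hk kh h_le k_le by (simp add: D_def)
    have "?d (h \<otimes> h) g = ?d h k"
      using cdist_stabilizer[OF hG U fixed[OF h(1)] hG kG] hk by simp
    also have "\<dots> = ?d \<one> (inv h \<otimes> k)"
      using cdist_stabilizer[OF hG U fixed[OF h(1)], of \<one> "inv h \<otimes> k"] hG kG
      by (simp add: m_assoc[symmetric])
    finally have "?d \<one> g \<le> ?d \<one> (h \<otimes> h) + (2 * C + D)"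
      using cdist_triangle[OF U one_closed m_closed[OF hG hG] gG] close by simp
    moreover have "C \<ge> 0" "D \<ge> 0" using C0_0 const_ge_1 by (simp_all add: C_def D_def)
    ultimately show ?thesis using h(1) h_le h_ge by (intro bexI[OF _ h(1)]) auto
  qed
  then show ?thesis by blast
qed


text \<open>Suppose \<open>rV = V\<close>.  Then \<open>h\<close>, its conjugate \<open>h'\<close> and, as the third conjugate is inverse to it, the
  product \<open>hh'\<close> have nearly the same displacement \<open>s\<close> in \<open>V\<close>.  The inequality for commuting elements
  shows first that the displacement of \<open>h\<inverse>h'\<close> is at most about \<open>s\<close>, and then, for \<open>h\<inverse>h'\<close> and \<open>hh'\<close>
  with product \<open>h'\<^sup>2\<close> and quotient \<open>h\<^sup>2\<close>, that the displacements of the two squares add up to at most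
  about \<open>2s\<close>.  For almost square roots \<open>h\<close> of elements moving far they add up to about \<open>4s\<close>.\<close>

lemma conjugation_moves_unbounded_domain:
  assumes V: "unbounded_domain V" and r: "r \<in> carrier G" and dense: "coarsely_dense G A L"
    and comm: "\<And>x y. \<lbrakk>x \<in> L; y \<in> L\<rbrakk> \<Longrightarrow> x \<otimes> y = y \<otimes> x"
    and fixed: "\<And>l. l \<in> L \<Longrightarrow> \<phi> l V = V"
    and conj: "\<And>l. l \<in> L \<Longrightarrow> inv r \<otimes> l \<otimes> r \<in> L"
    and norm: "\<And>l. l \<in> L \<Longrightarrow>
      l \<otimes> (inv r \<otimes> l \<otimes> r) \<otimes> (inv r \<otimes> (inv r \<otimes> l \<otimes> r) \<otimes> r) = \<one>"
  shows "\<phi> r V \<noteq> V"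
proof
  assume rV: "\<phi> r V = V"
  note Vd = unbounded_domainD[OF V]
  let ?d = "cdist S V \<one>"
  define c where "c = 2 * (hconst S * word_length G A r + hconst S)"
  define D where "D = 6 * hconst S + 2"
  have Lc: "L \<subseteq> carrier G" using dense by (simp add: coarsely_dense_def)
  have conj_le: "\<bar>?d l - ?d (inv r \<otimes> l \<otimes> r)\<bar> \<le> c" if "l \<in> carrier G" for l
    using cdist_conjugate[OF r Vd that] rV by (simp add: c_def)
  obtain C where C: "\<And>g. g \<in> L \<Longrightarrow> \<exists>h\<in>L. ?d h \<ge> ?d g / 2 - C \<and> ?d (h \<otimes> h) \<ge> 2 * ?d h - C"
    using almost_square_root[OF Vd dense comm fixed] by blast
  obtain g where g: "g \<in> L" "?d g > 2 * (C + C + (9 * c + 3 * D) / 2)"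
    using unbounded_on_coarsely_dense[OF V dense] by blast
  obtain h where h: "h \<in> L" "?d h \<ge> ?d g / 2 - C" "?d (h \<otimes> h) \<ge> 2 * ?d h - C"
    using C[OF g(1)] by blast
  define h' where "h' = inv r \<otimes> h \<otimes> r"
  define h'' where "h'' = inv r \<otimes> h' \<otimes> r"
  have L: "h \<in> L" "h' \<in> L" "h'' \<in> L" using h(1) conj by (simp_all add: h'_def h''_def)
  then have car [simp]: "h \<in> carrier G" "h' \<in> carrier G" "h'' \<in> carrier G" using Lc by auto
  note [simp] = fixed[OF L(1)] fixed[OF L(2)] Vd
  have hh': "h' \<otimes> h = h \<otimes> h'" using comm L by blast
  have d': "\<bar>?d h - ?d h'\<bar> \<le> c" and d'': "\<bar>?d h' - ?d h''\<bar> \<le> c"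
    using conj_le[OF car(1)] conj_le[OF car(2)] by (simp_all add: h'_def h''_def)
  have "h \<otimes> h' \<otimes> h'' = \<one>" using norm[OF h(1)] by (simp add: h'_def h''_def)
  then have "h \<otimes> h' = inv h''" by (simp add: inv_equality)
  moreover have "?d (inv h'') = ?d h''"
    using cdist_stabilizer[OF car(3) Vd fixed[OF L(3)], of \<one> "inv h''"] by (simp add: cdist_commute)
  ultimately have prod: "?d (h \<otimes> h') = ?d h''" by simp
  have "?d (h \<otimes> h') + ?d (inv h \<otimes> h') \<le> 2 * max (?d h) (?d h') + D"
    using cdist_commuting[of h h' V] hh' by (simp add: D_def)
  then have quot: "?d (inv h \<otimes> h') \<le> ?d h + 4 * c + D" using prod d' d'' by (simp add: max_def split: if_splits)
  have inv_hh': "inv h \<otimes> h' = h' \<otimes> inv h"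
    by (metis car(1,2) hh' inv_closed inv_solve_left inv_solve_right m_assoc m_closed)
  have fix1: "\<phi> (inv h \<otimes> h') V = V" "\<phi> (h \<otimes> h') V = V"
    by (auto intro!: action_mult_fixed action_inv_fixed)
  have prod1: "(inv h \<otimes> h') \<otimes> (h \<otimes> h') = h' \<otimes> h'" "(h \<otimes> h') \<otimes> (inv h \<otimes> h') = h' \<otimes> h'"
    "inv (inv h \<otimes> h') \<otimes> (h \<otimes> h') = h \<otimes> h"
  proof -
    have cancel: "inv h \<otimes> (h \<otimes> x) = x" "h \<otimes> (inv h \<otimes> x) = x" "inv h' \<otimes> (h' \<otimes> x) = x"
      if "x \<in> carrier G" for x using that by (simp_all add: m_assoc[symmetric])
    have "(inv h \<otimes> h') \<otimes> (h \<otimes> h') = (h' \<otimes> inv h) \<otimes> (h \<otimes> h')" by (simp only: inv_hh')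
    then show "(inv h \<otimes> h') \<otimes> (h \<otimes> h') = h' \<otimes> h'" by (simp add: m_assoc cancel)
    have "(h \<otimes> h') \<otimes> (inv h \<otimes> h') = (h' \<otimes> h) \<otimes> (inv h \<otimes> h')" by (simp only: hh')
    then show "(h \<otimes> h') \<otimes> (inv h \<otimes> h') = h' \<otimes> h'" by (simp add: m_assoc cancel)
    have "inv (inv h \<otimes> h') \<otimes> (h \<otimes> h') = inv h' \<otimes> (h \<otimes> (h' \<otimes> h))"
      unfolding hh' by (simp add: inv_mult_group m_assoc)
    also have "h \<otimes> (h' \<otimes> h) = h' \<otimes> (h \<otimes> h)" by (simp add: hh'[symmetric] m_assoc[symmetric])
    finally show "inv (inv h \<otimes> h') \<otimes> (h \<otimes> h') = h \<otimes> h" by (simp add: cancel)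
  qed
  have "?d (h' \<otimes> h') + ?d (h \<otimes> h) \<le> 2 * max (?d (inv h \<otimes> h')) (?d (h \<otimes> h')) + D"
    using cdist_commuting[of "inv h \<otimes> h'" "h \<otimes> h'" V] fix1 prod1 by (simp add: D_def)
  also have "\<dots> \<le> 2 * (?d h + 4 * c + D) + D"
    using quot prod d' d'' const_ge_1 by (simp add: D_def)
  finally have "?d (h' \<otimes> h') + ?d (h \<otimes> h) \<le> 2 * ?d h + 8 * c + 3 * D" by simp
  moreover have "inv r \<otimes> (h \<otimes> h) \<otimes> r = h' \<otimes> h'"
  proof -
    have "h' \<otimes> h' = inv r \<otimes> h \<otimes> (r \<otimes> inv r) \<otimes> h \<otimes> r"
      using r by (simp only: h'_def m_assoc m_closed inv_closed car)
    then show ?thesis using r by (simp add: m_assoc)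
  qed
  then have "\<bar>?d (h \<otimes> h) - ?d (h' \<otimes> h')\<bar> \<le> c" using conj_le[of "h \<otimes> h"] by simp
  ultimately show False using h(2,3) g(2) by (simp add: field_simps)
qed

text \<open>If the domains were orthogonal, partial realisation would give \<open>l \<in> L\<close> with a large displacement in
  \<open>V\<close> and small ones in \<open>rV\<close> and \<open>r\<^sup>2V\<close>.  But \<open>l\<close> is the inverse of the product of its two conjugates,
  whose displacements in \<open>V\<close> are about those of \<open>l\<close> in \<open>rV\<close> and \<open>r\<^sup>2V\<close>.\<close>

lemma conjugation_orbit_not_orthogonal:
  assumes V: "unbounded_domain V" and r: "r \<in> carrier G" and dense: "coarsely_dense G A L"
    and fixed: "\<And>l. l \<in> L \<Longrightarrow> \<phi> l V = V"
    and conj: "\<And>l. l \<in> L \<Longrightarrow> inv r \<otimes> l \<otimes> r \<in> L"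
    and norm: "\<And>l. l \<in> L \<Longrightarrow>
      l \<otimes> (inv r \<otimes> l \<otimes> r) \<otimes> (inv r \<otimes> (inv r \<otimes> l \<otimes> r) \<otimes> r) = \<one>"
  shows "\<not> (pairwise (orth S) {V, \<phi> r V, \<phi> r (\<phi> r V)} \<and> V \<noteq> \<phi> r V \<and> V \<noteq> \<phi> r (\<phi> r V))"
proof
  assume orth: "pairwise (orth S) {V, \<phi> r V, \<phi> r (\<phi> r V)} \<and> V \<noteq> \<phi> r V \<and> V \<noteq> \<phi> r (\<phi> r V)"
  note Vd = unbounded_domainD[OF V]
  define W where "W = \<phi> r V"
  define W' where "W' = \<phi> r W"
  have dom: "V \<in> domains S" "W \<in> domains S" "W' \<in> domains S"
    using Vd r by (auto simp: W_def W'_def action_closed)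
  have neq: "W \<noteq> V" "W' \<noteq> V" using orth by (auto simp: W_def W'_def)
  define c where "c = 2 * (hconst S * word_length G A r + hconst S)"
  have Lc: "L \<subseteq> carrier G" using dense by (simp add: coarsely_dense_def)
  obtain C where C: "\<And>x. x \<in> carrier G \<Longrightarrow> \<exists>l\<in>L. \<forall>U\<in>domains S. cdist S U l x \<le> C"
    using coarsely_dense_cdist[OF dense] by blast
  define C' where "C' = C + hconst S"
  obtain g where g: "g \<in> L" "cdist S V \<one> g > 3 * C' + 3 * c"
    using unbounded_on_coarsely_dense[OF V dense] by blast
  have gG: "g \<in> carrier G" using g(1) Lc by blast
  define f where "f U = (if U = V then cproj S U g else cproj S U \<one>)" for U
  have "\<exists>x\<in>mspace (word_metric G A). \<forall>U\<in>{V, W, W'}. csetdist S U x {f U} \<le> hconst S \<and>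
      (\<forall>V\<in>domains S. properly_nested S U V \<or> transverse S U V \<longrightarrow> csetdist S V x (rho S U V) \<le> hconst S)"
    using orth dom gG
    by (intro partial_realisation) (auto simp: W_def W'_def f_def intro!: cproj_in)
  then obtain x where x: "x \<in> carrier G" "\<And>U. U \<in> {V, W, W'} \<Longrightarrow> csetdist S U x {f U} \<le> hconst S"
    using generating by auto
  obtain l where l: "l \<in> L" "\<And>U. U \<in> domains S \<Longrightarrow> cdist S U l x \<le> C" using C[OF x(1)] by blast
  have lG: "l \<in> carrier G" using l(1) Lc by blast
  have near: "mdist (cspace S U) (cproj S U l) (f U) \<le> C'" if U: "U \<in> {V, W, W'}" for U
  proof -
    have Ud: "U \<in> domains S" using U dom by auto
    have "f U \<in> mspace (cspace S U)" using Ud gG by (auto simp: f_def cproj_in)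
    then have "mdist (cspace S U) (cproj S U l) (f U)
        \<le> cdist S U l x + mdist (cspace S U) (cproj S U x) (f U)"
      unfolding cdist_def using Ud lG x(1) by (intro mdist_triangle cproj_in)
    then show ?thesis using l(2)[OF Ud] x(2)[OF U] by (simp add: csetdist_def C'_def)
  qed
  have V_l: "cdist S V l g \<le> C'" using near[of V] by (simp add: f_def cdist_def)
  have W_l: "cdist S W \<one> l \<le> C'" "cdist S W' \<one> l \<le> C'"
    using near[of W] near[of W'] neq by (simp_all add: f_def cdist_def mdist_commute)
  define l' where "l' = inv r \<otimes> l \<otimes> r"
  define l'' where "l'' = inv r \<otimes> l' \<otimes> r"
  have L: "l' \<in> L" "l'' \<in> L" using l(1) conj by (simp_all add: l'_def l''_def)
  then have car: "l' \<in> carrier G" "l'' \<in> carrier G" using Lc by auto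
  have l': "cdist S V \<one> l' \<le> C' + c"
    using cdist_conjugate[OF r Vd lG] W_l(1) by (simp add: W_def l'_def c_def)
  have "cdist S W \<one> l' \<le> C' + c"
    using cdist_conjugate[OF r dom(2) lG] W_l(2) by (simp add: W'_def l'_def c_def)
  then have l'': "cdist S V \<one> l'' \<le> C' + 2 * c"
    using cdist_conjugate[OF r Vd car(1)] by (simp add: W_def l''_def c_def)
  have "l \<otimes> (l' \<otimes> l'') = \<one>" using norm[OF l(1)] lG car by (simp add: l'_def[symmetric] l''_def[symmetric] m_assoc)
  then have "cdist S V \<one> l = cdist S V (l' \<otimes> l'') \<one>"
    using cdist_stabilizer[OF lG Vd fixed[OF l(1)], of "l' \<otimes> l''" \<one>] lG car by simp
  also have "\<dots> \<le> cdist S V \<one> l' + cdist S V l' (l' \<otimes> l'')"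
    using cdist_triangle[OF Vd one_closed car(1) m_closed[OF car]] by (simp add: cdist_commute)
  also have "cdist S V l' (l' \<otimes> l'') = cdist S V \<one> l''"
    using cdist_stabilizer[OF car(1) Vd fixed[OF L(1)], of \<one> l''] car by simp
  finally have "cdist S V \<one> l \<le> 2 * C' + 3 * c" using l' l'' by simp
  then show False
    using V_l g(2) cdist_triangle[OF Vd one_closed lG gG] by simp
qed

text \<open>The hypothesis \<open>norm\<close> says that conjugation by \<open>r\<close> acts on \<open>L\<close> as a rotation of order three does on
  a plane lattice.  The subgroup \<open>L'\<close> of the elements of \<open>L\<close> that fix a maximal unbounded domain \<open>V\<close>
  together with \<open>rV\<close> and \<open>r\<^sup>2V\<close> is coarsely dense and invariant under conjugation by \<open>r\<close>, and
  the two preceding lemmas exclude both \<open>rV = V\<close> and \<open>rV \<noteq> V\<close>.\<close>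

theorem no_abelian_subgroup_rotated_freely:
  assumes inf: "infinite (carrier G)" and L: "subgroup L G" "finite (rcosets L)"
    and comm: "\<And>x y. \<lbrakk>x \<in> L; y \<in> L\<rbrakk> \<Longrightarrow> x \<otimes> y = y \<otimes> x"
    and r: "r \<in> carrier G" "r \<otimes> r \<otimes> r = \<one>"
    and conj: "\<And>l. l \<in> L \<Longrightarrow> inv r \<otimes> l \<otimes> r \<in> L"
    and norm: "\<And>l. l \<in> L \<Longrightarrow>
      l \<otimes> (inv r \<otimes> l \<otimes> r) \<otimes> (inv r \<otimes> (inv r \<otimes> l \<otimes> r) \<otimes> r) = \<one>"
  shows False
proof -
  have dense: "coarsely_dense G A L" by (rule coarsely_dense_finite_index[OF L])
  obtain V where V: "maximal_unbounded V" using exists_maximal_unbounded[OF inf] ..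
  define W where "W = \<phi> r V"
  define W' where "W' = \<phi> r W"
  have max: "maximal_unbounded W" "maximal_unbounded W'"
    using V r(1) by (simp_all add: W_def W'_def maximal_unbounded_action)
  note dom = maximal_unboundedD(1)[OF V] maximal_unboundedD(1)[OF max(1)] maximal_unboundedD(1)[OF max(2)]
  have rW': "\<phi> r W' = V"
  proof -
    have "\<phi> r W' = \<phi> (r \<otimes> r \<otimes> r) V"
      using composition_rule[of V "r \<otimes> r" r] composition_rule[of V r r] dom(1) r(1)
      by (simp add: W_def W'_def composition_rule action_closed)
    then show ?thesis using r(2) id_eq_one dom(1) by (metis restrict_apply')
  qed
  define L' where "L' = {l \<in> L. \<forall>U\<in>{V, W, W'}. \<phi> l U = U}"
  have dense': "coarsely_dense G A L'"
    unfolding L'_def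
    by (rule coarsely_dense_stabilizer[OF L(1) comm dense])
      (use V max dom finite_abelian_orbit[OF L(1) comm dense] in auto)
  have fixed: "\<phi> l V = V" "\<phi> l W = W" "\<phi> l W' = W'" if "l \<in> L'" for l using that by (auto simp: L'_def)
  have Lc: "L \<subseteq> carrier G" using L(1) by (rule subgroup.subset)
  have conj': "inv r \<otimes> l \<otimes> r \<in> L'" if l: "l \<in> L'" for l
  proof -
    have lL: "l \<in> L" "l \<in> carrier G" using l Lc by (auto simp: L'_def)
    have "\<phi> (inv r \<otimes> l \<otimes> r) U = U" if "U \<in> {V, W, W'}" for U
    proof -
      have U: "U \<in> domains S" "\<phi> r U \<in> {V, W, W'}" using that dom rW' by (auto simp: W_def W'_def)
      then have "\<phi> (inv r \<otimes> l \<otimes> r) U = \<phi> (inv r) (\<phi> l (\<phi> r U))"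
        using lL r(1) by (simp add: composition_rule action_closed)
      also have "\<phi> l (\<phi> r U) = \<phi> r U" using fixed[OF l] U(2) by auto
      finally show ?thesis using r(1) U(1) by simp
    qed
    then show ?thesis using conj[OF lL(1)] by (simp add: L'_def)
  qed
  have L'L: "l \<in> L" if "l \<in> L'" for l using that by (simp add: L'_def)
  have "W \<noteq> V"
    using conjugation_moves_unbounded_domain[OF maximal_unboundedD(2)[OF V] r(1) dense' comm fixed(1)
        conj' norm] L'L by (simp add: W_def)
  moreover have "W' \<noteq> W" using \<open>W \<noteq> V\<close> dom r(1) unfolding W_def W'_def by (metis action_inv(1))
  moreover have "V \<noteq> W'" using \<open>W' \<noteq> W\<close> dom r(1) rW' by (metis W'_def action_inv(1))
  ultimately have "pairwise (orth S) {V, W, W'}"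
    using maximal_unbounded_orthogonal[OF _ _ _ dense'] V max fixed
    by (auto simp: pairwise_def)
  then show False
    using conjugation_orbit_not_orthogonal[OF maximal_unboundedD(2)[OF V] r(1) dense' fixed(1) conj' norm]
      \<open>W \<noteq> V\<close> \<open>V \<noteq> W'\<close> L'L by (auto simp: W_def W'_def)
qed

end


section \<open>Spaces that coarsely are a plane\<close>

lemma geodesic_metric_interval:
  fixes I :: "real set"
  assumes I: "is_interval I"
  shows "geodesic_metric (submetric euclidean_metric I)"
proof -
  have "\<exists>P. geodesic_segment (submetric euclidean_metric I) x y P" if xy: "x \<in> I" "y \<in> I" for x y
  proof -
    define e where "e = (if x \<le> y then 1 else - 1 :: real)"
    have e: "\<bar>e\<bar> = 1" "e * \<bar>x - y\<bar> = y - x" by (auto simp: e_def)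
    have in_I: "x + e * t \<in> I" if t: "t \<in> {0..\<bar>x - y\<bar>}" for t
    proof (cases "x \<le> y")
      case True
      then show ?thesis using t by (intro mem_is_interval_1_I[OF I xy]) (auto simp: e_def)
    next
      case False
      then show ?thesis using t by (intro mem_is_interval_1_I[OF I xy(2,1)]) (auto simp: e_def)
    qed
    have "\<bar>(x + e * s) - (x + e * t)\<bar> = \<bar>s - t\<bar>" for s t
    proof -
      have "(x + e * s) - (x + e * t) = e * (s - t)" by (simp add: algebra_simps)
      then show ?thesis using e(1) by (simp add: abs_mult)
    qed
    then have "geodesic_path (submetric euclidean_metric I) x y (\<lambda>t. x + e * t)"
      unfolding geodesic_path_def mdist_submetric mdist_euclidean_metric dist_real_def
      using in_I e(2) by (simp add: image_subset_iff)
    then show ?thesis using xy unfolding geodesic_segment_def by auto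
  qed
  then show ?thesis by (simp add: geodesic_metric_def)
qed

text \<open>Triangles in the line are degenerate: each side is covered by the two others.\<close>

lemma hyperbolic_metric_interval:
  fixes I :: "real set"
  assumes \<delta>: "0 \<le> \<delta>"
  shows "hyperbolic_metric \<delta> (submetric euclidean_metric I)"
proof -
  let ?m = "submetric euclidean_metric I"
  have between: "\<bar>p - x\<bar> + \<bar>y - p\<bar> = \<bar>y - x\<bar>" if "geodesic_segment ?m x y P" "p \<in> P" for x y p P
    using geodesic_segment_between(2)[OF that] by (simp add: dist_real_def abs_minus_commute)
  have onto: "q \<in> P" if P: "geodesic_segment ?m x y P" and q: "\<bar>q - x\<bar> + \<bar>y - q\<bar> = \<bar>y - x\<bar>" for x y q P
  proof -
    obtain \<gamma> where \<gamma>: "geodesic_path ?m x y \<gamma>" "P = \<gamma> ` {0..\<bar>y - x\<bar>}"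
      using P by (auto simp: geodesic_segment_def dist_real_def abs_minus_commute[of x y])
    define t where "t = \<bar>q - x\<bar>"
    have t: "t \<in> {0..\<bar>y - x\<bar>}" "0 \<in> {0..\<bar>y - x\<bar>}" "\<bar>y - x\<bar> \<in> {0..\<bar>y - x\<bar>}"
      using q by (auto simp: t_def)
    have ends: "\<gamma> 0 = x" "\<gamma> \<bar>y - x\<bar> = y"
      and iso: "\<forall>s\<in>{0..\<bar>y - x\<bar>}. \<forall>t\<in>{0..\<bar>y - x\<bar>}. \<bar>\<gamma> s - \<gamma> t\<bar> = \<bar>s - t\<bar>"
      using \<gamma>(1) unfolding geodesic_path_def mdist_submetric mdist_euclidean_metric dist_real_def
      by (auto simp only: abs_minus_commute[of x y])
    have "\<bar>\<gamma> t - x\<bar> = t" "\<bar>y - \<gamma> t\<bar> = \<bar>y - x\<bar> - t"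
      using bspec[OF bspec[OF iso t(1)] t(2)] bspec[OF bspec[OF iso t(3)] t(1)] ends t by auto
    then have "\<bar>\<gamma> t - x\<bar> = \<bar>q - x\<bar>" "\<bar>y - \<gamma> t\<bar> = \<bar>y - q\<bar>" "\<bar>q - x\<bar> + \<bar>y - q\<bar> = \<bar>y - x\<bar>"
      using q by (auto simp: t_def)
    then have "\<gamma> t = q" by linarith
    then show ?thesis using \<gamma>(2) t(1) by blast
  qed
  have "\<exists>q\<in>Q \<union> R. mdist ?m p q \<le> \<delta>"
    if PQR: "geodesic_segment ?m x y P" "geodesic_segment ?m y z Q" "geodesic_segment ?m z x R" and p: "p \<in> P"
    for x y z P Q R p
  proof -
    have "\<bar>p - y\<bar> + \<bar>z - p\<bar> = \<bar>z - y\<bar> \<or> \<bar>p - z\<bar> + \<bar>x - p\<bar> = \<bar>x - z\<bar>"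
      using between[OF PQR(1) p] by linarith
    then have "p \<in> Q \<union> R" using onto[OF PQR(2)] onto[OF PQR(3)] by blast
    then show ?thesis using \<delta> by (intro bexI[of _ p]) auto
  qed
  then show ?thesis unfolding hyperbolic_metric_def by blast
qed

text \<open>A shortest word for \<open>x\<inverse>y\<close> spells a path from \<open>x\<close> to \<open>y\<close> on which integral parameters are distances;
  rounding real parameters costs at most 1.\<close>

lemma (in group) quasigeodesic_word_metric:
  assumes gen: "finite_generating_set G A"
  shows "quasigeodesic_metric (word_metric G A)"
proof -
  have A: "A \<subseteq> carrier G" using gen by (simp add: finite_generating_set_def)
  interpret W: Metric_space "carrier G" "word_dist G A" by (rule Metric_space_word_dist[OF gen])
  have path: "\<exists>\<gamma>. \<gamma> ` {0..real n} \<subseteq> carrier G \<and> \<gamma> 0 = x \<and> \<gamma> (real n) = y \<and>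
      (\<forall>s\<in>{0..real n}. \<forall>t\<in>{0..real n}. \<bar>s - t\<bar> - 1 \<le> word_dist G A (\<gamma> s) (\<gamma> t) \<and>
         word_dist G A (\<gamma> s) (\<gamma> t) \<le> \<bar>s - t\<bar> + 1)"
    if xy: "x \<in> carrier G" "y \<in> carrier G" and n: "n = word_length G A (inv x \<otimes> y)" for x y n
  proof -
    obtain w where w: "length w = n" "set w \<subseteq> A \<union> m_inv G ` A" "foldr (mult G) w \<one> = inv x \<otimes> y"
      using word_length_witness[OF gen, of "inv x \<otimes> y"] xy n by auto
    define p where "p i = x \<otimes> foldr (mult G) (take i w) \<one>" for i
    have sub: "set (take i w) \<subseteq> A \<union> m_inv G ` A" "set (drop i (take j w)) \<subseteq> A \<union> m_inv G ` A" for i j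
      using w(2) by (meson set_take_subset set_drop_subset order_trans)+
    have pG: "p i \<in> carrier G" for i using word_closed[OF A sub(1)] xy by (simp add: p_def)
    have p0: "p 0 = x" and pn: "p n = y" using xy w by (simp_all add: p_def m_assoc[symmetric])
    have upper: "word_dist G A (p i) (p j) \<le> real (j - i)" if "i \<le> j" for i j
    proof -
      let ?v = "drop i (take j w)"
      have "take j w = take i w @ ?v" using that by (metis append_take_drop_id min.absorb1 take_take)
      then have "foldr (mult G) (take j w) \<one> = foldr (mult G) (take i w) \<one> \<otimes> foldr (mult G) ?v \<one>"
        using word_append[OF A sub(1)[of i] sub(2)[of i j]] by metis
      then have "p j = p i \<otimes> foldr (mult G) ?v \<one>"
        using word_closed[OF A sub(1)] word_closed[OF A sub(2)] xy by (simp add: p_def m_assoc)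
      then have "inv (p i) \<otimes> p j = foldr (mult G) ?v \<one>"
        using pG word_closed[OF A sub(2)] by (simp add: m_assoc[symmetric])
      then have "word_length G A (inv (p i) \<otimes> p j) \<le> length ?v"
        using sub(2) by (intro word_length_le) auto
      also have "length ?v \<le> j - i" by simp
      finally show ?thesis using pG by (simp add: word_dist_def)
    qed
    have lower: "word_dist G A (p i) (p j) \<ge> real j - real i" if "i \<le> j" "j \<le> n" for i j
    proof -
      have "word_dist G A x y = n" using xy by (simp add: word_dist_def n)
      moreover have "word_dist G A x y \<le> word_dist G A (p 0) (p i) + word_dist G A (p i) (p j) + word_dist G A (p j) (p n)"
        using W.triangle[of x "p i" y] W.triangle[of "p i" "p j" y] pG xy p0 pn by simp
      moreover have "word_dist G A (p 0) (p i) \<le> i" "word_dist G A (p j) (p n) \<le> real n - real j"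
        using upper[of 0 i] upper[of j n] that by (simp_all add: of_nat_diff)
      ultimately show ?thesis by simp
    qed
    have dist: "word_dist G A (p i) (p j) = \<bar>real i - real j\<bar>" if "i \<le> n" "j \<le> n" for i j
    proof (cases "i \<le> j")
      case True
      then show ?thesis using upper[of i j] lower[of i j] that by (simp add: of_nat_diff)
    next
      case False
      then show ?thesis using upper[of j i] lower[of j i] that W.commute[of "p i" "p j"] by (simp add: of_nat_diff)
    qed
    define \<gamma> where "\<gamma> t = p (nat \<lfloor>t\<rfloor>)" for t :: real
    have "\<bar>s - t\<bar> - 1 \<le> word_dist G A (\<gamma> s) (\<gamma> t) \<and> word_dist G A (\<gamma> s) (\<gamma> t) \<le> \<bar>s - t\<bar> + 1"
      if "s \<in> {0..real n}" "t \<in> {0..real n}" for s t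
    proof -
      have "nat \<lfloor>s\<rfloor> \<le> n" "nat \<lfloor>t\<rfloor> \<le> n" using that by (auto simp: nat_le_iff floor_le_iff)
      then have "word_dist G A (\<gamma> s) (\<gamma> t) = \<bar>real (nat \<lfloor>s\<rfloor>) - real (nat \<lfloor>t\<rfloor>)\<bar>" by (simp add: dist \<gamma>_def)
      also have "\<dots> = \<bar>real_of_int \<lfloor>s\<rfloor> - real_of_int \<lfloor>t\<rfloor>\<bar>" using that by simp
      finally show ?thesis by linarith
    qed
    moreover have "\<gamma> 0 = x" "\<gamma> (real n) = y" by (simp_all add: \<gamma>_def p0 pn)
    moreover have "\<gamma> ` {0..real n} \<subseteq> carrier G" using pG by (auto simp: \<gamma>_def)
    ultimately show ?thesis by blast
  qed
  have "\<forall>x\<in>carrier G. \<forall>y\<in>carrier G. \<exists>l\<ge>0. \<exists>\<gamma>. \<gamma> ` {0..l} \<subseteq> carrier G \<and> \<gamma> 0 = x \<and> \<gamma> l = y \<and>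
      (\<forall>s\<in>{0..l}. \<forall>t\<in>{0..l}. \<bar>s - t\<bar> / 1 - 1 \<le> word_dist G A (\<gamma> s) (\<gamma> t) \<and>
         word_dist G A (\<gamma> s) (\<gamma> t) \<le> 1 * \<bar>s - t\<bar> + 1)"
  proof (intro ballI)
    fix x y assume xy: "x \<in> carrier G" "y \<in> carrier G"
    show "\<exists>l\<ge>0. \<exists>\<gamma>. \<gamma> ` {0..l} \<subseteq> carrier G \<and> \<gamma> 0 = x \<and> \<gamma> l = y \<and>
        (\<forall>s\<in>{0..l}. \<forall>t\<in>{0..l}. \<bar>s - t\<bar> / 1 - 1 \<le> word_dist G A (\<gamma> s) (\<gamma> t) \<and>
           word_dist G A (\<gamma> s) (\<gamma> t) \<le> 1 * \<bar>s - t\<bar> + 1)"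
      using path[OF xy HOL.refl]
      by (intro exI[of _ "real (word_length G A (inv x \<otimes> y))"]) simp
  qed
  then show ?thesis
    unfolding quasigeodesic_metric_def word_metric_simps[OF gen]
    by (rule exI[of _ 1, OF conjI[OF order_refl]])
qed


text \<open>The hierarchy of a product of two lines: the lines \<open>1\<close> and \<open>2\<close> are orthogonal and nested in \<open>0\<close>,
  whose hyperbolic space is a point.  The maps \<open>rho_map\<close> may have empty values because \<open>rho\<close>
  fills the point: where the axioms leave a choice between being near \<open>rho\<close> and a bound on \<open>rho_map\<close>,
  the first alternative always holds.\<close>

definition plane_hhs :: "real \<Rightarrow> ('x \<Rightarrow> real) \<Rightarrow> ('x \<Rightarrow> real) \<Rightarrow> ('x, nat, real) hhs" where
  "plane_hhs E f g =
     \<lparr>domains = {0, 1, 2}, hconst = E,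
      cspace = (\<lambda>U. submetric euclidean_metric (if U = 0 then {0} else UNIV)),
      cproj = (\<lambda>U x. if U = 1 then f x else if U = 2 then g x else 0),
      nested = (\<lambda>U V. U = V \<or> V = 0),
      orth = (\<lambda>U V. U = 1 \<and> V = 2 \<or> U = 2 \<and> V = 1),
      rho = (\<lambda>_ _. {0}), rho_map = (\<lambda>_ _ _. {})\<rparr>"

lemma plane_hhs_simps [simp]:
  "domains (plane_hhs E f g) = {0, 1, 2}" "hconst (plane_hhs E f g) = E"
  "cspace (plane_hhs E f g) U = submetric euclidean_metric (if U = 0 then {0} else UNIV)"
  "cproj (plane_hhs E f g) U x = (if U = 1 then f x else if U = 2 then g x else 0)"
  "nested (plane_hhs E f g) U V \<longleftrightarrow> U = V \<or> V = 0"
  "orth (plane_hhs E f g) U V \<longleftrightarrow> U = 1 \<and> V = 2 \<or> U = 2 \<and> V = 1"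
  "rho (plane_hhs E f g) U V = {0}" "rho_map (plane_hhs E f g) U V p = {}"
  by (simp_all add: plane_hhs_def)

lemma plane_hhs_relations:
  "properly_nested (plane_hhs E f g) U V \<longleftrightarrow> U \<noteq> 0 \<and> V = 0"
  "U \<in> {0, 1, 2} \<Longrightarrow> V \<in> {0, 1, 2} \<Longrightarrow> \<not> transverse (plane_hhs E f g) U V"
  "cdist (plane_hhs E f g) U x y = (if U = 1 then \<bar>f x - f y\<bar> else if U = 2 then \<bar>g x - g y\<bar> else 0)"
  "csetdist (plane_hhs E f g) 0 x {0} = 0"
  by (auto simp: properly_nested_def transverse_def cdist_def csetdist_def dist_real_def)

text \<open>Joint coarse surjectivity of the coordinates is partial realisation for the two orthogonal lines,
  and properness is uniqueness.  The constant is at least 2 because the two lines are needed to cover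
  the domains below the point in the large links axiom.\<close>

theorem hhs_structure_plane:
  assumes X: "quasigeodesic_metric X" and E: "E \<ge> 2"
    and lip: "\<And>x y. \<lbrakk>x \<in> mspace X; y \<in> mspace X\<rbrakk> \<Longrightarrow> \<bar>f x - f y\<bar> \<le> E * mdist X x y + E"
      "\<And>x y. \<lbrakk>x \<in> mspace X; y \<in> mspace X\<rbrakk> \<Longrightarrow> \<bar>g x - g y\<bar> \<le> E * mdist X x y + E"
    and onto: "\<And>p q. \<exists>x\<in>mspace X. \<bar>f x - p\<bar> \<le> E \<and> \<bar>g x - q\<bar> \<le> E"
    and proper: "\<And>\<kappa>. \<exists>\<theta>. \<forall>x\<in>mspace X. \<forall>y\<in>mspace X. mdist X x y > \<theta> \<longrightarrow>
        \<bar>f x - f y\<bar> > \<kappa> \<or> \<bar>g x - g y\<bar> > \<kappa>"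
  shows "hhs_structure X (plane_hhs E f g)"
proof -
  let ?S = "plane_hhs E f g"
  note [simp] = plane_hhs_relations
  have dom: "domains_in ?S U = (if U = 0 then {0, 1, 2} else {U} \<inter> {1, 2})" for U
    by (auto simp: domains_in_def)
  have coord: "\<exists>x\<in>mspace X. \<bar>f x - p\<bar> \<le> E" "\<exists>x\<in>mspace X. \<bar>g x - p\<bar> \<le> E" for p using onto by blast+
  show ?thesis
  proof
    show "quasigeodesic_metric X" by fact
    show "1 \<le> hconst ?S" using E by simp
    show "geodesic_metric (cspace ?S U)" for U
      using geodesic_metric_interval[OF is_interval_cc[of 0 0]] geodesic_metric_interval[OF is_interval_univ]
      by simp
    show "hyperbolic_metric (hconst ?S) (cspace ?S U)" for U
      using hyperbolic_metric_interval[of E "if U = 0 then {0} else UNIV"] E by (auto split: if_splits)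
    show "cproj ?S U x \<in> mspace (cspace ?S U)" if "U \<in> domains ?S" for U x using that by auto
    show "cdist ?S U x y \<le> hconst ?S * mdist X x y + hconst ?S"
      if "U \<in> domains ?S" "x \<in> mspace X" "y \<in> mspace X" for U x y
      using that lip E by auto
    show "msetdist (cspace ?S U) {p} (cproj ?S U ` mspace X) \<le> hconst ?S"
      if "U \<in> domains ?S" "p \<in> mspace (cspace ?S U)" for U p
    proof -
      have "\<exists>x\<in>mspace X. mdist (cspace ?S U) p (cproj ?S U x) \<le> E"
        using that coord[of p] onto E by (auto simp: dist_real_def abs_minus_commute)
      then show ?thesis by (auto simp: msetdist_def intro: INF_lower2)
    qed
    show "domains ?S \<noteq> {} \<Longrightarrow> \<exists>!M. M \<in> domains ?S \<and> (\<forall>V\<in>domains ?S. \<not> properly_nested ?S M V)"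
      by auto
    show "\<exists>W\<in>domains_in ?S T - {T}. \<forall>V\<in>domains_in ?S T. orth ?S V U \<longrightarrow> nested ?S V W"
      if "T \<in> domains ?S" "U \<in> domains_in ?S T" "{V \<in> domains_in ?S T. orth ?S V U} \<noteq> {}" for T U
      using that by (auto simp: dom split: if_splits)
    show "\<exists>n. \<forall>C\<subseteq>domains ?S. (\<forall>U\<in>C. \<forall>V\<in>C. nested ?S U V \<or> nested ?S V U) \<longrightarrow> finite C \<and> card C \<le> n"
      by (intro exI[of _ "card {0, 1, 2::nat}"]) (auto intro: finite_subset card_mono simp del: card.insert)
    show "\<exists>\<T>\<subseteq>domains_in ?S W - {W}. finite \<T> \<and> int (card \<T>) \<le> \<lfloor>N\<rfloor> \<and>
        (\<forall>V\<in>domains_in ?S W - {W}. (\<exists>T\<in>\<T>. nested ?S V T) \<or> cdist ?S V x x' < hconst ?S) \<and>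
        (\<forall>T\<in>\<T>. csetdist ?S W x (rho ?S T W) \<le> ereal N)"
      if W: "W \<in> domains ?S" and N: "N = hconst ?S * cdist ?S W x x' + hconst ?S" for W x x' N
    proof -
      have N2: "N \<ge> 2" using E N by (auto intro: add_increasing)
      then have fl: "2 \<le> \<lfloor>N\<rfloor>" by (simp add: le_floor_iff)
      show ?thesis
        using W fl N2 by (intro exI[of _ "domains_in ?S W - {W}"]) (auto simp: dom)
    qed
    show "mdiam (cspace ?S V) (\<Union> (rho_map ?S W V ` \<gamma>)) \<le> hconst ?S \<or>
        (\<exists>r\<in>\<gamma>. msetdist (cspace ?S W) {r} (rho ?S V W) \<le> hconst ?S)"
      if "properly_nested ?S V W" "geodesic_segment (cspace ?S W) p q \<gamma>" for V W p q \<gamma>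
    proof -
      have "p \<in> \<gamma>" "p \<in> mspace (cspace ?S W)"
        using geodesic_segment_ends[OF that(2)] that(2) by (auto simp: geodesic_segment_def)
      then show ?thesis using that(1) E by (intro disjI2 bexI[of _ p]) auto
    qed
    show "msetdist (cspace ?S W) (rho ?S V W) \<gamma> \<le> hconst ?S"
      if "properly_nested ?S V W" "geodesic_segment (cspace ?S W) (cproj ?S W y) (cproj ?S W z) \<gamma>" for V W y z \<gamma>
    proof -
      have "0 \<in> \<gamma>" using geodesic_segment_ends(1)[OF that(2)] that(1) by simp
      then show ?thesis using E by (auto simp: msetdist_def intro: INF_lower2)
    qed
    show "\<exists>x\<in>mspace X. \<forall>W\<in>\<W>. csetdist ?S W x {h W} \<le> hconst ?S \<and>
        (\<forall>V\<in>domains ?S. properly_nested ?S W V \<or> transverse ?S W V \<longrightarrow>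
          csetdist ?S V x (rho ?S W V) \<le> hconst ?S)"
      if "\<W> \<subseteq> domains ?S" "\<And>W. W \<in> \<W> \<Longrightarrow> h W \<in> mspace (cspace ?S W)" for \<W> h
    proof -
      obtain x where x: "x \<in> mspace X" "\<bar>f x - h 1\<bar> \<le> E" "\<bar>g x - h 2\<bar> \<le> E" using onto by blast
      have "h 0 = 0" if "0 \<in> \<W>" using that \<open>\<And>W. W \<in> \<W> \<Longrightarrow> h W \<in> mspace (cspace ?S W)\<close>[of 0] by simp
      then show ?thesis
        using x E that(1) by (intro bexI[OF _ x(1)]) (auto simp: csetdist_def dist_real_def)
    qed
    show "\<exists>\<theta>. \<forall>x\<in>mspace X. \<forall>y\<in>mspace X. \<theta> < mdist X x y \<longrightarrow> (\<exists>U\<in>domains ?S. \<kappa> < cdist ?S U x y)" for \<kappa>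
    proof -
      obtain \<theta> where "\<forall>x\<in>mspace X. \<forall>y\<in>mspace X. mdist X x y > \<theta> \<longrightarrow>
        \<bar>f x - f y\<bar> > \<kappa> \<or> \<bar>g x - g y\<bar> > \<kappa>" using proper[of \<kappa>] by blast
      then show ?thesis by (intro exI[of _ \<theta>]) auto
    qed
    show "rho ?S V W \<noteq> {} \<and> rho ?S V W \<subseteq> mspace (cspace ?S W) \<and> mdiam (cspace ?S W) (rho ?S V W) \<le> hconst ?S"
      if "properly_nested ?S V W" for V W
      using that E by simp
    show "rho ?S V W \<noteq> {} \<and> rho ?S V W \<subseteq> mspace (cspace ?S W) \<and> mdiam (cspace ?S W) (rho ?S V W) \<le> hconst ?S"
      if "V \<in> domains ?S" "W \<in> domains ?S" "transverse ?S V W" for V W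
      using plane_hhs_relations(2) that by (metis plane_hhs_simps(1))
    show "min (csetdist ?S W x (rho ?S V W)) (csetdist ?S V x (rho ?S W V)) \<le> hconst ?S"
      if "V \<in> domains ?S" "W \<in> domains ?S" "transverse ?S V W" for V W x
      using plane_hhs_relations(2) that by (metis plane_hhs_simps(1))
    show "min (csetdist ?S W x (rho ?S V W))
        (mdiam (cspace ?S V) ({cproj ?S V x} \<union> rho_map ?S W V (cproj ?S W x))) \<le> hconst ?S"
      if "properly_nested ?S V W" for V W x
      using that E by (simp add: min_le_iff_disj)
    show "msetdist (cspace ?S W) (rho ?S U W) (rho ?S V W) \<le> hconst ?S" for U V W
      using E by simp
  qed (unfold plane_hhs_simps(5,6,8), auto simp del: plane_hhs_simps)
qed


text \<open>In the basis used below for the lattice this is a norm whose unit ball is a regular hexagon; hence it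
  is invariant under the rotations and reflections of the lattice.\<close>

definition hex_norm :: "int \<times> int \<Rightarrow> int" where
  "hex_norm v = max \<bar>fst v\<bar> (max \<bar>snd v\<bar> \<bar>fst v - snd v\<bar>)"

lemma hex_norm_minus [simp]: "hex_norm (- v) = hex_norm v"
  by (simp add: hex_norm_def abs_minus_commute)

lemma hex_norm_triangle: "hex_norm (v + w) \<le> hex_norm v + hex_norm w"
proof -
  have "\<bar>fst v + fst w\<bar> \<le> \<bar>fst v\<bar> + \<bar>fst w\<bar>" "\<bar>snd v + snd w\<bar> \<le> \<bar>snd v\<bar> + \<bar>snd w\<bar>"
    "\<bar>(fst v + fst w) - (snd v + snd w)\<bar> \<le> \<bar>fst v - snd v\<bar> + \<bar>fst w - snd w\<bar>"
    using abs_triangle_ineq[of "fst v - snd v" "fst w - snd w"]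
    by (simp_all add: algebra_simps)
  moreover have "\<bar>fst x\<bar> \<le> hex_norm x" "\<bar>snd x\<bar> \<le> hex_norm x" "\<bar>fst x - snd x\<bar> \<le> hex_norm x" for x
    by (simp_all add: hex_norm_def)
  from this[of v] this[of w] calculation show ?thesis
    unfolding hex_norm_def[of "v + w"] fst_add snd_add by (intro max.boundedI; linarith)
qed

lemma hex_norm_nonneg [simp]: "0 \<le> hex_norm v"
  by (auto simp: hex_norm_def)

lemma abs_coordinates_le_hex_norm: "\<bar>fst v\<bar> \<le> hex_norm v" "\<bar>snd v\<bar> \<le> hex_norm v"
  by (auto simp: hex_norm_def)


lemma hex_norm_eq_0 [simp]: "hex_norm v = 0 \<longleftrightarrow> v = 0"
proof
  assume "hex_norm v = 0"
  then show "v = 0" using abs_coordinates_le_hex_norm[of v] by (simp add: prod_eq_iff)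
qed (simp add: hex_norm_def)

text \<open>The map \<open>F\<close> stands for an orbit map of an isometric action on the lattice.  Being subadditive, the
  displacement is at most a multiple of the word length, and it is a proper function as only finitely
  many elements have a given displacement.  Thus the coordinates of \<open>F\<close> satisfy the hypotheses of the
  previous theorem.\<close>

theorem (in group) hhs_structure_lattice_coordinates:
  fixes F :: "'a \<Rightarrow> int \<times> int"
  assumes gen: "finite_generating_set G A"
    and dist: "\<And>x y. \<lbrakk>x \<in> carrier G; y \<in> carrier G\<rbrakk> \<Longrightarrow> hex_norm (F y - F x) = hex_norm (F (inv x \<otimes> y))"
    and onto: "\<And>v. \<exists>x\<in>carrier G. F x = v"
    and finite: "\<And>k. finite {x \<in> carrier G. hex_norm (F x) \<le> k}"
  shows "\<exists>E. hhs_structure (word_metric G A)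
    (plane_hhs E (\<lambda>x. real_of_int (fst (F x))) (\<lambda>x. real_of_int (snd (F x))))"
proof -
  let ?l = "\<lambda>x. hex_norm (F x)"
  have A: "finite A" "A \<subseteq> carrier G" using gen by (auto simp: finite_generating_set_def)
  have F1: "F \<one> = 0"
  proof -
    have "hex_norm (F \<one>) = hex_norm (F \<one> - F \<one>)" using dist[of \<one> \<one>] by simp
    then have "hex_norm (F \<one>) = 0" by (simp only: diff_self hex_norm_eq_0)
    then show ?thesis by (simp only: hex_norm_eq_0)
  qed
  have inverse: "?l (inv x) = ?l x" if "x \<in> carrier G" for x
    using dist[OF that one_closed] that by (simp only: F1 diff_0 hex_norm_minus inv_closed r_one)
  have product: "?l (x \<otimes> y) \<le> ?l x + ?l y" if "x \<in> carrier G" "y \<in> carrier G" for x y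
  proof -
    have "?l (x \<otimes> y) = hex_norm (F y + - F (inv x))"
      using dist[of "inv x" y] that by (simp only: inv_closed inv_inv add_uminus_conv_diff)
    also have "\<dots> \<le> ?l y + hex_norm (- F (inv x))" by (rule hex_norm_triangle)
    also have "\<dots> = ?l x + ?l y" using inverse[OF that(1)] by (simp only: hex_norm_minus add.commute)
    finally show ?thesis .
  qed
  define M where "M = (\<Sum>x\<in>A. ?l x)"
  have M: "?l x \<le> M" if "x \<in> A \<union> m_inv G ` A" for x
  proof -
    have "?l x \<le> M" if "x \<in> A" for x unfolding M_def using A(1) that by (intro member_le_sum) auto
    then show ?thesis using that inverse A(2) by auto
  qed
  have word: "?l (foldr (mult G) w \<one>) \<le> M * int (length w)" if "set w \<subseteq> A \<union> m_inv G ` A" for w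
    using that
  proof (induction w)
    case Nil
    show ?case by (simp add: F1 hex_norm_def)
  next
    case (Cons x w)
    have "x \<in> carrier G" using Cons.prems A(2) by auto
    then have "?l (x \<otimes> foldr (mult G) w \<one>) \<le> ?l x + ?l (foldr (mult G) w \<one>)"
      using word_closed[OF A(2)] Cons.prems by (intro product) auto
    moreover have "?l x \<le> M" "?l (foldr (mult G) w \<one>) \<le> M * int (length w)"
      using M Cons by auto
    ultimately show ?case by (simp add: algebra_simps)
  qed
  have length: "?l x \<le> M * int (word_length G A x)" if "x \<in> carrier G" for x
  proof -
    obtain v where "length v = word_length G A x" "set v \<subseteq> A \<union> m_inv G ` A" "foldr (mult G) v \<one> = x"
      using word_length_witness[OF gen \<open>x \<in> carrier G\<close>] .
    then show ?thesis using word[of v] by simp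
  qed
  have M0: "M \<ge> 0" by (simp add: M_def sum_nonneg)
  define E where "E = real_of_int (M + 2)"
  have lip: "real_of_int (hex_norm (F x - F y)) \<le> E * word_dist G A x y + E"
    if xy: "x \<in> carrier G" "y \<in> carrier G" for x y
  proof -
    have "hex_norm (F x - F y) = ?l (inv x \<otimes> y)"
      using dist[OF xy] hex_norm_minus[of "F x - F y"] by simp
    also have "\<dots> \<le> M * int (word_length G A (inv x \<otimes> y))" using length xy by simp
    finally have "real_of_int (hex_norm (F x - F y)) \<le> real_of_int M * real (word_length G A (inv x \<otimes> y))"
      using of_int_le_iff[where ?'a = real, THEN iffD2] by fastforce
    also have "\<dots> \<le> E * real (word_length G A (inv x \<otimes> y))"
      by (intro mult_right_mono) (auto simp: E_def)
    finally show ?thesis using xy M0 by (simp add: word_dist_def E_def)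
  qed
  have "hhs_structure (word_metric G A)
    (plane_hhs E (\<lambda>x. real_of_int (fst (F x))) (\<lambda>x. real_of_int (snd (F x))))"
  proof (rule hhs_structure_plane, unfold word_metric_simps[OF gen])
    show "quasigeodesic_metric (word_metric G A)" by (rule quasigeodesic_word_metric[OF gen])
    show "E \<ge> 2" using M0 by (simp add: E_def)
    fix x y assume xy: "x \<in> carrier G" "y \<in> carrier G"
    have "real_of_int \<bar>fst (F x) - fst (F y)\<bar> \<le> hex_norm (F x - F y)"
      "real_of_int \<bar>snd (F x) - snd (F y)\<bar> \<le> hex_norm (F x - F y)"
      using abs_coordinates_le_hex_norm[of "F x - F y"] by (simp_all only: of_int_le_iff fst_diff snd_diff)
    then show "\<bar>real_of_int (fst (F x)) - real_of_int (fst (F y))\<bar> \<le> E * word_dist G A x y + E"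
      "\<bar>real_of_int (snd (F x)) - real_of_int (snd (F y))\<bar> \<le> E * word_dist G A x y + E"
      using lip[OF xy] by simp_all
  next
    fix p q :: real
    obtain x where x: "x \<in> carrier G" "F x = (\<lfloor>p\<rfloor>, \<lfloor>q\<rfloor>)" using onto by blast
    have "\<bar>real_of_int \<lfloor>p\<rfloor> - p\<bar> \<le> 1" "\<bar>real_of_int \<lfloor>q\<rfloor> - q\<bar> \<le> 1" by linarith+
    then show "\<exists>x\<in>carrier G. \<bar>real_of_int (fst (F x)) - p\<bar> \<le> E \<and> \<bar>real_of_int (snd (F x)) - q\<bar> \<le> E"
      using x M0 by (intro bexI[OF _ x(1)]) (auto simp: E_def)
  next
    fix \<kappa> :: real
    define B where "B = {x \<in> carrier G. ?l x \<le> \<lceil>2 * \<kappa>\<rceil>}"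
    define \<theta> where "\<theta> = real (\<Sum>x\<in>B. word_length G A x)"
    have \<theta>: "real (word_length G A x) \<le> \<theta>" if "x \<in> B" for x
      unfolding \<theta>_def of_nat_le_iff using finite that by (intro member_le_sum) (auto simp: B_def)
    have "\<bar>real_of_int (fst (F x)) - real_of_int (fst (F y))\<bar> > \<kappa> \<or>
        \<bar>real_of_int (snd (F x)) - real_of_int (snd (F y))\<bar> > \<kappa>"
      if xy: "x \<in> carrier G" "y \<in> carrier G" and far: "word_dist G A x y > \<theta>" for x y
    proof (rule ccontr)
      assume "\<not> ?thesis"
      then have "\<bar>real_of_int (fst (F x) - fst (F y))\<bar> \<le> \<kappa>" "\<bar>real_of_int (snd (F x) - snd (F y))\<bar> \<le> \<kappa>"
        by simp_all
      then have "real_of_int \<bar>fst (F x) - fst (F y)\<bar> + real_of_int \<bar>snd (F x) - snd (F y)\<bar> \<le> 2 * \<kappa>"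
        by simp
      moreover have "hex_norm (F x - F y) \<le> \<bar>fst (F x) - fst (F y)\<bar> + \<bar>snd (F x) - snd (F y)\<bar>"
        using abs_triangle_ineq4[of "fst (F x) - fst (F y)" "snd (F x) - snd (F y)"]
        by (simp add: hex_norm_def)
      ultimately have "hex_norm (F x - F y) \<le> \<lceil>2 * \<kappa>\<rceil>" by linarith
      then have "inv x \<otimes> y \<in> B"
        using dist[OF xy] hex_norm_minus[of "F x - F y"] xy by (simp add: B_def)
      then show False using \<theta> far xy by (fastforce simp: word_dist_def)
    qed
    then show "\<exists>\<theta>. \<forall>x\<in>carrier G. \<forall>y\<in>carrier G. \<theta> < word_dist G A x y \<longrightarrow>
        \<kappa> < \<bar>real_of_int (fst (F x)) - real_of_int (fst (F y))\<bar> \<or>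
        \<kappa> < \<bar>real_of_int (snd (F x)) - real_of_int (snd (F y))\<bar>"
      by blast
  qed
  then show ?thesis ..
qed

text \<open>Translations preserve the two coordinate directions, so the group fixes all domains and translates
  the lines.  A group that also rotates the lattice does not act in this way.\<close>

theorem (in group) hierarchically_hyperbolic_group_lattice:
  fixes F :: "'a \<Rightarrow> int \<times> int"
  assumes gen: "finite_generating_set G A"
    and hom: "\<And>x y. \<lbrakk>x \<in> carrier G; y \<in> carrier G\<rbrakk> \<Longrightarrow> F (x \<otimes> y) = F x + F y"
    and bij: "bij_betw F (carrier G) UNIV"
  shows "hierarchically_hyperbolic_group TYPE(nat) TYPE(real) G"
proof -
  let ?f = "\<lambda>x. real_of_int (fst (F x))" and ?g = "\<lambda>x. real_of_int (snd (F x))"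
  have "hex_norm (F y - F x) = hex_norm (F (inv x \<otimes> y))" if "x \<in> carrier G" "y \<in> carrier G" for x y
  proof -
    have "F y = F x + F (inv x \<otimes> y)"
      using hom[of x "inv x \<otimes> y"] that by (simp add: m_assoc[symmetric])
    then show ?thesis by simp
  qed
  moreover have "\<exists>x\<in>carrier G. F x = v" for v using bij unfolding bij_betw_def by (metis UNIV_I imageE)
  moreover have "finite {x \<in> carrier G. hex_norm (F x) \<le> k}" for k
  proof (rule finite_imageD)
    show "inj_on F {x \<in> carrier G. hex_norm (F x) \<le> k}"
      using bij by (auto simp: bij_betw_def intro: inj_on_subset)
    have "F ` {x \<in> carrier G. hex_norm (F x) \<le> k} \<subseteq> {-k..k} \<times> {-k..k}"
    proof (intro image_subsetI)
      fix x assume "x \<in> {x \<in> carrier G. hex_norm (F x) \<le> k}"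
      then show "F x \<in> {-k..k} \<times> {-k..k}"
        using abs_coordinates_le_hex_norm[of "F x"] by (cases "F x") auto
    qed
    then show "finite (F ` {x \<in> carrier G. hex_norm (F x) \<le> k})" by (rule finite_subset) simp
  qed
  ultimately obtain E where E: "hhs_structure (word_metric G A) (plane_hhs E ?f ?g)"
    using hhs_structure_lattice_coordinates[OF gen, of F] by blast
  let ?S = "plane_hhs E ?f ?g"
  let ?\<phi> = "\<lambda>g :: 'a. \<lambda>U \<in> {0, 1, 2 :: nat}. U"
  let ?\<psi> = "\<lambda>g U p. if U = (1 :: nat) then p + ?f g else if U = 2 then p + ?g g else p"
  have act: "?\<phi> g U = U" if "U \<in> domains ?S" for g U using that by auto
  have "hhg_structure G A ?S ?\<phi> ?\<psi>"
  proof (intro hhg_structure.intro E hhg_structure_axioms.intro)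
    show "group G" ..
    interpret B: group "BijGroup (domains ?S)" by (rule group_BijGroup)
    have "?\<phi> = (\<lambda>_. \<one>\<^bsub>BijGroup (domains ?S)\<^esub>)" by (simp add: BijGroup_def)
    moreover have "(\<lambda>_. \<one>\<^bsub>BijGroup (domains ?S)\<^esub>) \<in> hom G (BijGroup (domains ?S))"
      by (rule homI) (simp_all del: plane_hhs_simps)
    ultimately show "group_action G (domains ?S) ?\<phi>"
      unfolding group_action_def group_hom_def group_hom_axioms_def
      using B.is_group group_axioms by simp
    show "finite (orbits G (domains ?S) ?\<phi>)"
      by (simp add: orbits_def)
    show "finite_generating_set G A" by fact
    show "bij_betw (?\<psi> g U) (mspace (cspace ?S U)) (mspace (cspace ?S (?\<phi> g U)))"
      if "U \<in> domains ?S" for g U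
    proof -
      have "bij_betw (\<lambda>p. p + c) UNIV UNIV" for c :: real
        by (rule bij_betw_byWitness[of _ "\<lambda>p. p - c"]) auto
      then show ?thesis unfolding act[OF that] using that by (auto simp: bij_betw_def inj_on_def)
    qed
    show "?\<psi> (g \<otimes> h) U p = ?\<psi> g (?\<phi> h U) (?\<psi> h U p)"
      if "g \<in> carrier G" "h \<in> carrier G" "U \<in> domains ?S" for g h U p
      using that by (auto simp: hom)
    show "?\<psi> g U (cproj ?S U x) = cproj ?S (?\<phi> g U) (g \<otimes> x)"
      if "g \<in> carrier G" "x \<in> carrier G" "U \<in> domains ?S" for g x U
      using that by (auto simp: hom)
    show "?\<psi> g U ` rho ?S V U = rho ?S (?\<phi> g V) (?\<phi> g U)"
      if "U \<in> domains ?S" "V \<in> domains ?S" "transverse ?S U V \<or> properly_nested ?S V U" for g U V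
      using that by (auto simp: plane_hhs_relations)
    show "mdist (cspace ?S (?\<phi> g U)) (?\<psi> g U p) (?\<psi> g U q) = mdist (cspace ?S U) p q"
      for g U p q
      by (simp add: dist_real_def)
  qed (simp_all only: act)
  then show ?thesis unfolding hierarchically_hyperbolic_group_def by blast
qed


section \<open>Normal forms in the triangle group\<close>

lemma (in group) int_pow_commutes:
  assumes eq: "x \<otimes> y = y \<otimes> x" and car: "x \<in> carrier G" "y \<in> carrier G"
  shows "x [^] (i::int) \<otimes> y [^] (j::int) = y [^] j \<otimes> x [^] i"
proof -
  have one: "x [^] (i::int) \<otimes> y = y \<otimes> x [^] i"
    if eq: "x \<otimes> y = y \<otimes> x" and car: "x \<in> carrier G" "y \<in> carrier G" for x y i
  proof -
    have nat: "x [^] n \<otimes> y = y \<otimes> x [^] n" for n :: nat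
      by (rule group_commutes_pow[OF eq car])
    show ?thesis
    proof (cases i rule: int_cases2)
      case (nonneg n)
      then show ?thesis using nat by (simp add: int_pow_int)
    next
      case (nonpos n)
      then have "x [^] i = inv (x [^] n)" using car by (simp add: int_pow_neg_int)
      then show ?thesis
        using nat[of n] car by (metis inv_closed inv_solve_left inv_solve_right m_assoc m_closed nat_pow_closed)
    qed
  qed
  show ?thesis
    using one[OF _ int_pow_closed[OF car(2)] car(1)] one[OF eq[symmetric] car(2,1)] one[OF eq car] car
    by (metis int_pow_closed one)
qed

lemma (in group) involutions_braid:
  assumes "x \<in> carrier G" "y \<in> carrier G" "x \<otimes> x = \<one>" "y \<otimes> y = \<one>"
    and "x \<otimes> y \<otimes> x \<otimes> y \<otimes> x \<otimes> y = \<one>"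
  shows "x \<otimes> y \<otimes> x = y \<otimes> x \<otimes> y"
proof -
  have xx: "x \<otimes> (x \<otimes> z) = z" and yy: "y \<otimes> (y \<otimes> z) = z" if "z \<in> carrier G" for z
    using that assms by (simp_all add: m_assoc[symmetric])
  have "x \<otimes> y \<otimes> x = inv (y \<otimes> x \<otimes> y)"
    using assms(1,2,5) by (intro inv_equality[symmetric]) (simp_all add: m_assoc)
  also have "\<dots> = y \<otimes> x \<otimes> y"
    using assms by (intro inv_equality) (simp_all add: m_assoc xx yy)
  finally show ?thesis .
qed

text \<open>In the plane, \<open>a\<close>, \<open>b\<close> and \<open>c\<close> are the reflections in the sides of a triangle.  The
  reflections \<open>a\<close> and \<open>b\<close> generate the stabilizer of a vertex, which becomes the origin, while \<open>u\<close> and \<open>w\<close>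
  are translations that generate the whole lattice of translations.\<close>

locale triangle_relations = group G for G (structure) and a b c +
  assumes closed [simp]: "a \<in> carrier G" "b \<in> carrier G" "c \<in> carrier G"
    and squares: "a \<otimes> a = \<one>" "b \<otimes> b = \<one>" "c \<otimes> c = \<one>"
    and braids: "a \<otimes> b \<otimes> a = b \<otimes> a \<otimes> b" "b \<otimes> c \<otimes> b = c \<otimes> b \<otimes> c" "c \<otimes> a \<otimes> c = a \<otimes> c \<otimes> a"
begin

definition u where "u = a \<otimes> c \<otimes> a \<otimes> b"
definition w where "w = b \<otimes> c \<otimes> b \<otimes> a"
definition lattice where "lattice i j = u [^] (i::int) \<otimes> w [^] (j::int)"
definition finite_part where "finite_part = {\<one>, a, b, a \<otimes> b, b \<otimes> a, a \<otimes> b \<otimes> a}"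

lemma uw_closed [simp]: "u \<in> carrier G" "w \<in> carrier G" "lattice i j \<in> carrier G"
  by (simp_all add: u_def w_def lattice_def)

lemma finite_part_closed: "finite_part \<subseteq> carrier G"
  by (auto simp: finite_part_def)

lemma inverses: "inv a = a" "inv b = b" "inv c = c"
  using squares by (simp_all add: inv_equality)

lemma cancel:
  assumes "x \<in> carrier G"
  shows "a \<otimes> (a \<otimes> x) = x" "b \<otimes> (b \<otimes> x) = x" "c \<otimes> (c \<otimes> x) = x"
  using assms squares by (simp_all add: m_assoc[symmetric])

lemma braid:
  "b \<otimes> (a \<otimes> b) = a \<otimes> (b \<otimes> a)" "c \<otimes> (b \<otimes> c) = b \<otimes> (c \<otimes> b)" "c \<otimes> (a \<otimes> c) = a \<otimes> (c \<otimes> a)"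
  using braids by (simp_all add: m_assoc)

lemma braid':
  assumes "x \<in> carrier G"
  shows "b \<otimes> (a \<otimes> (b \<otimes> x)) = a \<otimes> (b \<otimes> (a \<otimes> x))" "c \<otimes> (b \<otimes> (c \<otimes> x)) = b \<otimes> (c \<otimes> (b \<otimes> x))"
    "c \<otimes> (a \<otimes> (c \<otimes> x)) = a \<otimes> (c \<otimes> (a \<otimes> x))"
proof -
  have "b \<otimes> (a \<otimes> b) \<otimes> x = a \<otimes> (b \<otimes> a) \<otimes> x" "c \<otimes> (b \<otimes> c) \<otimes> x = b \<otimes> (c \<otimes> b) \<otimes> x"
    "c \<otimes> (a \<otimes> c) \<otimes> x = a \<otimes> (c \<otimes> a) \<otimes> x"
    by (simp_all only: braid)
  then show "b \<otimes> (a \<otimes> (b \<otimes> x)) = a \<otimes> (b \<otimes> (a \<otimes> x))" "c \<otimes> (b \<otimes> (c \<otimes> x)) = b \<otimes> (c \<otimes> (b \<otimes> x))"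
    "c \<otimes> (a \<otimes> (c \<otimes> x)) = a \<otimes> (c \<otimes> (a \<otimes> x))"
    using assms by (simp_all add: m_assoc)
qed

text \<open>Oriented from left to right these equations need not decide the word problem, but they suffice
  for the few identities below.\<close>

lemmas rewrite_words = m_assoc squares cancel braid braid' inverses inv_mult_group

lemma uw_commute: "u \<otimes> w = w \<otimes> u"
  by (simp add: u_def w_def rewrite_words)

lemma lattice_mult: "lattice i j \<otimes> lattice k l = lattice (i + k) (j + l)"
proof -
  have "lattice i j \<otimes> lattice k l = u [^] i \<otimes> (w [^] j \<otimes> u [^] k) \<otimes> w [^] l"
    by (simp add: lattice_def m_assoc)
  also have "w [^] j \<otimes> u [^] k = u [^] k \<otimes> w [^] j"
    by (rule int_pow_commutes) (simp_all add: uw_commute)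
  finally show ?thesis by (simp add: lattice_def int_pow_mult m_assoc)
qed

lemma lattice_0 [simp]: "lattice 0 0 = \<one>"
  by (simp add: lattice_def)

text \<open>The reflection \<open>c\<close> is \<open>uw\<close> times the parallel reflection \<open>aba\<close> through the origin.  So \<open>sc\<close> is the
  conjugate of \<open>uw\<close> by \<open>s\<close>, which is one of \<open>u\<close>, \<open>w\<close>, \<open>uw\<close> or one of their inverses, times \<open>s(aba)\<close>.\<close>

lemma finite_part_times_generator:
  assumes s: "s \<in> finite_part" and g: "g \<in> {a, b, c}"
  shows "\<exists>i j. \<exists>s'\<in>finite_part. s \<otimes> g = lattice i j \<otimes> s'"
proof (cases "g = c")
  case False
  then have "s \<otimes> g \<in> finite_part" using s g by (auto simp: finite_part_def rewrite_words)
  then show ?thesis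
    by (intro exI[of _ 0] bexI[of _ "s \<otimes> g"]) (use finite_part_closed in auto)
next
  case True
  have powers: "lattice 1 0 = u" "lattice (- 1) 0 = inv u" "lattice 0 1 = w" "lattice 0 (- 1) = inv w"
    "lattice 1 1 = u \<otimes> w" "lattice (- 1) (- 1) = inv u \<otimes> inv w"
    using int_pow_neg[of u 1] int_pow_neg[of w 1] by (simp_all add: lattice_def)
  have "\<one> \<otimes> c = lattice 1 1 \<otimes> (a \<otimes> b \<otimes> a)" "a \<otimes> c = lattice 1 0 \<otimes> (b \<otimes> a)"
    "b \<otimes> c = lattice 0 1 \<otimes> (a \<otimes> b)" "(a \<otimes> b) \<otimes> c = lattice 0 (- 1) \<otimes> b"
    "(b \<otimes> a) \<otimes> c = lattice (- 1) 0 \<otimes> a" "(a \<otimes> b \<otimes> a) \<otimes> c = lattice (- 1) (- 1) \<otimes> \<one>"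
    unfolding powers by (simp_all add: u_def w_def rewrite_words)
  then show ?thesis using s unfolding True finite_part_def by (elim insertE emptyE; simp only:; blast)
qed

definition normal_forms where "normal_forms = {lattice i j \<otimes> s | i j s. s \<in> finite_part}"

lemma normal_forms_one: "\<one> \<in> normal_forms"
  unfolding normal_forms_def
  by (rule CollectI, intro exI[of _ 0] exI[of _ \<one>]) (simp add: finite_part_def)

lemma normal_forms_times_generator:
  assumes "x \<in> normal_forms" "g \<in> {a, b, c}"
  shows "x \<otimes> g \<in> normal_forms"
proof -
  obtain i j s where x: "x = lattice i j \<otimes> s" "s \<in> finite_part" using assms by (auto simp: normal_forms_def)
  obtain k l s' where s': "s' \<in> finite_part" "s \<otimes> g = lattice k l \<otimes> s'"
    using finite_part_times_generator[OF x(2) assms(2)] by blast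
  have car: "s \<in> carrier G" "s' \<in> carrier G" "g \<in> carrier G" using x s' assms(2) finite_part_closed by auto
  then have "x \<otimes> g = lattice i j \<otimes> (s \<otimes> g)" by (simp add: x m_assoc)
  also have "\<dots> = lattice (i + k) (j + l) \<otimes> s'" using car by (simp add: s'(2) lattice_mult[symmetric] m_assoc)
  finally show ?thesis using s'(1) unfolding normal_forms_def by blast
qed

end

section \<open>The triangle group acts on a lattice\<close>

text \<open>The affine reflections in coordinates with respect to the basis \<open>u\<close>, \<open>w\<close> of the lattice.  Only the
  mirror of \<open>c\<close> misses the origin.\<close>

fun reflect :: "tri_gen \<Rightarrow> int \<times> int \<Rightarrow> int \<times> int" where
  "reflect Ta (i, j) = (i, i - j)"
| "reflect Tb (i, j) = (j - i, j)"
| "reflect Tc (i, j) = (1 - j, 1 - i)"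

definition word_act :: "tri_gen word \<Rightarrow> int \<times> int \<Rightarrow> int \<times> int" where
  "word_act = foldr (\<lambda>l. reflect (fst l))"

lemma word_act_simps [simp]:
  "word_act [] p = p" "word_act (l # ls) p = reflect (fst l) (word_act ls p)"
  "word_act (ls @ ls') p = word_act ls (word_act ls' p)"
  by (simp_all add: word_act_def)

lemma reflect_reflect [simp]: "reflect x (reflect x p) = p"
  by (cases p; cases x) auto

lemma word_act_pres_eq:
  assumes "pres_eq tri_relators v w"
  shows "word_act v p = word_act w p"
  using assms
proof (induction arbitrary: p rule: pres_eq.induct)
  case (relator r)
  then show ?case by (cases p) (auto simp: tri_relators_def Let_def)
qed auto

definition tri_act :: "tri_gen word set \<Rightarrow> int \<times> int \<Rightarrow> int \<times> int" where
  "tri_act X = word_act (SOME v. v \<in> X)"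

lemma tri_act_word_class [simp]: "tri_act (word_class tri_relators v) = word_act v"
proof
  fix p
  have "v \<in> word_class tri_relators v" by (simp add: word_class_def pres_eq.refl)
  then have "(SOME v'. v' \<in> word_class tri_relators v) \<in> word_class tri_relators v" by (rule someI)
  then show "tri_act (word_class tri_relators v) p = word_act v p"
    using word_act_pres_eq by (simp add: tri_act_def word_class_def)
qed

interpretation T: group triangle_group_333
  unfolding triangle_group_333_def by (rule group_presented_group)

lemma tri_carrier: "carrier triangle_group_333 = range (word_class tri_relators)"
  and tri_one: "\<one>\<^bsub>triangle_group_333\<^esub> = word_class tri_relators []"
  and tri_mult: "word_class tri_relators v \<otimes>\<^bsub>triangle_group_333\<^esub> word_class tri_relators w
    = word_class tri_relators (v @ w)"
  by (simp_all add: triangle_group_333_def presented_group_mult) (simp_all add: presented_group_def)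

abbreviation gen :: "tri_gen \<Rightarrow> tri_gen word set" where
  "gen x \<equiv> word_class tri_relators [(x, True)]"

lemma relators_one:
  "word_class tri_relators [(x, True), (x, True)] = \<one>\<^bsub>triangle_group_333\<^esub>"
  "(x, y) \<in> {(Ta, Tb), (Tb, Tc), (Tc, Ta)} \<Longrightarrow>
    word_class tri_relators [(x, True), (y, True), (x, True), (y, True), (x, True), (y, True)]
      = \<one>\<^bsub>triangle_group_333\<^esub>"
proof -
  have "word_class tri_relators r = \<one>\<^bsub>triangle_group_333\<^esub>" if "r \<in> tri_relators" for r
    using that by (simp add: tri_one word_class_eq_iff pres_eq.relator)
  moreover have "[(x, True), (x, True)] \<in> tri_relators"
    by (cases x) (simp_all add: tri_relators_def Let_def)
  moreover have "[(x, True), (y, True), (x, True), (y, True), (x, True), (y, True)] \<in> tri_relators"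
    if "(x, y) \<in> {(Ta, Tb), (Tb, Tc), (Tc, Ta)}"
    using that by (auto simp: tri_relators_def Let_def)
  ultimately show "word_class tri_relators [(x, True), (x, True)] = \<one>\<^bsub>triangle_group_333\<^esub>"
    "(x, y) \<in> {(Ta, Tb), (Tb, Tc), (Tc, Ta)} \<Longrightarrow>
      word_class tri_relators [(x, True), (y, True), (x, True), (y, True), (x, True), (y, True)]
        = \<one>\<^bsub>triangle_group_333\<^esub>"
    by blast+
qed

lemma gen_closed: "word_class tri_relators v \<in> carrier triangle_group_333"
  by (simp add: tri_carrier)

interpretation T: triangle_relations triangle_group_333 "gen Ta" "gen Tb" "gen Tc"
proof
  show sq: "gen Ta \<otimes>\<^bsub>triangle_group_333\<^esub> gen Ta = \<one>\<^bsub>triangle_group_333\<^esub>"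
    "gen Tb \<otimes>\<^bsub>triangle_group_333\<^esub> gen Tb = \<one>\<^bsub>triangle_group_333\<^esub>"
    "gen Tc \<otimes>\<^bsub>triangle_group_333\<^esub> gen Tc = \<one>\<^bsub>triangle_group_333\<^esub>"
    by (simp_all add: tri_mult relators_one)
  show "gen Ta \<otimes>\<^bsub>triangle_group_333\<^esub> gen Tb \<otimes>\<^bsub>triangle_group_333\<^esub> gen Ta
      = gen Tb \<otimes>\<^bsub>triangle_group_333\<^esub> gen Ta \<otimes>\<^bsub>triangle_group_333\<^esub> gen Tb"
    by (rule T.involutions_braid) (simp_all add: sq gen_closed, simp_all add: tri_mult relators_one)
  show "gen Tb \<otimes>\<^bsub>triangle_group_333\<^esub> gen Tc \<otimes>\<^bsub>triangle_group_333\<^esub> gen Tb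
      = gen Tc \<otimes>\<^bsub>triangle_group_333\<^esub> gen Tb \<otimes>\<^bsub>triangle_group_333\<^esub> gen Tc"
    by (rule T.involutions_braid) (simp_all add: sq gen_closed, simp_all add: tri_mult relators_one)
  show "gen Tc \<otimes>\<^bsub>triangle_group_333\<^esub> gen Ta \<otimes>\<^bsub>triangle_group_333\<^esub> gen Tc
      = gen Ta \<otimes>\<^bsub>triangle_group_333\<^esub> gen Tc \<otimes>\<^bsub>triangle_group_333\<^esub> gen Ta"
    by (rule T.involutions_braid) (simp_all add: sq gen_closed, simp_all add: tri_mult relators_one)
qed (simp_all add: gen_closed)

text \<open>Right multiplication by a generator keeps normal forms, and every letter of a word is one of the
  generators, which are their own inverses.\<close>

lemma tri_normal_form:
  assumes "X \<in> carrier triangle_group_333"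
  obtains i j s where "s \<in> T.finite_part" "X = T.lattice i j \<otimes>\<^bsub>triangle_group_333\<^esub> s"
proof -
  have "word_class tri_relators v \<in> T.normal_forms" for v
  proof (induction v rule: rev_induct)
    case Nil
    show ?case using T.normal_forms_one by (simp add: tri_one)
  next
    case (snoc l v)
    obtain x e where l: "l = (x, e)" by (cases l)
    have "pres_eq tri_relators [(x, False)] [(x, True)]"
    proof -
      have "word_class tri_relators [(x, False)] \<otimes>\<^bsub>triangle_group_333\<^esub> gen x = \<one>\<^bsub>triangle_group_333\<^esub>"
        using pres_eq.cancel[of tri_relators x False] by (simp add: tri_mult tri_one word_class_eq_iff)
      moreover have "gen x \<otimes>\<^bsub>triangle_group_333\<^esub> gen x = \<one>\<^bsub>triangle_group_333\<^esub>"
        using T.squares by (cases x) auto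
      ultimately show ?thesis
        unfolding word_class_eq_iff[symmetric] using gen_closed by (metis T.right_cancel)
    qed
    then have "word_class tri_relators [l] = gen x"
      using l by (cases e) (auto simp: word_class_eq_iff pres_eq.refl)
    then have "word_class tri_relators (v @ [l]) = word_class tri_relators v \<otimes>\<^bsub>triangle_group_333\<^esub> gen x"
      by (simp add: tri_mult[symmetric])
    then show ?case using T.normal_forms_times_generator[OF snoc] by (cases x) auto
  qed
  moreover obtain v where "X = word_class tri_relators v" using assms unfolding tri_carrier by blast
  ultimately have "X \<in> T.normal_forms" by blast
  then show ?thesis using that unfolding T.normal_forms_def by blast
qed

lemma tri_act_mult:
  assumes "X \<in> carrier triangle_group_333" "Y \<in> carrier triangle_group_333"
  shows "tri_act (X \<otimes>\<^bsub>triangle_group_333\<^esub> Y) p = tri_act X (tri_act Y p)"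
  using assms by (auto simp: tri_carrier tri_mult)

lemma tri_act_one [simp]: "tri_act \<one>\<^bsub>triangle_group_333\<^esub> p = p"
  by (simp add: tri_one)

lemma tri_act_inv [simp]:
  assumes "X \<in> carrier triangle_group_333"
  shows "tri_act (inv\<^bsub>triangle_group_333\<^esub> X) (tri_act X p) = p"
    "tri_act X (tri_act (inv\<^bsub>triangle_group_333\<^esub> X) p) = p"
  using assms by (simp_all add: tri_act_mult[symmetric])

lemma hex_norm_reflect: "hex_norm (reflect x p - reflect x q) = hex_norm (p - q)"
proof -
  obtain i j k l where pq: "p = (i, j)" "q = (k, l)" by (cases p; cases q)
  have "\<bar>i - j - (k - l)\<bar> = \<bar>i - k - (j - l)\<bar>" "\<bar>j - i - (l - k)\<bar> = \<bar>i - k - (j - l)\<bar>"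
    "\<bar>k - i\<bar> = \<bar>i - k\<bar>" "\<bar>l - j\<bar> = \<bar>j - l\<bar>" "\<bar>l - j - (k - i)\<bar> = \<bar>i - k - (j - l)\<bar>"
    by linarith+
  then show ?thesis by (cases x) (simp_all add: pq hex_norm_def max.commute max.left_commute)
qed

lemma hex_norm_tri_act:
  assumes "X \<in> carrier triangle_group_333"
  shows "hex_norm (tri_act X p - tri_act X q) = hex_norm (p - q)"
proof -
  obtain v where X: "X = word_class tri_relators v" using assms by (auto simp: tri_carrier)
  show ?thesis unfolding X tri_act_word_class by (induction v) (simp_all add: hex_norm_reflect)
qed

lemma tri_act_int_pow:
  assumes X: "X \<in> carrier triangle_group_333" and act: "\<And>p. tri_act X p = p + v"
  shows "tri_act (X [^]\<^bsub>triangle_group_333\<^esub> (i::int)) p = p + (i * fst v, i * snd v)"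
proof -
  have nat: "tri_act (X [^]\<^bsub>triangle_group_333\<^esub> n) p = p + (int n * fst v, int n * snd v)" for n :: nat and p
    by (induction n arbitrary: p)
      (simp_all add: tri_act_mult X act prod_eq_iff algebra_simps)
  show ?thesis
  proof (cases i rule: int_cases2)
    case (nonneg n)
    then show ?thesis using nat by (simp add: int_pow_int)
  next
    case (nonpos n)
    let ?Y = "X [^]\<^bsub>triangle_group_333\<^esub> n" and ?q = "p + (i * fst v, i * snd v)"
    have "tri_act ?Y ?q = p" using nat[of n ?q] nonpos by (simp add: prod_eq_iff)
    then have "tri_act (inv\<^bsub>triangle_group_333\<^esub> ?Y) p = ?q" using tri_act_inv(1)[of ?Y ?q] X by simp
    then show ?thesis using nonpos X by (simp add: T.int_pow_neg_int)
  qed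
qed

lemma tri_act_lattice: "tri_act (T.lattice i j) p = p + (i, j)"
proof -
  have "tri_act T.u p = p + (1, 0)" "tri_act T.w p = p + (0, 1)" for p
    by (cases p; simp add: T.u_def T.w_def tri_mult)+
  then have "tri_act (T.u [^]\<^bsub>triangle_group_333\<^esub> i) p = p + (i, 0)"
    "tri_act (T.w [^]\<^bsub>triangle_group_333\<^esub> j) p = p + (0, j)" for p
    using tri_act_int_pow[OF T.uw_closed(1), of "(1, 0)"] tri_act_int_pow[OF T.uw_closed(2), of "(0, 1)"]
    by simp_all
  then show ?thesis by (simp add: T.lattice_def tri_act_mult)
qed

lemma tri_act_finite_part:
  assumes "s \<in> T.finite_part"
  shows "tri_act s (0, 0) = (0, 0)"
  using assms by (auto simp: T.finite_part_def tri_act_mult gen_closed)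

text \<open>Comparing images of the origin identifies the lattice part of the normal form.  The finite part then
  fixes both basis vectors, and among the six candidates only the identity does.\<close>

lemma tri_translation_eq_lattice:
  assumes X: "X \<in> carrier triangle_group_333" and act: "\<And>p. tri_act X p = p + v"
  shows "X = T.lattice (fst v) (snd v)"
proof -
  obtain i j s where s: "s \<in> T.finite_part" and nf: "X = T.lattice i j \<otimes>\<^bsub>triangle_group_333\<^esub> s"
    using tri_normal_form[OF X] .
  have sG: "s \<in> carrier triangle_group_333" using s T.finite_part_closed by blast
  have eq: "tri_act s p + (i, j) = p + v" for p
    using act[of p] sG by (simp add: nf tri_act_mult tri_act_lattice)
  have v: "v = (i, j)" using eq[of "(0, 0)"] tri_act_finite_part[OF s] by (simp add: prod_eq_iff)
  then have "tri_act s (1, 0) = (1, 0)" "tri_act s (0, 1) = (0, 1)" using eq by auto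
  then have "s = \<one>\<^bsub>triangle_group_333\<^esub>"
    using s by (auto simp: T.finite_part_def tri_act_mult gen_closed)
  then show ?thesis by (simp add: nf v)
qed


section \<open>The translations and the rotation of order three\<close>

text \<open>The vertex \<open>(0, 0)\<close> has the finite part as its stabilizer, so this map has finite fibres.\<close>

definition orbit_map :: "tri_gen word set \<Rightarrow> int \<times> int" where
  "orbit_map X = tri_act X (0, 0)"

text \<open>Described by the action, the translations are visibly invariant under conjugation; that they are the
  elements \<open>T.lattice i j\<close> is then a consequence of the normal form.\<close>

definition translation_subgroup :: "tri_gen word set set" where
  "translation_subgroup = {X \<in> carrier triangle_group_333. \<exists>v. \<forall>p. tri_act X p = p + v}"

lemma orbit_map_normal_form:
  assumes "s \<in> T.finite_part"
  shows "orbit_map (T.lattice i j \<otimes>\<^bsub>triangle_group_333\<^esub> s) = (i, j)"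
  using assms T.finite_part_closed
  by (simp add: orbit_map_def tri_act_mult tri_act_lattice tri_act_finite_part subset_iff)

lemma lattice_in_translations: "T.lattice i j \<in> translation_subgroup"
  by (auto simp: translation_subgroup_def tri_act_lattice)

lemma orbit_map_lattice [simp]: "orbit_map (T.lattice i j) = (i, j)"
  by (simp add: orbit_map_def tri_act_lattice)

lemma translationsD:
  assumes "X \<in> translation_subgroup"
  shows "X \<in> carrier triangle_group_333" "tri_act X p = p + orbit_map X"
    "X = T.lattice (fst (orbit_map X)) (snd (orbit_map X))"
proof -
  obtain v where X: "X \<in> carrier triangle_group_333" and v: "\<And>p. tri_act X p = p + v"
    using assms by (auto simp: translation_subgroup_def)
  then have "orbit_map X = v" by (simp add: orbit_map_def prod_eq_iff)
  then show "X \<in> carrier triangle_group_333" "tri_act X p = p + orbit_map X"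
    "X = T.lattice (fst (orbit_map X)) (snd (orbit_map X))"
    using X v tri_translation_eq_lattice[OF X v] by simp_all
qed

lemma orbit_map_mult:
  assumes "X \<in> carrier triangle_group_333" "Y \<in> carrier triangle_group_333"
  shows "orbit_map (X \<otimes>\<^bsub>triangle_group_333\<^esub> Y) = tri_act X (orbit_map Y)"
  using assms by (simp add: orbit_map_def tri_act_mult)

lemma orbit_map_mult_translations:
  assumes "X \<in> translation_subgroup" "Y \<in> translation_subgroup"
  shows "orbit_map (X \<otimes>\<^bsub>triangle_group_333\<^esub> Y) = orbit_map X + orbit_map Y"
  using translationsD(1)[OF assms(1)] translationsD(1)[OF assms(2)]
  by (simp add: orbit_map_mult translationsD(2)[OF assms(1)] add.commute)

lemma subgroup_translations: "subgroup translation_subgroup triangle_group_333"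
proof
  show "translation_subgroup \<subseteq> carrier triangle_group_333" by (auto simp: translation_subgroup_def)
  show "\<one>\<^bsub>triangle_group_333\<^esub> \<in> translation_subgroup"
    using lattice_in_translations[of 0 0] by simp
  show "X \<otimes>\<^bsub>triangle_group_333\<^esub> Y \<in> translation_subgroup" if "X \<in> translation_subgroup" "Y \<in> translation_subgroup" for X Y
    using lattice_in_translations translationsD(3)[OF that(1)] translationsD(3)[OF that(2)] T.lattice_mult
    by metis
  show "inv\<^bsub>triangle_group_333\<^esub> X \<in> translation_subgroup" if X: "X \<in> translation_subgroup" for X
  proof -
    define i j where "i = fst (orbit_map X)" and "j = snd (orbit_map X)"
    have "X = T.lattice i j" using translationsD(3)[OF X] by (simp add: i_def j_def)
    then have "inv\<^bsub>triangle_group_333\<^esub> X = T.lattice (- i) (- j)"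
      by (intro T.inv_equality) (simp_all add: T.lattice_mult)
    then show ?thesis using lattice_in_translations by simp
  qed
qed

lemma finite_index_translations: "finite (rcosets\<^bsub>triangle_group_333\<^esub> translation_subgroup)"
proof (rule finite_subset)
  show "rcosets\<^bsub>triangle_group_333\<^esub> translation_subgroup
      \<subseteq> (\<lambda>s. translation_subgroup #>\<^bsub>triangle_group_333\<^esub> s) ` T.finite_part"
  proof
    fix C assume "C \<in> rcosets\<^bsub>triangle_group_333\<^esub> translation_subgroup"
    then obtain X where X: "X \<in> carrier triangle_group_333" "C = translation_subgroup #>\<^bsub>triangle_group_333\<^esub> X"
      by (auto simp: RCOSETS_def)
    obtain i j s where s: "s \<in> T.finite_part" "X = T.lattice i j \<otimes>\<^bsub>triangle_group_333\<^esub> s"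
      using tri_normal_form[OF X(1)] .
    have "C = translation_subgroup #>\<^bsub>triangle_group_333\<^esub> T.lattice i j #>\<^bsub>triangle_group_333\<^esub> s"
      using s T.finite_part_closed subgroup.subset[OF subgroup_translations]
      by (simp add: X(2) T.coset_mult_assoc subset_iff)
    also have "translation_subgroup #>\<^bsub>triangle_group_333\<^esub> T.lattice i j = translation_subgroup"
      using subgroup_translations lattice_in_translations by (intro T.coset_join2) simp_all
    finally show "C \<in> (\<lambda>s. translation_subgroup #>\<^bsub>triangle_group_333\<^esub> s) ` T.finite_part"
      using s(1) by blast
  qed
  show "finite ((\<lambda>s. translation_subgroup #>\<^bsub>triangle_group_333\<^esub> s) ` T.finite_part)"
    by (simp add: T.finite_part_def)
qed

lemma translations_generated:
  "generate triangle_group_333 {T.u, T.w} = translation_subgroup"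
proof
  have uw: "{T.u, T.w} \<subseteq> translation_subgroup"
    using lattice_in_translations[of 1 0] lattice_in_translations[of 0 1] by (simp add: T.lattice_def)
  then show "generate triangle_group_333 {T.u, T.w} \<subseteq> translation_subgroup"
    using T.generate_subgroup_incl subgroup_translations by blast
  have sub: "subgroup (generate triangle_group_333 {T.u, T.w}) triangle_group_333"
    by (rule T.generate_is_subgroup) simp
  have "T.lattice i j \<in> generate triangle_group_333 {T.u, T.w}" for i j
    unfolding T.lattice_def
    by (intro subgroup.m_closed[OF sub] T.subgroup_int_pow_closed[OF sub] generate.incl) simp_all
  then show "translation_subgroup \<subseteq> generate triangle_group_333 {T.u, T.w}"
    using translationsD(3) by (metis subsetI)
qed

text \<open>On the translations the orbit map is an isomorphism onto \<open>\<int>\<^sup>2\<close>.\<close>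

lemma virtually_hierarchically_hyperbolic_triangle_group:
  "virtually_hierarchically_hyperbolic_group TYPE(nat) TYPE(real) triangle_group_333"
proof -
  let ?H = "triangle_group_333\<lparr>carrier := translation_subgroup\<rparr>"
  interpret H: group ?H by (rule T.subgroup_imp_group[OF subgroup_translations])
  have uw: "{T.u, T.w} \<subseteq> translation_subgroup"
    using translations_generated generate.incl by (metis subsetI)
  have "hierarchically_hyperbolic_group TYPE(nat) TYPE(real) ?H"
  proof (rule H.hierarchically_hyperbolic_group_lattice[where F = orbit_map])
    show "finite_generating_set ?H {T.u, T.w}"
      using T.generate_consistent[OF uw subgroup_translations] uw translations_generated
      by (simp add: finite_generating_set_def)
    show "orbit_map (X \<otimes>\<^bsub>?H\<^esub> Y) = orbit_map X + orbit_map Y" if "X \<in> carrier ?H" "Y \<in> carrier ?H" for X Y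
      using that by (simp add: orbit_map_mult_translations)
    show "bij_betw orbit_map (carrier ?H) UNIV"
    proof (rule bij_betw_byWitness[where f' = "\<lambda>v. T.lattice (fst v) (snd v)"])
      show "\<forall>X\<in>carrier ?H. T.lattice (fst (orbit_map X)) (snd (orbit_map X)) = X"
        using translationsD(3) by simp
      show "(\<lambda>v. T.lattice (fst v) (snd v)) ` UNIV \<subseteq> carrier ?H"
        using lattice_in_translations by auto
    qed auto
  qed
  then show ?thesis
    unfolding virtually_hierarchically_hyperbolic_group_def
    using subgroup_translations finite_index_translations by blast
qed

text \<open>The triangle group acts on the lattice by isometries of the hexagonal norm, so its orbit map
  provides plane coordinates for every word metric.\<close>

lemma hierarchically_hyperbolic_space_triangle_group:
  assumes gen: "finite_generating_set triangle_group_333 A"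
  shows "hierarchically_hyperbolic_space TYPE(nat) TYPE(real) (word_metric triangle_group_333 A)"
proof -
  have "hex_norm (orbit_map Y - orbit_map X) = hex_norm (orbit_map (inv\<^bsub>triangle_group_333\<^esub> X \<otimes>\<^bsub>triangle_group_333\<^esub> Y))"
    if X: "X \<in> carrier triangle_group_333" and Y: "Y \<in> carrier triangle_group_333" for X Y
  proof -
    let ?Z = "inv\<^bsub>triangle_group_333\<^esub> X \<otimes>\<^bsub>triangle_group_333\<^esub> Y"
    have "orbit_map Y = tri_act X (orbit_map ?Z)" using X Y by (simp add: orbit_map_mult)
    moreover have "orbit_map X = tri_act X 0" by (simp add: orbit_map_def zero_prod_def)
    ultimately show ?thesis using hex_norm_tri_act[OF X, of "orbit_map ?Z" 0] by simp
  qed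
  moreover have "\<exists>X\<in>carrier triangle_group_333. orbit_map X = v" for v
    by (intro bexI[of _ "T.lattice (fst v) (snd v)"]) simp_all
  moreover have "finite {X \<in> carrier triangle_group_333. hex_norm (orbit_map X) \<le> k}" for k
  proof (rule finite_subset)
    let ?nf = "\<lambda>((i, j), s). T.lattice i j \<otimes>\<^bsub>triangle_group_333\<^esub> s"
    show "{X \<in> carrier triangle_group_333. hex_norm (orbit_map X) \<le> k}
        \<subseteq> ?nf ` (({-k..k} \<times> {-k..k}) \<times> T.finite_part)"
    proof
      fix X assume X: "X \<in> {X \<in> carrier triangle_group_333. hex_norm (orbit_map X) \<le> k}"
      then obtain i j s where s: "s \<in> T.finite_part" "X = T.lattice i j \<otimes>\<^bsub>triangle_group_333\<^esub> s"
        using tri_normal_form by blast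
      have "\<bar>i\<bar> \<le> k" "\<bar>j\<bar> \<le> k"
        using X abs_coordinates_le_hex_norm[of "(i, j)"] s(1) by (simp_all add: s(2) orbit_map_normal_form)
      then show "X \<in> ?nf ` (({-k..k} \<times> {-k..k}) \<times> T.finite_part)"
        using s by (intro image_eqI[of _ _ "((i, j), s)"]) auto
    qed
    show "finite (?nf ` (({-k..k} \<times> {-k..k}) \<times> T.finite_part))"
      by (simp add: T.finite_part_def)
  qed
  ultimately show ?thesis
    unfolding hierarchically_hyperbolic_space_def
    using group.hhs_structure_lattice_coordinates[OF T.is_group gen, of orbit_map] by blast
qed

text \<open>The rotation \<open>r = ab\<close> turns a vector \<open>v\<close> by a third of a full turn, so \<open>v\<close>, \<open>r\<inverse>v\<close> and \<open>r\<^sup>-\<^sup>2v\<close> add up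
  to zero.\<close>

lemma not_hierarchically_hyperbolic_triangle_group:
  "\<not> hierarchically_hyperbolic_group TYPE('d) TYPE('c) triangle_group_333"
proof
  let ?T = triangle_group_333
  assume "hierarchically_hyperbolic_group TYPE('d) TYPE('c) ?T"
  then obtain A and S :: "(tri_gen word set, 'd, 'c) hhs" and \<phi> \<psi> where "hhg_structure ?T A S \<phi> \<psi>"
    unfolding hierarchically_hyperbolic_group_def by blast
  then interpret hhg_structure ?T A S \<phi> \<psi> .
  define r where "r = gen Ta \<otimes>\<^bsub>?T\<^esub> gen Tb"
  have r: "r \<in> carrier ?T" by (simp add: r_def)
  have r3: "r \<otimes>\<^bsub>?T\<^esub> r \<otimes>\<^bsub>?T\<^esub> r = \<one>\<^bsub>?T\<^esub>"
    by (simp add: r_def tri_mult relators_one)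
  have inv_r: "inv\<^bsub>?T\<^esub> r = gen Tb \<otimes>\<^bsub>?T\<^esub> gen Ta"
    by (simp add: r_def T.inv_mult_group T.inverses)
  have act_r: "tri_act r (i, j) = (j - i, - i)" "tri_act (inv\<^bsub>?T\<^esub> r) (i, j) = (- j, i - j)" for i j
    unfolding inv_r by (simp_all add: r_def tri_act_mult)
  let ?conj = "\<lambda>l. inv\<^bsub>?T\<^esub> r \<otimes>\<^bsub>?T\<^esub> l \<otimes>\<^bsub>?T\<^esub> r"
  have act_conj: "tri_act (?conj l) p = p + tri_act (inv\<^bsub>?T\<^esub> r) (orbit_map l)"
    if l: "l \<in> translation_subgroup" for l p
    using translationsD(1,2)[OF l] r
    by (cases p; cases "orbit_map l") (simp add: tri_act_mult act_r)
  have conj: "?conj l \<in> translation_subgroup" if l: "l \<in> translation_subgroup" for l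
  proof -
    have "?conj l \<in> carrier ?T" using translationsD(1)[OF l] r by simp
    then show ?thesis using act_conj[OF l] unfolding translation_subgroup_def by blast
  qed
  have orbit_conj: "orbit_map (?conj l) = tri_act (inv\<^bsub>?T\<^esub> r) (orbit_map l)" if l: "l \<in> translation_subgroup" for l
    using act_conj[OF l, of "(0, 0)"] by (simp add: orbit_map_def prod_eq_iff)
  have comm: "x \<otimes>\<^bsub>?T\<^esub> y = y \<otimes>\<^bsub>?T\<^esub> x" if "x \<in> translation_subgroup" "y \<in> translation_subgroup" for x y
    using translationsD(3)[OF that(1)] translationsD(3)[OF that(2)] by (metis T.lattice_mult add.commute)
  have norm: "l \<otimes>\<^bsub>?T\<^esub> ?conj l \<otimes>\<^bsub>?T\<^esub> ?conj (?conj l) = \<one>\<^bsub>?T\<^esub>" if l: "l \<in> translation_subgroup" for l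
  proof -
    let ?X = "l \<otimes>\<^bsub>?T\<^esub> ?conj l \<otimes>\<^bsub>?T\<^esub> ?conj (?conj l)"
    have in_L: "?conj l \<in> translation_subgroup" "?conj (?conj l) \<in> translation_subgroup" using conj l by blast+
    note closed = subgroup.m_closed[OF subgroup_translations]
    have X: "?X \<in> translation_subgroup" by (rule closed[OF closed[OF l in_L(1)] in_L(2)])
    have "orbit_map ?X = orbit_map l + orbit_map (?conj l) + orbit_map (?conj (?conj l))"
      using orbit_map_mult_translations[OF closed[OF l in_L(1)] in_L(2)]
        orbit_map_mult_translations[OF l in_L(1)] by simp
    also have "\<dots> = (0, 0)"
      unfolding orbit_conj[OF in_L(1)] orbit_conj[OF l]
      by (cases "orbit_map l") (simp add: act_r)
    finally show ?thesis using translationsD(3)[OF X] by simp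
  qed
  have "infinite (carrier ?T)"
  proof
    assume "finite (carrier ?T)"
    then have "finite (orbit_map ` carrier ?T)" by simp
    moreover have "(i, 0) \<in> orbit_map ` carrier ?T" for i
      by (rule image_eqI[of _ _ "T.lattice i 0"]) simp_all
    then have "range (\<lambda>i. (i, 0)) \<subseteq> orbit_map ` carrier ?T" by blast
    ultimately have "finite (range (\<lambda>i :: int. (i, 0 :: int)))" using finite_subset by blast
    then show False by (simp add: finite_image_iff inj_on_def)
  qed
  then show False
    by (rule no_abelian_subgroup_rotated_freely[OF _ subgroup_translations finite_index_translations
          comm r r3 conj norm])
qed

theorem corollary4p5:
  shows "virtually_hierarchically_hyperbolic_group TYPE(nat) TYPE(real) triangle_group_333
    \<and> \<not> hierarchically_hyperbolic_group TYPE('d) TYPE('c) triangle_group_333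
    \<and> (\<forall>A. finite_generating_set triangle_group_333 A \<longrightarrow>
          hierarchically_hyperbolic_space TYPE(nat) TYPE(real) (word_metric triangle_group_333 A))"
  using virtually_hierarchically_hyperbolic_triangle_group
    not_hierarchically_hyperbolic_triangle_group hierarchically_hyperbolic_space_triangle_group
  by blast

end
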